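(* Let $n$ be a positive integer and $p$ a prime number. If $n\notin \mathcal{B}_p$, then every finite-dimensional Lie algebra $\mathfrak{g}$ over a field of characteristic $p$ admitting a periodic derivation of order $n$ is nilpotent of class $c(\mathfrak{g})\le H(n)$. If $n\in\mathcal{B}_p$, then there exists some non-nilpotent finite-dimensional Lie algebra over a field of characteristic $p$ admitting a periodic derivation of order $n$.
   Context: A derivation $D$ of a Lie algebra is called periodic of order $n$ if $D^n=\mathrm{id}$ and $D^k\neq \mathrm{id}$ for all $0<k<n$. $c(\mathfrak{g})$ denotes the nilpotency class. For a polynomial $r\in\mathbb{F}_p[t]$, its period $\mathrm{per}(r)$ is the minimal positive integer $m$ such that $r$ divides $t^m-1$ in $\mathbb{F}_p[t]$, if such an $m$ exists; it exists if and only if $r(0)\neq 0$. Define \[ \mathcal{P}_p=\{\mathrm{per}(h(t^p-t))\mid h\in\mathbb{F}_p[t],\ h(0)\neq 0,\ \deg(h)\ge 1\},\qquad \mathcal{B}_p=\mathbb{N}\cdot\mathcal{P}_p, \] so $\mathcal{B}_p$ is the set of all positive integer multiples of elements of $\mathcal{P}_p$. A subset $X$ of an additive abelian group is called arithmetically-free if there are no $\alpha,\beta\in X$ such that $\alpha+k\beta\in X$ for all integers $k\ge 0$. $H$ is the generalized Higman map: $H(n)$ is the least natural number such that every Lie ring $L$ which is graded by an abelian group $(A,+)$, i.e. $L=\bigoplus_{a\in A}L_a$ with $[L_a,L_b]\subseteq L_{a+b}$, and whose support $\{a\in A\mid L_a\neq 0\}$ is contained in an arithmetically-free subset of $A$ with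 at most $n$ elements, is nilpotent of class at most $H(n)$. (Such a number exists for each $n$ by a known theorem of Moens.) *)

theory Defs
  imports "HOL-Algebra.Generated_Groups" "Jordan_Normal_Form.Missing_VectorSpace"
    "Berlekamp_Zassenhaus.Finite_Field"
begin

text \<open>The multiplication \<open>\<otimes>\<close> of the underlying record is the Lie bracket; its
  \<open>one\<close> field is unused.\<close>

locale lie_ring = abelian_group L for L (structure) +
  assumes bracket_closed: "\<lbrakk>x \<in> carrier L; y \<in> carrier L\<rbrakk> \<Longrightarrow> x \<otimes> y \<in> carrier L"
    and bracket_l_distr: "\<lbrakk>x \<in> carrier L; y \<in> carrier L; z \<in> carrier L\<rbrakk>
      \<Longrightarrow> (x \<oplus> y) \<otimes> z = (x \<otimes> z) \<oplus> (y \<otimes> z)"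
    and bracket_r_distr: "\<lbrakk>x \<in> carrier L; y \<in> carrier L; z \<in> carrier L\<rbrakk>
      \<Longrightarrow> z \<otimes> (x \<oplus> y) = (z \<otimes> x) \<oplus> (z \<otimes> y)"
    and bracket_alternating: "x \<in> carrier L \<Longrightarrow> x \<otimes> x = \<zero>"
    and jacobi: "\<lbrakk>x \<in> carrier L; y \<in> carrier L; z \<in> carrier L\<rbrakk>
      \<Longrightarrow> (x \<otimes> (y \<otimes> z)) \<oplus> (y \<otimes> (z \<otimes> x)) \<oplus> (z \<otimes> (x \<otimes> y)) = \<zero>"

locale lie_algebra = vectorspace K L + lie_ring L for K (structure) and L (structure) +
  assumes bracket_smult_l: "\<lbrakk>a \<in> carrier K; x \<in> carrier L; y \<in> carrier L\<rbrakk>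
      \<Longrightarrow> (a \<odot>\<^bsub>L\<^esub> x) \<otimes>\<^bsub>L\<^esub> y = a \<odot>\<^bsub>L\<^esub> (x \<otimes>\<^bsub>L\<^esub> y)"
    and bracket_smult_r: "\<lbrakk>a \<in> carrier K; x \<in> carrier L; y \<in> carrier L\<rbrakk>
      \<Longrightarrow> x \<otimes>\<^bsub>L\<^esub> (a \<odot>\<^bsub>L\<^esub> y) = a \<odot>\<^bsub>L\<^esub> (x \<otimes>\<^bsub>L\<^esub> y)"

definition characteristic :: "('k, 'm) ring_scheme \<Rightarrow> nat" where
  "characteristic R =
    (if \<exists>m::nat. m > 0 \<and> [m] \<cdot>\<^bsub>R\<^esub> \<one>\<^bsub>R\<^esub> = \<zero>\<^bsub>R\<^esub>
     then (LEAST m::nat. m > 0 \<and> [m] \<cdot>\<^bsub>R\<^esub> \<one>\<^bsub>R\<^esub> = \<zero>\<^bsub>R\<^esub>) else 0)"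

text \<open>The lower central series, indexed from \<open>0\<close>. Each term is the additive subgroup generated
  by the brackets; for a Lie algebra this is also their linear span, since the set of
  generators is closed under scalar multiplication.\<close>

primrec lower_central :: "('l, 'm) ring_scheme \<Rightarrow> nat \<Rightarrow> 'l set" where
  "lower_central L 0 = carrier L"
| "lower_central L (Suc i) =
    generate (add_monoid L) {x \<otimes>\<^bsub>L\<^esub> y | x y. x \<in> lower_central L i \<and> y \<in> carrier L}"

definition lie_nilpotent :: "('l, 'm) ring_scheme \<Rightarrow> bool" where
  "lie_nilpotent L \<longleftrightarrow> (\<exists>c. lower_central L c = {\<zero>\<^bsub>L\<^esub>})"

definition nilpotency_class :: "('l, 'm) ring_scheme \<Rightarrow> nat" where
  "nilpotency_class L = (LEAST c. lower_central L c = {\<zero>\<^bsub>L\<^esub>})"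

definition lie_derivation ::
    "('k, 'm) ring_scheme \<Rightarrow> ('k, 'l, 'r) module_scheme \<Rightarrow> ('l \<Rightarrow> 'l) \<Rightarrow> bool" where
  "lie_derivation K L D \<longleftrightarrow> D \<in> LinearCombinations.module_hom K L L \<and>
    (\<forall>x\<in>carrier L. \<forall>y\<in>carrier L. D (x \<otimes>\<^bsub>L\<^esub> y) = (D x \<otimes>\<^bsub>L\<^esub> y) \<oplus>\<^bsub>L\<^esub> (x \<otimes>\<^bsub>L\<^esub> D y))"

definition periodic_of_order :: "('l, 'm) ring_scheme \<Rightarrow> ('l \<Rightarrow> 'l) \<Rightarrow> nat \<Rightarrow> bool" where
  "periodic_of_order L D n \<longleftrightarrow> (\<forall>x\<in>carrier L. (D ^^ n) x = x) \<and>
    (\<forall>k. 0 < k \<and> k < n \<longrightarrow> \<not> (\<forall>x\<in>carrier L. (D ^^ k) x = x))"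

text \<open>\<open>'p mod_ring\<close> with \<open>'p :: prime_card\<close> is the field with \<open>p = CARD('p)\<close> elements.\<close>

definition per :: "'p::prime_card mod_ring poly \<Rightarrow> nat" where
  "per r = (LEAST m. m > 0 \<and> r dvd monom 1 m - 1)"

definition period_set :: "'p::prime_card itself \<Rightarrow> nat set" where
  "period_set _ = {per (pcompose h (monom 1 CARD('p) - monom 1 1)) | h :: 'p mod_ring poly.
    poly h 0 \<noteq> 0 \<and> degree h \<ge> 1}"

definition bad_orders :: "'p::prime_card itself \<Rightarrow> nat set" where
  "bad_orders P = {k * m | k m. k > 0 \<and> m \<in> period_set P}"

text \<open>The abelian group \<open>A\<close> is written multiplicatively, as usual for \<^locale>\<open>comm_group\<close>.\<close>

definition arithmetically_free :: "('a, 'm) monoid_scheme \<Rightarrow> 'a set \<Rightarrow> bool" where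
  "arithmetically_free A X \<longleftrightarrow> X \<subseteq> carrier A \<and>
    \<not> (\<exists>\<alpha>\<in>X. \<exists>\<beta>\<in>X. \<forall>k::nat. \<alpha> \<otimes>\<^bsub>A\<^esub> \<beta> [^]\<^bsub>A\<^esub> k \<in> X)"

text \<open>The last clause says that \<open>L\<close> is the internal direct sum of the subgroups \<open>G a\<close>.\<close>

definition lie_grading ::
    "('a, 'm) monoid_scheme \<Rightarrow> ('l, 'r) ring_scheme \<Rightarrow> ('a \<Rightarrow> 'l set) \<Rightarrow> bool" where
  "lie_grading A L G \<longleftrightarrow>
    (\<forall>a\<in>carrier A. subgroup (G a) (add_monoid L)) \<and>
    (\<forall>a\<in>carrier A. \<forall>b\<in>carrier A. \<forall>x\<in>G a. \<forall>y\<in>G b. x \<otimes>\<^bsub>L\<^esub> y \<in> G (a \<otimes>\<^bsub>A\<^esub> b)) \<and>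
    (\<forall>x\<in>carrier L. \<exists>!f. f \<in> (\<Pi>\<^sub>E a\<in>carrier A. G a) \<and>
       finite {a \<in> carrier A. f a \<noteq> \<zero>\<^bsub>L\<^esub>} \<and>
       x = (\<Oplus>\<^bsub>L\<^esub>a\<in>{a \<in> carrier A. f a \<noteq> \<zero>\<^bsub>L\<^esub>}. f a))"

definition grading_support ::
    "('a, 'm) monoid_scheme \<Rightarrow> ('l, 'r) ring_scheme \<Rightarrow> ('a \<Rightarrow> 'l set) \<Rightarrow> 'a set" where
  "grading_support A L G = {a \<in> carrier A. G a \<noteq> {\<zero>\<^bsub>L\<^esub>}}"

text \<open>A definition cannot quantify over all types, so the Higman map is parametrized by the types
  \<open>'l\<close> and \<open>'a\<close> in which the carriers of the Lie rings and of the grading groups lie. The value is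
  the same for all infinite \<open>'l\<close> and \<open>'a\<close>: a graded Lie ring violating a bound contains a
  finitely generated, hence countable, graded subring violating it, and the subgroup generated
  by its finite support is countable as well.\<close>

definition higman_bound :: "'l itself \<Rightarrow> 'a itself \<Rightarrow> nat \<Rightarrow> nat \<Rightarrow> bool" where
  "higman_bound _ _ n c \<longleftrightarrow>
    (\<forall>(L :: 'l ring) (A :: 'a monoid) G X.
      lie_ring L \<and> comm_group A \<and> lie_grading A L G \<and>
      arithmetically_free A X \<and> finite X \<and> card X \<le> n \<and> grading_support A L G \<subseteq> X
      \<longrightarrow> lie_nilpotent L \<and> nilpotency_class L \<le> c)"

definition higman_map :: "'l itself \<Rightarrow> 'a itself \<Rightarrow> nat \<Rightarrow> nat" where
  "higman_map l a n = (LEAST c. higman_bound l a n c)"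

end

theory Submission
  imports "HOL-Algebra.Algebraic_Closure_Type" "HOL-Library.Countable_Set" Defs
begin

text \<open>If \<open>n = p^s m\<close> with \<open>p\<close> not dividing \<open>m\<close>, then \<open>D\<close> to the power \<open>p^s\<close> is again a derivation, of
  order dividing \<open>m\<close>. After extending the scalars to an algebraic closure of \<open>\<F>\<^sub>p\<close> its
  eigenspaces grade the Lie ring by the \<open>m\<close>-th roots of unity inside the additive group of the field. If
  these were not arithmetically free, they would contain \<open>\<alpha> + \<F>\<^sub>p \<beta>\<close> and hence, after
  division by \<open>\<beta>\<close>, a coset \<open>\<gamma> + \<F>\<^sub>p\<close>. The minimal polynomial of this coset over \<open>\<F>\<^sub>p\<close> divides
  \<open>t^m - 1\<close> and is invariant under \<open>t \<mapsto> t + 1\<close>, so it has the form \<open>h(t^p - t)\<close>, and \<open>m\<close> is a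
  multiple of its period. Conversely, for \<open>n\<close> in \<open>\<B>\<^sub>p\<close> there is such a coset of \<open>n\<close>-th roots of unity;
  an element \<open>x\<close> of weight \<open>1\<close> permuting weight vectors for the elements of the coset cyclically
  spans with them a non-nilpotent Lie algebra.

  The bound \<open>H(n)\<close> must also be shown to exist. A solvable graded subring acts nilpotently: in a long word
  many letters have the same degree, modulo shorter words over the derived subring they can be made
  adjacent, and then arithmetic freeness kills the word. Adjoining the elements of the support
  one by one gives a chain of groups with cyclic quotients, and Kreknin's elimination shows
  along this chain that the whole ring is solvable.\<close>

text \<open>The ground field is forgotten: in characteristic p a Lie algebra is a Lie ring killed by
  p, and scalars are extended from the prime field, since the \<open>m\<close>-th roots of unity
  already lie in an algebraic closure of it. A derivation of order divisible by p is not
  diagonalisable. The power p^s has order prime to p, so t^m - 1 is separable and the eigenspaces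
  span. At most m \<le> n of them are nonzero, which is why the bound for \<open>n\<close> applies.
  Two obstacles concern the form of the Higman map. It is a \<open>LEAST\<close>, which says
  something only when some bound exists; the explicit \<open>higman_length\<close> provides one. And
  it ranges over carriers in two fixed types, while the scalar extension lives in a function type.
  Vanishing of a bracket word involves only finitely many homogeneous elements, so it is tested in
  the countable graded subring that they generate, and this embeds into every infinite type.\<close>

section \<open>Arithmetically free sets and spans of homogeneous elements\<close>

text \<open>Freeness alone gives some exit time, not a bounded one. If all terms with k \<le> n lay
  in \<X>, two of these n + 1 terms would coincide, so \<open>a\<close> would have finite order at
  most \<open>n\<close> and the whole progression would repeat them. Here \<open>d\<close> is
  arbitrary because it will be the degree of an arbitrary word.\<close>

lemma arithmetically_free_exit:
  assumes A: "comm_group A" and \<X>: "arithmetically_free A \<X>" "finite \<X>" "card \<X> \<le> n"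
    and a: "a \<in> \<X>" and d: "d \<in> carrier A"
  shows "\<exists>k\<le>n. d \<otimes>\<^bsub>A\<^esub> a [^]\<^bsub>A\<^esub> (k::nat) \<notin> \<X>"
proof (rule ccontr)
  interpret comm_group A by (rule A)
  assume "\<not> ?thesis"
  hence in_X: "d \<otimes>\<^bsub>A\<^esub> a [^]\<^bsub>A\<^esub> k \<in> \<X>" if "k \<le> n" for k :: nat using that by auto
  have aA: "a \<in> carrier A" using \<X> a by (auto simp: arithmetically_free_def)
  have "\<not> inj_on (\<lambda>k::nat. d \<otimes>\<^bsub>A\<^esub> a [^]\<^bsub>A\<^esub> k) {..n}"
  proof
    assume "inj_on (\<lambda>k::nat. d \<otimes>\<^bsub>A\<^esub> a [^]\<^bsub>A\<^esub> k) {..n}"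
    hence "card {..n} \<le> card \<X>" by (rule card_inj_on_le) (use in_X \<X> in auto)
    with \<X> show False by simp
  qed
  then obtain i j :: nat where ij: "i < j" "j \<le> n" "d \<otimes>\<^bsub>A\<^esub> a [^]\<^bsub>A\<^esub> i = d \<otimes>\<^bsub>A\<^esub> a [^]\<^bsub>A\<^esub> j"
    unfolding inj_on_def by (metis atMost_iff linorder_neqE_nat)
  have "a [^]\<^bsub>A\<^esub> i = a [^]\<^bsub>A\<^esub> j" using ij aA d by simp
  also have "\<dots> = a [^]\<^bsub>A\<^esub> i \<otimes>\<^bsub>A\<^esub> a [^]\<^bsub>A\<^esub> (j - i)" using ij aA by (simp add: nat_pow_mult)
  finally have per: "a [^]\<^bsub>A\<^esub> (j - i) = \<one>\<^bsub>A\<^esub>" using aA by (metis l_cancel_one nat_pow_closed)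
  have "d \<otimes>\<^bsub>A\<^esub> a [^]\<^bsub>A\<^esub> k \<in> \<X>" for k :: nat
  proof -
    have "a [^]\<^bsub>A\<^esub> k = a [^]\<^bsub>A\<^esub> ((j - i) * (k div (j - i)) + k mod (j - i))" by simp
    also have "\<dots> = a [^]\<^bsub>A\<^esub> (k mod (j - i))"
      unfolding nat_pow_mult[OF aA, symmetric] nat_pow_pow[OF aA, symmetric] per
      using aA by simp
    finally have "d \<otimes>\<^bsub>A\<^esub> a [^]\<^bsub>A\<^esub> k = d \<otimes>\<^bsub>A\<^esub> a [^]\<^bsub>A\<^esub> (k mod (j - i))" by simp
    moreover have "k mod (j - i) < j - i" using ij by simp
    hence "k mod (j - i) \<le> n" using ij by linarith
    ultimately show ?thesis using in_X by simp
  qed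
  moreover from this[of 0] have "d \<in> \<X>" using d by simp
  ultimately show False using \<X> a unfolding arithmetically_free_def by blast
qed

text \<open>\<open>U\<close> stands for the homogeneous elements of a graded Lie ring with bracket \<open>b\<close>, and \<open>cl S\<close> for the
  homogeneous elements of the additive span of \<open>S\<close>. Addition is not part of the interface, because
  every step below only asks in which span an element lies; \<open>x \<in> cl {}\<close> says that \<open>x\<close> is zero. There
  is one zero in each degree.\<close>

locale graded_span = comm_group A for A :: "('a, 'm) monoid_scheme" (structure) +
  fixes U :: "'u set" and cl :: "'u set \<Rightarrow> 'u set" and b :: "'u \<Rightarrow> 'u \<Rightarrow> 'u" and deg :: "'u \<Rightarrow> 'a"
    and \<X> :: "'a set" and n :: nat
  assumes cl_sub: "cl S \<subseteq> U"
    and cl_inc: "\<lbrakk>x \<in> S; x \<in> U\<rbrakk> \<Longrightarrow> x \<in> cl S"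
    and cl_least: "\<lbrakk>x \<in> cl S; \<And>s. \<lbrakk>s \<in> S; s \<in> U\<rbrakk> \<Longrightarrow> s \<in> cl T\<rbrakk> \<Longrightarrow> x \<in> cl T"
    and b_closed: "\<lbrakk>x \<in> U; y \<in> U\<rbrakk> \<Longrightarrow> b x y \<in> U"
    and lin_l: "\<lbrakk>x \<in> cl S; y \<in> U; \<And>s. \<lbrakk>s \<in> S; s \<in> U\<rbrakk> \<Longrightarrow> b s y \<in> cl T\<rbrakk> \<Longrightarrow> b x y \<in> cl T"
    and comm: "\<lbrakk>x \<in> U; y \<in> U\<rbrakk> \<Longrightarrow> b x y \<in> cl {b y x}"
    and jac_l: "\<lbrakk>x \<in> U; y \<in> U; z \<in> U\<rbrakk> \<Longrightarrow> b (b x y) z \<in> cl {b (b x z) y, b x (b y z)}"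
    and deg_carrier: "x \<in> U \<Longrightarrow> deg x \<in> carrier A"
    and deg_b: "\<lbrakk>x \<in> U; y \<in> U\<rbrakk> \<Longrightarrow> deg (b x y) = deg x \<otimes> deg y"
    and deg_cl: "x \<in> cl S \<Longrightarrow> x \<in> cl {s \<in> S. deg s = deg x}"
    and nil: "\<lbrakk>x \<in> U; deg x \<notin> \<X>\<rbrakk> \<Longrightarrow> x \<in> cl {}"
    and X_free: "arithmetically_free A \<X>" and X_fin: "finite \<X>" and X_card: "card \<X> \<le> n"
begin

lemma cl_in_U: "x \<in> cl S \<Longrightarrow> x \<in> U"
  using cl_sub by blast

lemma cl_mono: "\<lbrakk>x \<in> cl S; S \<subseteq> T\<rbrakk> \<Longrightarrow> x \<in> cl T"
  by (erule cl_least) (auto intro: cl_inc)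

lemma cl_trans: "\<lbrakk>x \<in> cl S; S \<subseteq> cl T\<rbrakk> \<Longrightarrow> x \<in> cl T"
  by (erule cl_least) auto

lemma lin_r:
  assumes "y \<in> cl S" "x \<in> U" and h: "\<And>s. \<lbrakk>s \<in> S; s \<in> U\<rbrakk> \<Longrightarrow> b x s \<in> cl T"
  shows "b x y \<in> cl T"
proof -
  have "b y x \<in> cl T"
    using assms(1,2)
  proof (rule lin_l)
    fix s assume s: "s \<in> S" "s \<in> U"
    from comm[OF s(2) assms(2)] show "b s x \<in> cl T" by (rule cl_least) (use h s in auto)
  qed
  moreover have "b x y \<in> cl {b y x}" using comm assms cl_in_U by blast
  ultimately show ?thesis by (blast intro: cl_trans)
qed

lemma jac_r:
  assumes "x \<in> U" "y \<in> U" "z \<in> U"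
  shows "b x (b y z) \<in> cl {b (b x y) z, b (b x z) y}"
proof -
  have "b (b y z) x \<in> cl {b (b x y) z, b (b x z) y}"
    using jac_l[OF assms(2,3,1)]
  proof (rule cl_least)
    fix s assume "s \<in> {b (b y x) z, b y (b z x)}"
    moreover have "b (b y x) z \<in> cl {b (b x y) z, b (b x z) y}"
      by (rule lin_l[OF comm]) (use assms b_closed cl_inc in auto)
    moreover have "b y (b z x) \<in> cl {b (b x y) z, b (b x z) y}"
      by (rule lin_r[OF comm], use assms in auto)
         (rule cl_least[OF comm], use assms b_closed cl_inc in auto)
    ultimately show "s \<in> cl {b (b x y) z, b (b x z) y}" by auto
  qed
  moreover have "b x (b y z) \<in> cl {b (b y z) x}" using comm assms b_closed by blast
  ultimately show ?thesis by (blast intro: cl_trans)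
qed

lemma nil_l: "\<lbrakk>x \<in> cl {}; y \<in> U\<rbrakk> \<Longrightarrow> b x y \<in> cl S"
  by (rule lin_l) auto

lemma nil_r: "\<lbrakk>y \<in> cl {}; x \<in> U\<rbrakk> \<Longrightarrow> b x y \<in> cl S"
  by (rule lin_r) auto

lemma foldl_U: "\<lbrakk>x \<in> U; set zs \<subseteq> U\<rbrakk> \<Longrightarrow> foldl b x zs \<in> U"
  by (induction zs arbitrary: x) (auto simp: b_closed)

lemma foldl_nil: "\<lbrakk>x \<in> cl {}; set zs \<subseteq> U\<rbrakk> \<Longrightarrow> foldl b x zs \<in> cl {}"
  by (induction zs arbitrary: x) (auto simp: nil_l)

section \<open>Generated subrings and the derived series\<close>

inductive_set gen :: "'u set \<Rightarrow> 'u set" for S where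
  base: "\<lbrakk>x \<in> S; x \<in> U\<rbrakk> \<Longrightarrow> x \<in> gen S"
| br: "\<lbrakk>x \<in> gen S; y \<in> gen S\<rbrakk> \<Longrightarrow> b x y \<in> gen S"
| cl: "\<lbrakk>x \<in> cl T; \<forall>t\<in>T. t \<in> U \<longrightarrow> t \<in> gen S\<rbrakk> \<Longrightarrow> x \<in> gen S"

lemma gen_U: "x \<in> gen S \<Longrightarrow> x \<in> U"
  by (induction rule: gen.induct) (auto simp: b_closed cl_in_U)

lemma gen_cl: "x \<in> cl (gen S) \<Longrightarrow> x \<in> gen S"
  by (erule gen.cl) auto

lemma gen_nil: "x \<in> cl {} \<Longrightarrow> x \<in> gen S"
  by (erule gen.cl) auto

lemma gen_least: "\<lbrakk>x \<in> gen S; \<And>s. \<lbrakk>s \<in> S; s \<in> U\<rbrakk> \<Longrightarrow> s \<in> gen T\<rbrakk> \<Longrightarrow> x \<in> gen T"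
  by (induction rule: gen.induct) (auto intro: gen.intros)

lemma gen_empty: "x \<in> gen {} \<Longrightarrow> x \<in> cl {}"
proof (induction rule: gen.induct)
  case (cl x T)
  thus ?case by (blast intro: cl_least)
qed (auto intro: nil_l gen_U)

text \<open>Bracketing with a fixed \<open>z\<close> is a derivation by \<open>jac_l\<close>, so it
  preserves a generated subring as soon as it maps the generators into it.\<close>

lemma gen_normal:
  assumes "x \<in> gen S" "z \<in> U" and h: "\<And>s. \<lbrakk>s \<in> S; s \<in> U\<rbrakk> \<Longrightarrow> b s z \<in> gen S"
  shows "b x z \<in> gen S"
  using assms(1)
proof (induction rule: gen.induct)
  case (br x y)
  show ?case
    by (rule gen.cl[OF jac_l]) (use br assms gen_U in \<open>auto intro: gen.br\<close>)
next
  case (cl x T)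
  have "b x z \<in> cl {b t z | t. t \<in> T \<and> t \<in> U}"
    by (rule lin_l[OF cl(1) assms(2)]) (auto intro!: cl_inc b_closed assms)
  thus ?case by (rule gen.cl) (use cl in auto)
qed (use h in auto)

text \<open>Stage 0 is the bare set and not its span, so that a series can start from a set of
  homogeneous generators. Comparisons such as \<open>dseries_mono\<close> therefore carry a
  \<open>cl\<close>.\<close>

primrec dseries :: "nat \<Rightarrow> 'u set \<Rightarrow> 'u set" where
  "dseries 0 S = S"
| "dseries (Suc i) S = cl {b x y | x y. x \<in> dseries i S \<and> y \<in> dseries i S}"

lemma dseries_add: "dseries (i + j) S = dseries i (dseries j S)"
  by (induction i) auto

lemma dseries_U: "S \<subseteq> U \<Longrightarrow> dseries i S \<subseteq> U"
  by (cases i) (use cl_sub in auto)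

lemma dseries_mono:
  assumes "S \<subseteq> cl T" "T \<subseteq> U"
  shows "dseries i S \<subseteq> cl (dseries i T)"
proof (induction i)
  case (Suc i)
  have "S \<subseteq> U" using assms cl_sub by blast
  show ?case
  proof
    fix u assume "u \<in> dseries (Suc i) S"
    hence u: "u \<in> cl {b x y | x y. x \<in> dseries i S \<and> y \<in> dseries i S}" by simp
    have "b x y \<in> dseries (Suc i) T" if "x \<in> dseries i S" "y \<in> dseries i S" for x y
    proof -
      have x: "x \<in> cl (dseries i T)" and y: "y \<in> cl (dseries i T)" using that Suc by auto
      show ?thesis unfolding dseries.simps
      proof (rule lin_l[OF x cl_in_U[OF y]])
        fix s assume "s \<in> dseries i T" "s \<in> U"
        thus "b s y \<in> cl {b x y | x y. x \<in> dseries i T \<and> y \<in> dseries i T}"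
          by (intro lin_r[OF y] cl_inc b_closed) auto
      qed
    qed
    moreover have "dseries (Suc i) T \<subseteq> U" by (simp add: cl_sub)
    ultimately show "u \<in> cl (dseries (Suc i) T)"
      by (intro cl_least[OF u]) (blast intro: cl_inc)
  qed
qed (use assms in auto)

lemma dseries_nil:
  assumes "dseries i S \<subseteq> cl {}" "i \<le> j"
  shows "dseries j S \<subseteq> cl {}"
proof -
  have "dseries k (cl {}) \<subseteq> cl {}" for k
  proof (induction k)
    case (Suc k)
    show ?case
    proof
      fix u assume "u \<in> dseries (Suc k) (cl {})"
      hence "u \<in> cl {b x y | x y. x \<in> dseries k (cl {}) \<and> y \<in> dseries k (cl {})}" by simp
      thus "u \<in> cl {}" by (rule cl_least) (use Suc cl_sub in \<open>auto intro!: nil_l\<close>)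
    qed
  qed simp
  moreover have "dseries (j - i) (dseries i S) \<subseteq> cl (dseries (j - i) (cl {}))"
    by (rule dseries_mono) (use assms cl_sub cl_inc in blast)+
  moreover have "dseries j S = dseries (j - i) (dseries i S)" using assms dseries_add[of "j - i" i] by simp
  ultimately show ?thesis by (blast intro: cl_trans)
qed

lemma dseries_sub_cl:
  assumes "T \<subseteq> U" "\<And>x y. \<lbrakk>x \<in> T; y \<in> T\<rbrakk> \<Longrightarrow> b x y \<in> cl T"
  shows "dseries i T \<subseteq> cl T"
proof (induction i)
  case (Suc i)
  have "b x y \<in> cl T" if "x \<in> dseries i T" "y \<in> dseries i T" for x y
  proof -
    have x: "x \<in> cl T" and y: "y \<in> cl T" using that Suc by auto
    show ?thesis
    proof (rule lin_l[OF x cl_in_U[OF y]])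
      fix s assume "s \<in> T" "s \<in> U"
      thus "b s y \<in> cl T" by (intro lin_r[OF y]) (use assms in auto)
    qed
  qed
  hence "{b x y | x y. x \<in> dseries i T \<and> y \<in> dseries i T} \<subseteq> cl T" by blast
  thus ?case using cl_trans by (auto simp: subset_eq)
qed (use assms cl_inc in auto)

definition is_subring :: "'u set \<Rightarrow> bool" where
  "is_subring R \<longleftrightarrow> R \<subseteq> U \<and> (\<forall>x\<in>cl R. x \<in> R) \<and> (\<forall>x\<in>R. \<forall>y\<in>R. b x y \<in> R)"

lemma is_subring_dseries: "is_subring R \<Longrightarrow> is_subring (dseries i R) \<and> dseries i R \<subseteq> R"
proof (induction i)
  case (Suc i)
  let ?D = "{b x y | x y. x \<in> dseries i R \<and> y \<in> dseries i R}"
  have IH: "is_subring (dseries i R)" "dseries i R \<subseteq> R" using Suc by auto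
  have D: "?D \<subseteq> dseries i R" using IH(1) by (auto simp: is_subring_def)
  have cD: "cl ?D \<subseteq> dseries i R"
  proof
    fix x assume "x \<in> cl ?D"
    hence "x \<in> cl (dseries i R)" by (rule cl_mono[OF _ D])
    thus "x \<in> dseries i R" using IH(1) by (simp add: is_subring_def)
  qed
  have "x \<in> cl ?D" if "x \<in> cl (cl ?D)" for x using that by (rule cl_least)
  moreover have "b x y \<in> cl ?D" if "x \<in> cl ?D" "y \<in> cl ?D" for x y
    using that cD cl_in_U[OF that(1)] cl_in_U[OF that(2)] by (intro cl_inc b_closed) auto
  ultimately show ?case using cD IH cl_sub by (auto simp: is_subring_def)
qed simp

subsection \<open>Solvable subrings act nilpotently\<close>

text \<open>In the sorting argument \<open>W\<close> consists of the brackets of \<open>v\<close>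
  with letters of the derived subring, and this right submodule collects the error terms.\<close>

inductive_set submod :: "'u set \<Rightarrow> 'u set \<Rightarrow> 'u set" for T W where
  base: "\<lbrakk>x \<in> W; x \<in> U\<rbrakk> \<Longrightarrow> x \<in> submod T W"
| act: "\<lbrakk>x \<in> submod T W; t \<in> T; t \<in> U\<rbrakk> \<Longrightarrow> b x t \<in> submod T W"
| cl: "\<lbrakk>x \<in> cl S; \<forall>s\<in>S. s \<in> U \<longrightarrow> s \<in> submod T W\<rbrakk> \<Longrightarrow> x \<in> submod T W"

lemma submod_U: "x \<in> submod T W \<Longrightarrow> x \<in> U"
  by (induction rule: submod.induct) (auto simp: b_closed cl_in_U)

lemma submod_least: "\<lbrakk>x \<in> submod T W; \<And>s. \<lbrakk>s \<in> W; s \<in> U\<rbrakk> \<Longrightarrow> s \<in> submod T V\<rbrakk> \<Longrightarrow> x \<in> submod T V"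
  by (induction rule: submod.induct) (auto intro: submod.intros)

lemma submod_nil: "x \<in> submod T (cl {}) \<Longrightarrow> x \<in> cl {}"
proof (induction rule: submod.induct)
  case (cl x T)
  thus ?case by (blast intro: cl_least)
qed (auto intro: nil_l)

lemma submod_foldl: "\<lbrakk>x \<in> submod T W; set zs \<subseteq> T; T \<subseteq> U\<rbrakk> \<Longrightarrow> foldl b x zs \<in> submod T W"
  by (induction zs arbitrary: x) (auto intro!: submod.act)

context
  fixes T
  assumes T_U: "T \<subseteq> U" and T_br: "\<And>x y. \<lbrakk>x \<in> T; y \<in> T\<rbrakk> \<Longrightarrow> b x y \<in> cl T"
begin

lemma dseries1_cl: "dseries 1 T \<subseteq> cl T"
  by (rule dseries_sub_cl) (use T_U T_br in auto)

lemma dseries1_br: "\<lbrakk>z \<in> T; t \<in> dseries 1 T\<rbrakk> \<Longrightarrow> b z t \<in> dseries 1 T"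
  unfolding One_nat_def dseries.simps
  by (rule lin_r[of t T]) (use dseries1_cl T_U in \<open>auto intro: cl_inc b_closed\<close>)

lemma dseries1_br': "\<lbrakk>x \<in> T; y \<in> T\<rbrakk> \<Longrightarrow> b x y \<in> dseries 1 T"
  using T_U unfolding One_nat_def dseries.simps by (intro cl_inc b_closed) auto

text \<open>The identity [[x,z],t] = [[x,t],z] + [x,[z,t]] pushes a derived letter \<open>t\<close>
  past \<open>z\<close>. The second term contains the letter [z,t], which is again derived, so the
  induction has to allow all \<open>t\<close>. A derived letter at the end of a word can thus be
  brought to its beginning, at the price of changing it.\<close>

lemma submod_move:
  assumes "w \<in> submod T W" "t \<in> dseries 1 T"
  shows "b w t \<in> submod T {b x t | x t. x \<in> W \<and> x \<in> U \<and> t \<in> dseries 1 T}"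
  using assms
proof (induction arbitrary: t rule: submod.induct)
  case (base x)
  moreover have "t \<in> U" using base dseries_U[OF T_U] by blast
  ultimately show ?case by (intro submod.base) (auto simp: b_closed)
next
  case (act x z)
  have tU: "t \<in> U" using act dseries_U[OF T_U] by blast
  have "b z t \<in> dseries 1 T" using act dseries1_br by blast
  hence "b x (b z t) \<in> submod T {b x t | x t. x \<in> W \<and> x \<in> U \<and> t \<in> dseries 1 T}" by (rule act.IH)
  moreover have "b (b x t) z \<in> submod T {b x t | x t. x \<in> W \<and> x \<in> U \<and> t \<in> dseries 1 T}"
    by (rule submod.act[OF act.IH[OF act.prems] act.hyps(2,3)])
  moreover have "b (b x z) t \<in> cl {b (b x t) z, b x (b z t)}"
    by (rule jac_l) (use act tU submod_U in auto)
  ultimately show ?case by (intro submod.cl) auto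
next
  case (cl x S)
  have tU: "t \<in> U" using cl dseries_U[OF T_U] by blast
  have "b x t \<in> cl {b s t | s. s \<in> S \<and> s \<in> U}"
    by (rule lin_l[OF cl(1) tU]) (auto intro!: cl_inc b_closed tU)
  thus ?case by (rule submod.cl) (use cl in auto)
qed

text \<open>Moving \<open>y\<close> to the left past a letter \<open>z\<close> costs a term with the
  derived letter [z,y]. By \<open>submod_move\<close> this letter can be carried down to
  \<open>v\<close>, so all such terms lie in the submodule on the right.\<close>

lemma submod_swap:
  assumes v: "v \<in> U" and x: "x \<in> submod T {v}" and N: "set N \<subseteq> T" and y: "y \<in> T"
  shows "b (foldl b x N) y \<in> cl ({foldl b (b x y) N} \<union> submod T {b v t | t. t \<in> dseries 1 T})"
    (is "_ \<in> cl (_ \<union> ?Q)")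
  using N
proof (induction N rule: rev_induct)
  case Nil
  thus ?case using x y T_U submod_U by (auto intro!: cl_inc b_closed)
next
  case (snoc z N)
  let ?w = "foldl b x N"
  have w: "?w \<in> submod T {v}" using x snoc T_U by (intro submod_foldl) auto
  have wU: "?w \<in> U" using w submod_U by blast
  have z: "z \<in> T" "z \<in> U" "y \<in> U" using snoc T_U y by auto
  have x': "foldl b (b x y) N \<in> U"
    using x submod_U z snoc T_U by (intro foldl_U b_closed) auto
  have "b (b ?w z) y \<in> cl {b (b ?w y) z, b ?w (b z y)}" using wU z by (intro jac_l)
  moreover have "b ?w (b z y) \<in> ?Q"
  proof -
    have "b ?w (b z y) \<in> submod T {b x t | x t. x \<in> {v} \<and> x \<in> U \<and> t \<in> dseries 1 T}"
      by (rule submod_move[OF w]) (use z y dseries1_br' in blast)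
    thus ?thesis by (rule submod_least) (auto intro: submod.base)
  qed
  moreover have "b (b ?w y) z \<in> cl ({foldl b (b x y) (N @ [z])} \<union> ?Q)"
  proof (rule lin_l)
    show "b ?w y \<in> cl ({foldl b (b x y) N} \<union> ?Q)" using snoc by simp
  qed (use z x' b_closed submod_U in \<open>auto intro!: cl_inc submod.act\<close>)
  ultimately show ?case
    using cl_trans[of "b (b ?w z) y" "{b (b ?w y) z, b ?w (b z y)}"
      "{foldl b (b x y) (N @ [z])} \<union> ?Q"] submod_U
    by (auto intro: cl_inc)
qed

text \<open>Sorting the letters of a word costs only terms in which a letter from the derived subring acts on
  \<open>v\<close>, and such terms are absorbed by the submodule on the right.\<close>

lemma submod_sort:
  assumes v: "v \<in> U" and zs: "set zs \<subseteq> T"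
  shows "foldl b v zs \<in> cl ({foldl b v (filter P zs @ filter (\<lambda>z. \<not> P z) zs)}
           \<union> submod T {b v t | t. t \<in> dseries 1 T})"
    (is "_ \<in> cl (_ \<union> ?Q)")
  using zs
proof (induction zs rule: rev_induct)
  case (snoc z zs)
  let ?F = "filter P zs" and ?N = "filter (\<lambda>z. \<not> P z) zs"
  have z: "z \<in> T" "z \<in> U" using snoc T_U by auto
  have Q: "b q z \<in> ?Q" if "q \<in> ?Q" for q using that z by (intro submod.act)
  have sF: "set ?F \<subseteq> T" "set ?N \<subseteq> T" using snoc by auto
  have F: "foldl b v ?F \<in> submod T {v}" using sF T_U v by (intro submod_foldl submod.base) auto
  have IH: "foldl b v zs \<in> cl ({foldl b v (?F @ ?N)} \<union> ?Q)" using snoc by simp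
  have "b (foldl b v zs) z \<in> cl ({b (foldl b v (?F @ ?N)) z} \<union> ?Q)"
    by (rule lin_l[OF IH z(2)]) (use z in \<open>auto intro!: cl_inc submod.act b_closed dest: submod_U\<close>)
  moreover have "b (foldl b v (?F @ ?N)) z \<in>
      cl ({foldl b v (filter P (zs @ [z]) @ filter (\<lambda>z. \<not> P z) (zs @ [z]))} \<union> ?Q)"
  proof (cases "P z")
    case True
    show ?thesis using submod_swap[OF v F sF(2) z(1)] True by simp
  next
    case False
    thus ?thesis using v F sF T_U z by (auto intro!: cl_inc b_closed foldl_U)
  qed
  ultimately have "b (foldl b v zs) z \<in>
      cl ({foldl b v (filter P (zs @ [z]) @ filter (\<lambda>z. \<not> P z) (zs @ [z]))} \<union> ?Q)"
    by (elim cl_trans) (auto intro: cl_inc submod_U)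
  thus ?case by simp
qed (use v in \<open>auto intro: cl_inc\<close>)

text \<open>The degrees of the prefixes form a progression with difference \<open>a\<close>, which
  leaves \<X> after some k \<le> n letters. That prefix is zero, and further letters keep it
  zero.\<close>

lemma foldl_same_deg:
  assumes "v \<in> U" "set zs \<subseteq> U" "\<forall>z\<in>set zs. deg z = a" "a \<in> \<X>" "n \<le> length zs"
  shows "foldl b v zs \<in> cl {}"
proof -
  have aA: "a \<in> carrier A" using assms X_free by (auto simp: arithmetically_free_def)
  obtain k where k: "k \<le> n" "deg v \<otimes> a [^] k \<notin> \<X>"
    using arithmetically_free_exit[OF _ X_free X_fin X_card assms(4) deg_carrier[OF assms(1)]]
      comm_group_axioms by blast
  have d: "deg (foldl b v ys) = deg v \<otimes> a [^] length ys"
    if "set ys \<subseteq> U" "\<forall>z\<in>set ys. deg z = a" for ys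
    using that
  proof (induction ys rule: rev_induct)
    case (snoc y ys)
    thus ?case using aA assms(1) deg_carrier[OF assms(1)] by (simp add: deg_b foldl_U m_assoc)
  qed (use assms deg_carrier in auto)
  have sub: "set (take k zs) \<subseteq> set zs" "set (drop k zs) \<subseteq> set zs"
    by (rule set_take_subset) (rule set_drop_subset)
  have "deg (foldl b v (take k zs)) = deg v \<otimes> a [^] length (take k zs)"
    by (rule d) (use sub assms in auto)
  moreover have "length (take k zs) = k" using k assms by simp
  ultimately have "foldl b v (take k zs) \<in> cl {}"
    using k sub assms by (intro nil foldl_U) auto
  hence "foldl b (foldl b v (take k zs)) (drop k zs) \<in> cl {}"
    by (rule foldl_nil) (use sub assms in auto)
  thus ?thesis by (metis append_take_drop_id foldl_append)
qed

text \<open>Pigeonhole: more than \<open>n * n\<close> letters with at most \<open>n\<close> degrees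
  contain \<open>n\<close> letters of equal degree. Sorted to the front they kill the main term of
  \<open>submod_sort\<close>, which leaves only the error terms.\<close>

lemma submod_long:
  assumes v: "v \<in> U" and zs: "set zs \<subseteq> T" and len: "n * n < length zs"
  shows "foldl b v zs \<in> submod T {b v t | t. t \<in> dseries 1 T}"
proof (cases "\<forall>z\<in>set zs. deg z \<in> \<X>")
  case True
  have "\<exists>a\<in>\<X>. n \<le> length (filter (\<lambda>z. deg z = a) zs)"
  proof (rule ccontr)
    assume "\<not> ?thesis"
    hence le: "length (filter (\<lambda>z. deg z = a) zs) \<le> n" if "a \<in> \<X>" for a using that by force
    have "length zs = (\<Sum>a\<in>\<X>. length (filter (\<lambda>z. deg z = a) zs))"
      using True
    proof (induction zs)
      case (Cons z zs)
      have "(\<Sum>a\<in>\<X>. length (filter (\<lambda>z. deg z = a) (z # zs)))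
          = (\<Sum>a\<in>\<X>. length (filter (\<lambda>z. deg z = a) zs) + (if deg z = a then 1 else 0))"
        by (rule sum.cong) auto
      also have "\<dots> = length zs + 1" using Cons X_fin by (simp add: sum.distrib)
      finally show ?case by simp
    qed simp
    also have "\<dots> \<le> card \<X> * n" using sum_bounded_above[of \<X>, OF le] by simp
    also have "\<dots> \<le> n * n" using X_card by simp
    finally show False using len by simp
  qed
  then obtain a where a: "a \<in> \<X>" "n \<le> length (filter (\<lambda>z. deg z = a) zs)" by blast
  let ?F = "filter (\<lambda>z. deg z = a) zs" and ?N = "filter (\<lambda>z. \<not> deg z = a) zs"
  have "foldl b v ?F \<in> cl {}"
    by (rule foldl_same_deg[where a = a]) (use a v zs T_U in auto)
  hence "foldl b v (?F @ ?N) \<in> cl {}"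
    unfolding foldl_append by (rule foldl_nil) (use zs T_U in auto)
  hence "foldl b v (?F @ ?N) \<in> submod T {b v t | t. t \<in> dseries 1 T}" by (rule submod.cl) auto
  thus ?thesis by (intro submod.cl[OF submod_sort[OF v zs, of "\<lambda>z. deg z = a"]]) auto
next
  case False
  \<comment> \<open>A letter with degree outside \<X> is itself zero.\<close>
  then obtain z where z: "z \<in> set zs" "deg z \<notin> \<X>" by blast
  then obtain xs ys where xy: "zs = xs @ z # ys" by (meson split_list)
  have "b (foldl b v xs) z \<in> cl {}"
    by (rule nil_r[OF nil]) (use z xy zs T_U v in \<open>auto intro!: foldl_U\<close>)
  hence "foldl b v zs \<in> cl {}" using foldl_nil[of _ ys] xy zs T_U by auto
  thus ?thesis by (rule submod.cl) auto
qed

text \<open>Each block of \<open>n * n + 1\<close> letters is exchanged for one letter of the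
  derived subring. The new letter appears behind the part of the word already treated, and
  \<open>submod_move\<close> brings it next to the derived letters gained before.\<close>

lemma submod_powers:
  assumes v: "v \<in> U" and "set zs \<subseteq> T" "length zs = (n * n + 1) * q"
  shows "foldl b v zs \<in> submod T {foldl b v ts | ts. set ts \<subseteq> dseries 1 T \<and> length ts = q}"
  using assms(2,3)
proof (induction q arbitrary: zs)
  case 0
  thus ?case using v by (auto intro: submod.base)
next
  case (Suc q)
  define xs ys where "xs = take ((n * n + 1) * q) zs" and "ys = drop ((n * n + 1) * q) zs"
  have zs: "zs = xs @ ys" by (simp add: xs_def ys_def)
  have l: "length xs = (n * n + 1) * q" "length ys = n * n + 1"
    using Suc by (auto simp: xs_def ys_def algebra_simps)
  have s: "set xs \<subseteq> T" "set ys \<subseteq> T" using Suc(2) zs by auto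
  let ?S = "\<lambda>q. {foldl b v ts | ts. set ts \<subseteq> dseries 1 T \<and> length ts = q}"
  have w: "foldl b v xs \<in> submod T (?S q)" by (rule Suc.IH[OF s(1) l(1)])
  have "foldl b (foldl b v xs) ys \<in> submod T {b (foldl b v xs) t | t. t \<in> dseries 1 T}"
    by (rule submod_long) (use s l w submod_U in auto)
  hence "foldl b (foldl b v xs) ys \<in> submod T (?S (Suc q))"
  proof (rule submod_least)
    fix s assume "s \<in> {b (foldl b v xs) t | t. t \<in> dseries 1 T}"
    then obtain t where t: "s = b (foldl b v xs) t" "t \<in> dseries 1 T" by blast
    have "s \<in> submod T {b x t | x t. x \<in> ?S q \<and> x \<in> U \<and> t \<in> dseries 1 T}"
      unfolding t(1) by (rule submod_move[OF w t(2)])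
    thus "s \<in> submod T (?S (Suc q))"
    proof (rule submod_least)
      fix s assume "s \<in> {b x t | x t. x \<in> ?S q \<and> x \<in> U \<and> t \<in> dseries 1 T}" and sU: "s \<in> U"
      then obtain ts t where "s = b (foldl b v ts) t" "set ts \<subseteq> dseries 1 T" "length ts = q" "t \<in> dseries 1 T"
        by blast
      hence "s = foldl b v (ts @ [t])" "set (ts @ [t]) \<subseteq> dseries 1 T" "length (ts @ [t]) = Suc q" by auto
      thus "s \<in> submod T (?S (Suc q))" using sU by (intro submod.base) blast+
    qed
  qed
  thus ?case by (simp add: zs)
qed

end

text \<open>Induction on the derived length: by \<open>submod_powers\<close> a word of
  \<open>(n * n + 1) ^ Suc s\<close> letters lies in the submodule generated by the words of
  \<open>(n * n + 1) ^ s\<close> letters from the derived subring, and these vanish because the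
  derived subring has length \<open>s\<close>.\<close>

lemma solvable_acts_nilpotently:
  assumes "T \<subseteq> U" "\<And>x y. \<lbrakk>x \<in> T; y \<in> T\<rbrakk> \<Longrightarrow> b x y \<in> cl T" "dseries s T \<subseteq> cl {}"
    and "v \<in> U" "set zs \<subseteq> T" "length zs = (n * n + 1) ^ s"
  shows "foldl b v zs \<in> cl {}"
  using assms
proof (induction s arbitrary: T v zs)
  case 0
  \<comment> \<open>For derived length 0 the letters are zeros, and the exponent 0 still leaves a
    word with one letter.\<close>
  then obtain z where "zs = [z]" "z \<in> cl {}" by (cases zs) auto
  thus ?case using 0 by (auto intro: nil_r)
next
  case (Suc s)
  note T = Suc.prems(1,2)
  let ?T1 = "dseries 1 T"
  have T1: "?T1 \<subseteq> U" "?T1 \<subseteq> cl T" using dseries_U[OF T(1)] dseries1_cl[OF T] by blast+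
  have br: "b x y \<in> cl ?T1" if "x \<in> ?T1" "y \<in> ?T1" for x y
  proof (rule cl_inc)
    have "b t y \<in> dseries 1 T" if "t \<in> T" for t
      using dseries1_br[OF T that \<open>y \<in> ?T1\<close>] .
    hence "b x y \<in> cl (dseries 1 T)"
      by (intro lin_l[of x T y "dseries 1 T"]) (use \<open>x \<in> ?T1\<close> \<open>y \<in> ?T1\<close> T1 in \<open>auto intro: cl_inc\<close>)
    hence "b x y \<in> dseries 1 T" unfolding One_nat_def dseries.simps by (rule cl_least)
    thus "b x y \<in> dseries 1 T" "b x y \<in> U" using T1 by auto
  qed
  have "dseries s ?T1 = dseries (Suc s) T" using dseries_add[of s 1] by simp
  hence "dseries s ?T1 \<subseteq> cl {}" using Suc.prems by simp
  hence z: "foldl b v ts \<in> cl {}" if "set ts \<subseteq> ?T1" "length ts = (n * n + 1) ^ s" for ts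
    using that Suc.IH[OF T1(1) br _ Suc.prems(4)] by blast
  have "foldl b v zs \<in> submod T {foldl b v ts | ts. set ts \<subseteq> ?T1 \<and> length ts = (n * n + 1) ^ s}"
    by (rule submod_powers) (use Suc.prems in auto)
  hence "foldl b v zs \<in> submod T (cl {})"
    by (rule submod_least) (use z in \<open>auto intro: submod.base\<close>)
  thus ?case by (rule submod_nil)
qed

end

text \<open>Derived length spent when \<open>i\<close> positive ranks have been eliminated. Removing
  rank 0 costs \<open>c\<close>. If f is the length so far, the next rank takes \<open>N\<close>
  rounds of f + 1 steps, namely f steps to reach generators of large rank and one for
  \<open>derived_rank\<close>, and then f final steps. \<open>N\<close> is the number of rank-0
  letters that annihilate every element.\<close>

fun kreknin_length :: "nat \<Rightarrow> nat \<Rightarrow> nat \<Rightarrow> nat" where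
  "kreknin_length N c 0 = c"
| "kreknin_length N c (Suc i) = kreknin_length N c i + N * Suc (kreknin_length N c i)"

lemma kreknin_length_mono: "i \<le> j \<Longrightarrow> kreknin_length N c i \<le> kreknin_length N c j"
  by (rule lift_Suc_mono_le[of "kreknin_length N c"]) auto

context graded_span
begin

subsection \<open>Kreknin's elimination\<close>

lemma bilinear_span:
  assumes "x \<in> cl S" "y \<in> cl T"
    and "\<And>s t. \<lbrakk>s \<in> S; s \<in> U; t \<in> T; t \<in> U\<rbrakk> \<Longrightarrow> b s t \<in> cl V"
  shows "b x y \<in> cl V"
  by (rule lin_l[OF assms(1) cl_in_U[OF assms(2)]], rule lin_r[OF assms(2)]) (use assms(3) in blast)+

definition subring_within :: "'a set \<Rightarrow> 'u set \<Rightarrow> bool" where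
  "subring_within X' R \<longleftrightarrow> is_subring R \<and> (\<forall>u\<in>R. deg u \<in> X' \<or> u \<in> cl {})"

text \<open>\<open>\<rho>\<close> is the class of a degree in a cyclic quotient of order \<open>M\<close>, represented in \<open>{0..<M}\<close>; the part \<open>B0\<close>
  of rank \<open>0\<close> is already known to be solvable and to act nilpotently. The elimination removes the
  ranks \<open>1, 2, \<dots>\<close> one at a time from a set of generators for some term of the derived series.\<close>

context
  fixes X' :: "'a set" and \<rho> :: "'a \<Rightarrow> nat" and M :: nat and B0 :: "'u set" and c N :: nat
  assumes X': "X' \<subseteq> \<X>" and \<rho>_less: "\<And>a. a \<in> X' \<Longrightarrow> \<rho> a < M"
    and \<rho>_add: "\<And>a b. \<lbrakk>a \<in> X'; b \<in> X'; a \<otimes> b \<in> X'\<rbrakk> \<Longrightarrow> \<rho> (a \<otimes> b) = (\<rho> a + \<rho> b) mod M"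
    and B0: "B0 = {u \<in> U. deg u \<in> X' \<and> \<rho> (deg u) = 0}"
    and B0_solv: "dseries c B0 \<subseteq> cl {}"
    and B0_act: "\<And>v zs. \<lbrakk>v \<in> U; set zs \<subseteq> B0; length zs = N\<rbrakk> \<Longrightarrow> foldl b v zs \<in> cl {}"
begin

abbreviation good :: "'u set \<Rightarrow> bool" where
  "good \<equiv> subring_within X'"

definition ranked :: "'u set \<Rightarrow> (nat \<Rightarrow> bool) \<Rightarrow> 'u set" where
  "ranked R P = {u \<in> R. deg u \<in> X' \<and> P (\<rho> (deg u))}"

lemma good_dseries: "good R \<Longrightarrow> good (dseries i R)"
  using is_subring_dseries unfolding subring_within_def by blast

lemma good_U: "good R \<Longrightarrow> R \<subseteq> U"
  by (simp add: subring_within_def is_subring_def)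

lemma good_b: "\<lbrakk>good R; x \<in> R; y \<in> R\<rbrakk> \<Longrightarrow> b x y \<in> R"
  by (simp add: subring_within_def is_subring_def)

lemma good_cl: "\<lbrakk>good R; x \<in> cl S; S \<subseteq> R\<rbrakk> \<Longrightarrow> x \<in> R"
  using cl_mono[of x S R] unfolding subring_within_def is_subring_def by blast

lemma gen_good:
  assumes "good R" "S \<subseteq> R" "x \<in> gen S"
  shows "x \<in> R"
  using assms(3)
proof (induction rule: gen.induct)
  case (cl x T)
  have "x \<in> cl (T \<inter> U)" using cl(1) by (rule cl_least) (auto intro: cl_inc)
  thus ?case by (rule good_cl[OF assms(1)]) (use cl in auto)
qed (use assms good_b in auto)

lemma ranked_sub: "ranked R P \<subseteq> R"
  by (auto simp: ranked_def)

text \<open>Rank 0 adds nothing modulo \<open>M\<close>; when the degree leaves \<open>X'\<close>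
  the bracket is zero and has no rank.\<close>

lemma ranked_zero:
  assumes R: "good R" and s: "s \<in> ranked R P" and z: "z \<in> ranked R (\<lambda>i. i = 0)"
  shows "b s z \<in> ranked R P \<or> b s z \<in> cl {}"
proof -
  have U: "s \<in> U" "z \<in> U" using assms good_U by (auto simp: ranked_def)
  have bR: "b s z \<in> R" using s z good_b[OF R] by (auto simp: ranked_def)
  show ?thesis
  proof (cases "deg (b s z) \<in> X'")
    case True
    have "\<rho> (deg (b s z)) = (\<rho> (deg s) + \<rho> (deg z)) mod M"
      using True s z by (simp add: deg_b U \<rho>_add ranked_def)
    also have "\<dots> = \<rho> (deg s)" using s z \<rho>_less by (auto simp: ranked_def)
    finally show ?thesis using s bR True by (simp add: ranked_def)
  next
    case False
    thus ?thesis using bR R by (auto simp: subring_within_def)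
  qed
qed

text \<open>The rank-0 part normalises the subring generated by any selection of ranks: by
  \<open>ranked_zero\<close> it does so on the generators.\<close>

lemma gen_ranked_normal:
  assumes R: "good R" and x: "x \<in> gen (ranked R P)" and z: "z \<in> cl (ranked R (\<lambda>i. i = 0))"
  shows "b x z \<in> gen (ranked R P)"
proof (rule gen_normal[OF x cl_in_U[OF z]])
  fix s assume s: "s \<in> ranked R P" "s \<in> U"
  have "b s z \<in> cl (gen (ranked R P))"
  proof (rule lin_r[OF z s(2)])
    fix z' assume "z' \<in> ranked R (\<lambda>i. i = 0)" "z' \<in> U"
    thus "b s z' \<in> cl (gen (ranked R P))"
      using ranked_zero[OF R s(1)] s
      by (metis b_closed cl_inc gen.base gen_nil)
  qed
  thus "b s z \<in> gen (ranked R P)" by (rule gen_cl)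
qed

text \<open>R is spanned by its rank-0 part and by the subring generated by the positive ranks,
  which the rank-0 part normalises. Modulo that subring the derived series of R is therefore that of
  the rank-0 part, and this dies after \<open>c\<close> steps.\<close>

lemma dseries_zero_part:
  assumes R: "good R"
  shows "dseries c R \<subseteq> gen (ranked R (\<lambda>i. i > 0))"
proof -
  let ?Q = "gen (ranked R (\<lambda>i. i > 0))" and ?R0 = "ranked R (\<lambda>i. i = 0)"
  have RU: "R \<subseteq> U" "?R0 \<subseteq> U" using good_U[OF R] ranked_sub by auto
  have br0: "b x y \<in> cl ?R0" if "x \<in> ?R0" "y \<in> ?R0" for x y
    using ranked_zero[OF R that] that RU by (metis b_closed cl_inc cl_mono empty_subsetI subsetD)
  have dn0: "dseries i ?R0 \<subseteq> cl ?R0" for i by (rule dseries_sub_cl[OF RU(2) br0])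
  have main: "dseries i R \<subseteq> cl (dseries i ?R0 \<union> ?Q)" for i
  proof (induction i)
    case 0
    show ?case
    proof
      fix u assume u: "u \<in> dseries 0 R"
      hence "deg u \<in> X' \<or> u \<in> cl {}" using R by (auto simp: subring_within_def)
      moreover have uU: "u \<in> U" using u RU by auto
      have "u \<in> ?R0 \<or> u \<in> ranked R (\<lambda>i. i > 0)" if "deg u \<in> X'"
        using that u by (auto simp: ranked_def)
      hence "u \<in> dseries 0 ?R0 \<union> ?Q" if "deg u \<in> X'" using that uU gen.base by auto
      ultimately show "u \<in> cl (dseries 0 ?R0 \<union> ?Q)" using uU cl_inc cl_mono by blast
    qed
  next
    case (Suc i)
    let ?C = "dseries (Suc i) ?R0 \<union> ?Q"
    have bb: "b x y \<in> ?C" if x: "x \<in> dseries i ?R0 \<union> ?Q" and y: "y \<in> dseries i ?R0 \<union> ?Q" for x y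
    proof -
      consider "x \<in> dseries i ?R0" "y \<in> dseries i ?R0" | "x \<in> ?Q" "y \<in> ?Q"
        | "x \<in> dseries i ?R0" "y \<in> ?Q" | "x \<in> ?Q" "y \<in> dseries i ?R0" using x y by blast
      thus ?thesis
      proof cases
        case 1
        hence "x \<in> U" "y \<in> U" using dseries_U[OF RU(2)] by auto
        thus ?thesis using 1 by (auto intro!: cl_inc b_closed)
      next
        case 3
        have "b y x \<in> ?Q" by (rule gen_ranked_normal[OF R]) (use 3 dn0 in auto)
        moreover have "b x y \<in> cl {b y x}"
          using 3 by (intro comm) (auto dest: gen_U subsetD[OF dseries_U[OF RU(2)]])
        ultimately have "b x y \<in> ?Q" by (intro gen.cl) auto
        thus ?thesis by simp
      next
        case 4
        have "b x y \<in> ?Q" by (rule gen_ranked_normal[OF R]) (use 4 dn0 in auto)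
        thus ?thesis by simp
      qed (auto intro: gen.br)
    qed
    show ?case
    proof
      fix u assume "u \<in> dseries (Suc i) R"
      hence u: "u \<in> cl {b x y | x y. x \<in> dseries i R \<and> y \<in> dseries i R}" by simp
      thus "u \<in> cl ?C"
      proof (rule cl_least)
        fix s assume "s \<in> {b x y | x y. x \<in> dseries i R \<and> y \<in> dseries i R}"
        then obtain x y where s: "s = b x y" "x \<in> dseries i R" "y \<in> dseries i R" by blast
        hence xy: "x \<in> cl (dseries i ?R0 \<union> ?Q)" "y \<in> cl (dseries i ?R0 \<union> ?Q)" using Suc by auto
        show "s \<in> cl ?C" unfolding s(1)
        proof (rule bilinear_span[OF xy])
          fix v w assume "v \<in> dseries i ?R0 \<union> ?Q" "v \<in> U" "w \<in> dseries i ?R0 \<union> ?Q" "w \<in> U"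
          thus "b v w \<in> cl ?C" using cl_inc[OF bb b_closed] by blast
        qed
      qed
    qed
  qed
  have "?R0 \<subseteq> cl B0" using RU by (auto simp: ranked_def B0 intro!: cl_inc)
  hence "dseries c ?R0 \<subseteq> cl (dseries c B0)" by (rule dseries_mono) (auto simp: B0)
  hence z: "dseries c ?R0 \<subseteq> cl {}" using cl_trans[OF _ B0_solv] by blast
  show ?thesis
  proof
    fix u assume "u \<in> dseries c R"
    hence "u \<in> cl (dseries c ?R0 \<union> ?Q)" using main by auto
    hence "u \<in> cl ?Q"
    proof (rule cl_least)
      fix s assume "s \<in> dseries c ?R0 \<union> ?Q" "s \<in> U"
      moreover have "s \<in> cl ?Q" if "s \<in> dseries c ?R0" using z that by (meson cl_mono empty_subsetI subsetD)
      ultimately show "s \<in> cl ?Q" by (auto intro: cl_inc)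
    qed
    thus "u \<in> ?Q" by (rule gen_cl)
  qed
qed

text \<open>The element of the generated subring is unfolded by \<open>jac_r\<close> until the last
  factor is a generator. The first factor becomes an arbitrary element of R, which is harmless: the
  count of ranks in \<open>derived_rank\<close> only restricts the last factor.\<close>

lemma gen_last_step:
  assumes R: "good R" and S: "S \<subseteq> R" and h: "h \<in> gen S" and z: "z \<in> R"
  shows "b z h \<in> cl {b z y | z y. z \<in> R \<and> y \<in> S}"
  using h z
proof (induction arbitrary: z rule: gen.induct)
  case (base x)
  thus ?case using good_U[OF R] by (auto intro!: cl_inc b_closed)
next
  case (br x y)
  have xy: "x \<in> R" "y \<in> R" using gen_good[OF R S] br by auto
  hence "b (b z x) y \<in> cl {b z y | z y. z \<in> R \<and> y \<in> S}"
    "b (b z y) x \<in> cl {b z y | z y. z \<in> R \<and> y \<in> S}"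
    using br.IH(1)[of "b z y"] br.IH(2)[of "b z x"] br.prems good_b[OF R] by auto
  moreover have "b z (b x y) \<in> cl {b (b z x) y, b (b z y) x}"
    using xy br.prems good_U[OF R] by (intro jac_r) auto
  ultimately show ?case by (auto intro: cl_least)
next
  case (cl x T)
  show ?case
    by (rule lin_r[OF cl(1)]) (use cl good_U[OF R] in auto)
qed

text \<open>If \<open>z\<close> and \<open>y\<close> have ranks \<open>i < M\<close> and \<open>j \<ge> k\<close> with \<open>i + j \<equiv> k\<close> modulo \<open>M\<close>, then either \<open>j = k\<close> and
  \<open>i = 0\<close>, or both \<open>i\<close> and \<open>j\<close> exceed \<open>k\<close>.\<close>

lemma derived_rank:
  assumes R: "good R" and k: "0 < k" and f: "dseries f R \<subseteq> gen (ranked R (\<lambda>i. i \<ge> k))"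
    and u: "u \<in> dseries (Suc f) R" "deg u \<in> X'" "\<rho> (deg u) = k"
  shows "u \<in> cl ({b x y | x y. x \<in> ranked R (\<lambda>i. i > k) \<and> y \<in> ranked R (\<lambda>i. i > k)}
     \<union> {b x z | x z. x \<in> ranked R (\<lambda>i. i = k) \<and> z \<in> ranked R (\<lambda>i. i = 0)})" (is "_ \<in> cl ?C")
proof -
  let ?S = "ranked R (\<lambda>i. i \<ge> k)"
  let ?D = "{b z y | z y. z \<in> R \<and> y \<in> ?S}"
  have fR: "dseries f R \<subseteq> R" using R is_subring_dseries by (auto simp: subring_within_def)
  have "u \<in> cl {b x y | x y. x \<in> dseries f R \<and> y \<in> dseries f R}" using u by simp
  hence "u \<in> cl ?D"
  proof (rule cl_least)
    fix s assume "s \<in> {b x y | x y. x \<in> dseries f R \<and> y \<in> dseries f R}"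
    then obtain x y where "s = b x y" "x \<in> R" "y \<in> gen ?S" using f fR by blast
    thus "s \<in> cl ?D" using gen_last_step[OF R ranked_sub] by blast
  qed
  \<comment> \<open>Homogeneity discards the brackets of other degrees, so the ranks of the two
    factors add up to \<open>k\<close> modulo \<open>M\<close>.\<close>
  hence "u \<in> cl {w \<in> ?D. deg w = deg u}" by (rule deg_cl)
  thus ?thesis
  proof (rule cl_least)
    fix w assume "w \<in> {w \<in> ?D. deg w = deg u}"
    then obtain z y where w: "w = b z y" "z \<in> R" "y \<in> ?S" "deg w = deg u" by blast
    have U: "z \<in> U" "y \<in> U" using w good_U[OF R] by (auto simp: ranked_def)
    show "w \<in> cl ?C"
    proof (cases "deg z \<in> X'")
      case False
      hence "z \<in> cl {}" using R w by (auto simp: subring_within_def)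
      thus ?thesis using nil_l U w by blast
    next
      case z: True
      have y: "deg y \<in> X'" "k \<le> \<rho> (deg y)" "y \<in> R" using w by (auto simp: ranked_def)
      have eq: "(\<rho> (deg z) + \<rho> (deg y)) mod M = k"
        using \<rho>_add[OF z y(1)] deg_b[OF U] w u by simp
      have lt: "\<rho> (deg z) < M" "\<rho> (deg y) < M" "k < M" using \<rho>_less z y u by blast+
      show ?thesis
      proof (cases "\<rho> (deg y) = k")
        case True
        have "\<rho> (deg z) = 0"
        proof (cases "\<rho> (deg z) + k < M")
          case True
          thus ?thesis using eq \<open>\<rho> (deg y) = k\<close> by simp
        next
          case False
          hence "(\<rho> (deg z) + k) mod M = \<rho> (deg z) + k - M"
            using lt by (simp add: mod_if)
          thus ?thesis using eq \<open>\<rho> (deg y) = k\<close> lt by simp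
        qed
        hence "b y z \<in> ?C" using w z y True by (auto simp: ranked_def)
        hence "b y z \<in> cl ?C" using U by (intro cl_inc b_closed) auto
        moreover have "w \<in> cl {b y z}" unfolding w(1) by (rule comm[OF U])
        ultimately show ?thesis by (auto intro: cl_least)
      next
        case False
        \<comment> \<open>Without wrapping around, the sum would be at least the rank of
          \<open>y\<close>, which now exceeds \<open>k\<close>.\<close>
        have nl: "\<not> \<rho> (deg z) + \<rho> (deg y) < M" using eq y False by auto
        hence "(\<rho> (deg z) + \<rho> (deg y)) mod M = \<rho> (deg z) + \<rho> (deg y) - M"
          using lt by (simp add: mod_if)
        hence "k < \<rho> (deg z)" using eq lt y nl by linarith
        hence "z \<in> ranked R (\<lambda>i. i > k)" "y \<in> ranked R (\<lambda>i. i > k)"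
          using w(2) z y False by (simp_all add: ranked_def)
        hence "b z y \<in> ?C" by blast
        thus ?thesis unfolding w(1) using U by (intro cl_inc b_closed)
      qed
    qed
  qed
qed

text \<open>One use of \<open>derived_rank\<close> writes an element of rank \<open>k\<close>
  through brackets of higher ranks and through [x,z] with \<open>x\<close> of rank \<open>k\<close>
  from the preceding round and \<open>z\<close> of rank 0. After \<open>N\<close> rounds the second
  kind has become words with \<open>N\<close> letters of rank 0, which vanish by
  \<open>B0_act\<close>. The last \<open>f\<close> steps then express everything through ranks at
  least \<open>k\<close>.\<close>

lemma kreknin_step:
  assumes k: "0 < k" and f: "\<And>R. good R \<Longrightarrow> dseries f R \<subseteq> gen (ranked R (\<lambda>i. i \<ge> k))" and R: "good R"
  shows "dseries (f + N * Suc f) R \<subseteq> gen (ranked R (\<lambda>i. i > k))"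
proof -
  let ?Q = "gen (ranked R (\<lambda>i. i > k))"
  define Rs where "Rs i = dseries (i * Suc f) R" for i
  define E where "E i = {foldl b v zs | v zs. v \<in> ranked R (\<lambda>i. i = k) \<and> set zs \<subseteq> ranked R (\<lambda>i. i = 0)
    \<and> length zs = i}" for i
  have Rs: "good (Rs i)" "Rs i \<subseteq> R" for i
    using good_dseries[OF R] R is_subring_dseries by (auto simp: Rs_def subring_within_def)
  have RsS: "Rs (Suc i) = dseries (Suc f) (Rs i)" for i
    using dseries_add[of "Suc f" "i * Suc f" R] by (simp only: Rs_def mult_Suc)
  have RU: "R \<subseteq> U" by (rule good_U[OF R])
  have key: "u \<in> cl (?Q \<union> E i)" if "u \<in> ranked (Rs i) (\<lambda>i. i = k)" for u i
    using that
  proof (induction i arbitrary: u)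
    case 0
    hence u: "u \<in> ranked R (\<lambda>i. i = k)" by (simp add: Rs_def)
    have "u = foldl b u []" by simp
    hence "u \<in> E 0" unfolding E_def using u by force
    thus ?case using u RU by (auto simp: ranked_def intro: cl_inc)
  next
    case (Suc i)
    have "u \<in> cl ({b x y | x y. x \<in> ranked (Rs i) (\<lambda>i. i > k) \<and> y \<in> ranked (Rs i) (\<lambda>i. i > k)}
     \<union> {b x z | x z. x \<in> ranked (Rs i) (\<lambda>i. i = k) \<and> z \<in> ranked (Rs i) (\<lambda>i. i = 0)})"
      by (rule derived_rank[OF Rs(1) k f[OF Rs(1)]]) (use Suc.prems RsS in \<open>auto simp: ranked_def\<close>)
    thus ?case
    proof (rule cl_least, elim UnE)
      fix s assume "s \<in> {b x y | x y. x \<in> ranked (Rs i) (\<lambda>i. i > k) \<and> y \<in> ranked (Rs i) (\<lambda>i. i > k)}"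
      then obtain x y where "s = b x y" "x \<in> ranked R (\<lambda>i. i > k)" "y \<in> ranked R (\<lambda>i. i > k)"
        using Rs(2)[of i] by (auto simp: ranked_def)
      hence "s \<in> ?Q" using RU ranked_sub by (blast intro: gen.br gen.base)
      thus "s \<in> cl (?Q \<union> E (Suc i))" by (intro cl_inc) (auto dest: gen_U)
    next
      fix s assume "s \<in> {b x z | x z. x \<in> ranked (Rs i) (\<lambda>i. i = k) \<and> z \<in> ranked (Rs i) (\<lambda>i. i = 0)}"
      then obtain x z where s: "s = b x z" "x \<in> ranked (Rs i) (\<lambda>i. i = k)" "z \<in> ranked R (\<lambda>i. i = 0)"
        using Rs(2)[of i] by (auto simp: ranked_def)
      have zU: "z \<in> U" "z \<in> cl (ranked R (\<lambda>i. i = 0))" using s RU by (auto simp: ranked_def intro!: cl_inc)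
      show "s \<in> cl (?Q \<union> E (Suc i))" unfolding s(1)
      proof (rule lin_l[OF Suc.IH[OF s(2)] zU(1)], elim UnE)
        fix w assume "w \<in> ?Q"
        hence "b w z \<in> ?Q" using gen_ranked_normal[OF R _ zU(2)] by blast
        thus "b w z \<in> cl (?Q \<union> E (Suc i))" by (intro cl_inc) (auto dest: gen_U)
      next
        fix w assume "w \<in> E i" and wU: "w \<in> U"
        then obtain v zs where "b w z = foldl b v (zs @ [z])" "v \<in> ranked R (\<lambda>i. i = k)"
          "set (zs @ [z]) \<subseteq> ranked R (\<lambda>i. i = 0)" "length (zs @ [z]) = Suc i"
          unfolding E_def using s by auto
        hence "b w z \<in> E (Suc i)" unfolding E_def by blast
        thus "b w z \<in> cl (?Q \<union> E (Suc i))" using wU zU by (intro cl_inc b_closed) auto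
      qed
    qed
  qed
  have EN: "E N \<subseteq> cl {}"
  proof
    fix w assume "w \<in> E N"
    then obtain v zs where w: "w = foldl b v zs" "v \<in> ranked R (\<lambda>i. i = k)" "set zs \<subseteq> ranked R (\<lambda>i. i = 0)"
      "length zs = N" by (auto simp: E_def)
    show "w \<in> cl {}" unfolding w(1)
      by (rule B0_act) (use w RU in \<open>auto simp: ranked_def B0\<close>)
  qed
  have rank_k: "u \<in> ?Q" if "u \<in> ranked (Rs N) (\<lambda>i. i = k)" for u
    by (rule gen.cl[OF key[OF that]]) (use EN gen_nil in auto)
  have ge: "u \<in> ?Q" if "u \<in> ranked (Rs N) (\<lambda>i. i \<ge> k)" for u
  proof (cases "\<rho> (deg u) = k")
    case True
    thus ?thesis using rank_k that by (simp add: ranked_def)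
  next
    case False
    hence "u \<in> ranked R (\<lambda>i. i > k)" using that Rs(2) by (auto simp: ranked_def)
    thus ?thesis using RU ranked_sub by (blast intro: gen.base)
  qed
  have "dseries (f + N * Suc f) R = dseries f (Rs N)" by (simp only: Rs_def dseries_add)
  also have "\<dots> \<subseteq> gen (ranked (Rs N) (\<lambda>i. i \<ge> k))" by (rule f[OF Rs(1)])
  also have "\<dots> \<subseteq> ?Q" using ge by (blast intro: gen_least)
  finally show ?thesis .
qed

text \<open>Only ranks that occur among the degrees in \<open>X'\<close> cost anything. The length
  thus depends on their number and not on the modulus \<open>M\<close>, which has no bound in terms
  of \<open>n\<close>.\<close>

lemma kreknin_rank:
  "good R \<Longrightarrow> dseries (kreknin_length N c (card {i \<in> \<rho> ` X'. 0 < i \<and> i \<le> k})) R \<subseteq> gen (ranked R (\<lambda>i. i > k))"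
proof (induction k arbitrary: R)
  case 0
  have e: "{i \<in> \<rho> ` X'. 0 < i \<and> i \<le> 0} = {}" by auto
  show ?case using dseries_zero_part[OF 0] unfolding e by simp
next
  case (Suc k)
  let ?S = "\<lambda>k. {i \<in> \<rho> ` X'. 0 < i \<and> i \<le> k}"
  have fin: "finite (?S k)" using finite_subset[OF X' X_fin] by simp
  show ?case
  proof (cases "Suc k \<in> \<rho> ` X'")
    case True
    hence "?S (Suc k) = insert (Suc k) (?S k)" by auto
    moreover have "Suc k \<notin> ?S k" by auto
    ultimately have "card (?S (Suc k)) = Suc (card (?S k))" using fin by simp
    moreover have "(\<lambda>i. k < i) = (\<lambda>i. Suc k \<le> i)" by auto
    ultimately show ?thesis
      using kreknin_step[of "Suc k" "kreknin_length N c (card (?S k))", OF _ _ Suc.prems] Suc.IH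
      by simp
  next
    case False
    have "?S (Suc k) = ?S k"
    proof (intro Collect_cong conj_cong refl iffI)
      fix i assume "i \<in> \<rho> ` X'" "i \<le> Suc k"
      thus "i \<le> k" using False by (metis le_Suc_eq)
    qed simp
    moreover have "ranked R (\<lambda>i. i > k) = ranked R (\<lambda>i. i > Suc k)"
      using False by (auto simp: ranked_def) (metis Suc_lessI image_eqI)
    ultimately show ?thesis using Suc by metis
  qed
qed

text \<open>No rank exceeds \<open>M\<close>, so after \<open>M\<close> the set of generators is
  empty and the generated subring consists of zeros.\<close>

lemma kreknin:
  assumes R: "good R"
  shows "dseries (kreknin_length N c n) R \<subseteq> cl {}"
proof -
  let ?K = "{i \<in> \<rho> ` X'. 0 < i \<and> i \<le> M}"
  have "ranked R (\<lambda>i. i > M) = {}" using \<rho>_less by (force simp: ranked_def)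
  hence "dseries (kreknin_length N c (card ?K)) R \<subseteq> cl {}"
    using kreknin_rank[OF R, of M] gen_empty by auto
  moreover have "card ?K \<le> card X'"
    using finite_subset[OF X' X_fin] by (intro surj_card_le[of _ _ \<rho>]) auto
  hence "card ?K \<le> n" using X_card card_mono[OF X_fin X'] by linarith
  ultimately show ?thesis by (rule dseries_nil[OF _ kreknin_length_mono])
qed

end

end

section \<open>Adjoining one degree at a time: cyclic quotients and the bound on the derived
  length\<close>

lemma (in comm_group) generate_insert_decomp:
  assumes "c \<in> carrier G" "Y \<subseteq> carrier G" "a \<in> generate G (insert c Y)"
  shows "\<exists>(i::int) y. y \<in> generate G Y \<and> a = c [^] i \<otimes> y"
  using assms(3)
proof (induction rule: generate.induct)
  case one
  show ?case by (intro exI[of _ 0] exI[of _ \<one>]) (auto intro: generate.one)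
next
  case (incl h)
  show ?case
  proof (cases "h = c")
    case True
    thus ?thesis using assms by (intro exI[of _ 1] exI[of _ \<one>]) (auto intro: generate.one simp: int_pow_1)
  next
    case False
    thus ?thesis using incl assms by (intro exI[of _ 0] exI[of _ h]) (auto intro: generate.incl)
  qed
next
  case (inv h)
  show ?case
  proof (cases "h = c")
    case True
    thus ?thesis using assms
      by (intro exI[of _ "-1"] exI[of _ \<one>]) (auto intro: generate.one simp: int_pow_neg int_pow_1)
  next
    case False
    thus ?thesis using inv assms by (intro exI[of _ 0] exI[of _ "inv h"]) (auto intro: generate.inv)
  qed
next
  case (eng a a')
  then obtain i y i' y' where *: "y \<in> generate G Y" "a = c [^] (i::int) \<otimes> y"
    "y' \<in> generate G Y" "a' = c [^] (i'::int) \<otimes> y'" by blast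
  have "y \<in> carrier G" "y' \<in> carrier G" using * generate_in_carrier[OF assms(2)] by auto
  hence "a \<otimes> a' = c [^] (i + i') \<otimes> (y \<otimes> y')"
    using assms(1) by (simp add: * int_pow_mult m_ac)
  thus ?case using * by (blast intro: generate.eng)
qed

text \<open>The quotient may be infinite cyclic. As only finitely many degrees matter, reducing the exponent
  modulo a large \<open>M\<close> still separates them from \<open>B\<close>.\<close>

lemma (in comm_group) exists_cyclic_rank:
  assumes B: "subgroup B G" and c: "c \<in> carrier G" and X': "finite X'"
    and dec: "\<And>a. a \<in> X' \<Longrightarrow> \<exists>(i::int) y. y \<in> B \<and> a = c [^] i \<otimes> y"
  shows "\<exists>M (\<rho> :: 'a \<Rightarrow> nat). (\<forall>a\<in>X'. \<rho> a < M) \<and>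
    (\<forall>a\<in>X'. \<forall>b\<in>X'. a \<otimes> b \<in> X' \<longrightarrow> \<rho> (a \<otimes> b) = (\<rho> a + \<rho> b) mod M) \<and>
    (\<forall>a\<in>X'. \<rho> a = 0 \<longrightarrow> a \<in> B)"
proof -
  obtain e y where ey: "\<And>a. a \<in> X' \<Longrightarrow> y a \<in> B \<and> a = c [^] (e a :: int) \<otimes> y a"
    using dec by metis
  have BG: "B \<subseteq> carrier G" using B by (rule subgroup.subset)
  \<comment> \<open>\<open>I\<close> is an ideal of the integers. If it is nonzero, its positive
    generator, the order of \<open>c\<close> modulo \<open>B\<close>, serves as modulus.\<close>
  define I where "I = {i :: int. c [^] i \<in> B}"
  have I_diff: "i - j \<in> I" if "i \<in> I" "j \<in> I" for i j
    using that c B by (auto simp: I_def int_pow_diff intro: subgroup.m_closed subgroup.m_inv_closed)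
  have I_mult: "i * k \<in> I" if "i \<in> I" for i k
  proof -
    have "(c [^] i) [^] k \<in> B" using that B by (auto simp: I_def intro: subgroup_int_pow_closed)
    thus ?thesis using c by (simp add: I_def int_pow_pow)
  qed
  obtain M :: nat where M: "M > 0" "\<And>i. i \<in> I \<Longrightarrow> int M dvd i"
    "\<And>a. a \<in> X' \<Longrightarrow> int M dvd e a \<Longrightarrow> e a \<in> I"
  proof (cases "\<exists>m::nat. m > 0 \<and> int m \<in> I")
    case True
    define m where "m = (LEAST m. m > 0 \<and> int m \<in> I)"
    have m: "m > 0 \<and> int m \<in> I" unfolding m_def using True by (rule LeastI_ex)
    have le: "m \<le> k" if "k > 0" "int k \<in> I" for k
      unfolding m_def using that by (intro Least_le) auto
    show ?thesis
    proof (rule that[of m])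
      fix i assume i: "i \<in> I"
      have "i - int m * (i div int m) \<in> I" using i m I_mult by (intro I_diff) auto
      hence r: "i mod int m \<in> I" by (simp add: minus_mult_div_eq_mod)
      have "i mod int m < int m" "0 \<le> i mod int m" using m by auto
      hence "i mod int m = 0" using le[of "nat (i mod int m)"] r by force
      thus "int m dvd i" by auto
    next
      fix a assume "int m dvd e a"
      thus "e a \<in> I" using m I_mult by (auto elim!: dvdE)
    qed (use m in auto)
  next
    case False
    have I0: "I = {0}"
    proof
      show "I \<subseteq> {0}"
      proof
        fix i assume i: "i \<in> I"
        have "\<bar>i\<bar> = i * sgn i" by (simp add: sgn_if)
        hence "\<bar>i\<bar> \<in> I" using I_mult[OF i, of "sgn i"] by (simp only:)
        hence "int (nat \<bar>i\<bar>) \<in> I" by simp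
        with False have "nat \<bar>i\<bar> = 0" by (metis gr0I)
        thus "i \<in> {0}" by simp
      qed
      have "\<one> \<in> B" using B by (rule subgroup.one_closed)
      thus "{0} \<subseteq> I" by (simp add: I_def)
    qed
    \<comment> \<open>This exceeds the absolute value of every exponent that occurs, so 0 is the
      only one among them that it divides.\<close>
    define M where "M = Suc (\<Sum>a\<in>X'. nat \<bar>e a\<bar>)"
    show ?thesis
    proof (rule that[of M])
      fix a assume a: "a \<in> X'" "int M dvd e a"
      have "nat \<bar>e a\<bar> \<le> (\<Sum>a\<in>X'. nat \<bar>e a\<bar>)" using a X' by (intro member_le_sum) auto
      hence "nat \<bar>e a\<bar> < M" by (simp only: M_def less_Suc_eq_le)
      hence "\<bar>e a\<bar> < int M" by linarith
      hence "e a = 0" using a(2) dvd_imp_le_int[of "e a" "int M"] by auto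
      thus "e a \<in> I" by (simp add: I0)
    qed (auto simp: I0 M_def)
  qed
  define \<rho> where "\<rho> a = nat (e a mod int M)" for a
  have \<rho>: "int (\<rho> a) = e a mod int M" for a using M by (simp add: \<rho>_def)
  show ?thesis
  proof (intro exI conjI ballI impI)
    fix a assume "a \<in> X'"
    have "int (\<rho> a) < int M" using M(1) by (simp add: \<rho>)
    thus "\<rho> a < M" by simp
  next
    fix a b assume ab: "a \<in> X'" "b \<in> X'" "a \<otimes> b \<in> X'"
    let ?i = "e a" and ?j = "e b" and ?k = "e (a \<otimes> b)"
    have yB: "y a \<in> B" "y b \<in> B" "y (a \<otimes> b) \<in> B" using ey ab by auto
    have yG: "y a \<in> carrier G" "y b \<in> carrier G" "y (a \<otimes> b) \<in> carrier G" using yB BG by auto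
    have "c [^] ?k \<otimes> y (a \<otimes> b) = (c [^] ?i \<otimes> y a) \<otimes> (c [^] ?j \<otimes> y b)"
      using ey[OF ab(1)] ey[OF ab(2)] ey[OF ab(3)] by simp
    also have "\<dots> = c [^] (?i + ?j) \<otimes> (y a \<otimes> y b)" using yG c by (simp add: int_pow_mult m_ac)
    finally have eq: "c [^] ?k \<otimes> y (a \<otimes> b) = c [^] (?i + ?j) \<otimes> (y a \<otimes> y b)" .
    \<comment> \<open>Two decompositions of the same element differ by a power of \<open>c\<close>
      inside \<open>B\<close>, so their exponents agree modulo \<open>M\<close>.\<close>
    have "c [^] (?i + ?j - ?k) = y (a \<otimes> b) \<otimes> inv (y a \<otimes> y b)"
    proof -
      have "c [^] (?i + ?j - ?k) \<otimes> (y a \<otimes> y b) = inv (c [^] ?k) \<otimes> (c [^] (?i + ?j) \<otimes> (y a \<otimes> y b))"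
        using yG c by (simp add: int_pow_diff m_ac)
      also have "\<dots> = y (a \<otimes> b)" using yG c by (simp add: eq[symmetric] m_assoc[symmetric])
      finally show ?thesis using yG c by (metis inv_solve_right int_pow_closed m_closed)
    qed
    also have "\<dots> \<in> B" using yB B by (intro subgroup.m_closed subgroup.m_inv_closed)
    finally have "int M dvd ?i + ?j - ?k" using M(2) by (simp add: I_def)
    hence "(?i + ?j) mod int M = ?k mod int M" by (simp add: mod_eq_dvd_iff)
    hence "int (\<rho> (a \<otimes> b)) = int ((\<rho> a + \<rho> b) mod M)" by (simp add: \<rho> of_nat_mod mod_add_eq)
    thus "\<rho> (a \<otimes> b) = (\<rho> a + \<rho> b) mod M" by simp
  next
    fix a assume a: "a \<in> X'" "\<rho> a = 0"
    hence "e a mod int M = 0" using \<rho>[of a] by simp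
    hence "c [^] e a \<in> B" using M(3)[OF a(1)] by (auto simp: I_def)
    thus "a \<in> B" using ey[OF a(1)] B by (metis subgroup.m_closed)
  qed
qed

text \<open>Here \<open>d\<close> counts the adjoined elements of the support. The part over the
  group generated by \<open>d\<close> of them has derived length at most f =
  \<open>solvable_length n d\<close>, and its words of length \<open>(n * n + 1) ^ f\<close> act as
  zero. These two numbers are the \<open>c\<close> and \<open>N\<close> of the next
  elimination.\<close>

primrec solvable_length :: "nat \<Rightarrow> nat \<Rightarrow> nat" where
  "solvable_length n 0 = 0"
| "solvable_length n (Suc d) =
    kreknin_length ((n * n + 1) ^ solvable_length n d) (solvable_length n d) n"

lemma solvable_length_mono: "i \<le> j \<Longrightarrow> solvable_length n i \<le> solvable_length n j"
proof (rule lift_Suc_mono_le[of "solvable_length n"])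
  fix d show "solvable_length n d \<le> solvable_length n (Suc d)"
    using kreknin_length_mono[of 0 n "(n * n + 1) ^ solvable_length n d" "solvable_length n d"] by simp
qed

definition higman_length :: "nat \<Rightarrow> nat" where
  "higman_length n = (n * n + 1) ^ solvable_length n n"

context graded_span
begin

text \<open>Adjoining \<open>c\<close> to Y gives a group that is cyclic modulo the group generated
  by Y. Degrees of rank 0 fall into the latter, where the induction hypothesis provides solvability
  and, through \<open>solvable_acts_nilpotently\<close>, the nilpotent action on all of
  \<open>U\<close>.\<close>

lemma solvable_generate:
  assumes "finite Y" "Y \<subseteq> \<X>"
  shows "dseries (solvable_length n (card Y)) {u \<in> U. deg u \<in> \<X> \<inter> generate A Y} \<subseteq> cl {}"
  using assms
proof (induction Y rule: finite_induct)
  case empty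
  \<comment> \<open>The neutral element in \<X> would give a constant progression inside \<X>. So
    over the trivial group there is nothing to show.\<close>
  have "\<one> \<notin> \<X>"
  proof
    assume "\<one> \<in> \<X>"
    then obtain k :: nat where "\<one> \<otimes> \<one> [^] k \<notin> \<X>"
      using X_free unfolding arithmetically_free_def by blast
    with \<open>\<one> \<in> \<X>\<close> show False by simp
  qed
  hence e: "{u \<in> U. deg u \<in> \<X> \<inter> generate A {}} = {}" by (auto simp: generate_empty)
  show ?case unfolding e by simp
next
  case (insert c Y)
  have XA: "\<X> \<subseteq> carrier A" using X_free by (simp add: arithmetically_free_def)
  have YA: "Y \<subseteq> carrier A" "c \<in> carrier A" "insert c Y \<subseteq> carrier A" using insert XA by auto
  let ?f = "solvable_length n (card Y)" and ?UY = "{u \<in> U. deg u \<in> \<X> \<inter> generate A Y}"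
  let ?X' = "\<X> \<inter> generate A (insert c Y)"
  have IH: "dseries ?f ?UY \<subseteq> cl {}" using insert by simp
  have dec: "\<exists>(i::int) y. y \<in> generate A Y \<and> a = c [^] i \<otimes> y" if "a \<in> ?X'" for a
    using generate_insert_decomp[OF YA(2,1)] that by auto
  have finX': "finite ?X'" using X_fin by simp
  obtain M \<rho> where \<rho>: "\<And>a. a \<in> ?X' \<Longrightarrow> \<rho> a < M"
    "\<And>a b. \<lbrakk>a \<in> ?X'; b \<in> ?X'; a \<otimes> b \<in> ?X'\<rbrakk> \<Longrightarrow> \<rho> (a \<otimes> b) = (\<rho> a + \<rho> b) mod M"
    "\<And>a. \<lbrakk>a \<in> ?X'; \<rho> a = (0::nat)\<rbrakk> \<Longrightarrow> a \<in> generate A Y"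
    using exists_cyclic_rank[OF generate_is_subgroup[OF YA(1)] YA(2) finX' dec] by blast
  define B0 where "B0 = {u \<in> U. deg u \<in> ?X' \<and> \<rho> (deg u) = 0}"
  have B0: "B0 \<subseteq> ?UY" using \<rho>(3) by (auto simp: B0_def)
  have UY_br: "b x y \<in> cl ?UY" if "x \<in> ?UY" "y \<in> ?UY" for x y
  proof (cases "deg (b x y) \<in> \<X>")
    case True
    thus ?thesis using that by (intro cl_inc b_closed) (auto simp: deg_b b_closed intro: generate.eng)
  next
    case False
    hence "b x y \<in> cl {}" using that by (intro nil b_closed) auto
    thus ?thesis by (rule cl_mono) simp
  qed
  have act: "foldl b v zs \<in> cl {}"
    if "v \<in> U" "set zs \<subseteq> B0" "length zs = (n * n + 1) ^ ?f" for v zs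
    by (rule solvable_acts_nilpotently[OF _ UY_br IH that(1) _ that(3)]) (use that B0 in auto)
  have solv: "dseries ?f B0 \<subseteq> cl {}"
  proof -
    have "dseries ?f B0 \<subseteq> cl (dseries ?f ?UY)" by (rule dseries_mono) (use B0 in \<open>auto intro!: cl_inc\<close>)
    thus ?thesis using cl_trans[OF _ IH] by blast
  qed
  \<comment> \<open>The zeros of the remaining degrees are added to obtain a subring.\<close>
  define R where "R = {u \<in> U. deg u \<in> ?X' \<or> u \<in> cl {}}"
  have "is_subring R" unfolding is_subring_def
  proof (intro conjI ballI)
    show "R \<subseteq> U" by (auto simp: R_def)
  next
    fix x assume x: "x \<in> cl R"
    show "x \<in> R"
    proof (cases "deg x \<in> ?X'")
      case True
      thus ?thesis using cl_in_U[OF x] by (simp add: R_def)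
    next
      case False
      have "x \<in> cl {s \<in> R. deg s = deg x}" using x by (rule deg_cl)
      hence "x \<in> cl {}" by (rule cl_trans) (use False in \<open>auto simp: R_def\<close>)
      thus ?thesis using cl_in_U[OF x] by (simp add: R_def)
    qed
  next
    fix x y assume xy: "x \<in> R" "y \<in> R"
    hence U: "x \<in> U" "y \<in> U" by (auto simp: R_def)
    consider "x \<in> cl {}" | "y \<in> cl {}" | "deg x \<in> ?X'" "deg y \<in> ?X'" using xy by (auto simp: R_def)
    hence "deg (b x y) \<in> ?X' \<or> b x y \<in> cl {}"
    proof cases
      case 3
      hence "deg (b x y) \<in> generate A (insert c Y)" using U by (auto simp: deg_b intro: generate.eng)
      thus ?thesis using nil[of "b x y"] U b_closed by blast
    qed (use U nil_l nil_r in blast)+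
    thus "b x y \<in> R" using U b_closed by (simp add: R_def)
  qed
  hence "subring_within ?X' R" by (auto simp: subring_within_def R_def)
  hence "dseries (kreknin_length ((n * n + 1) ^ ?f) ?f n) R \<subseteq> cl {}"
    using kreknin[where R = R, OF Int_lower1 \<rho>(1,2) B0_def solv act] by blast
  moreover have "{u \<in> U. deg u \<in> ?X'} \<subseteq> cl R" by (auto simp: R_def intro!: cl_inc)
  hence "dseries (kreknin_length ((n * n + 1) ^ ?f) ?f n) {u \<in> U. deg u \<in> ?X'}
      \<subseteq> cl (dseries (kreknin_length ((n * n + 1) ^ ?f) ?f n) R)"
    by (rule dseries_mono) (auto simp: R_def)
  ultimately have "dseries (kreknin_length ((n * n + 1) ^ ?f) ?f n) {u \<in> U. deg u \<in> ?X'} \<subseteq> cl {}"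
    using cl_trans by blast
  thus ?case using insert by simp
qed

theorem long_words_nil:
  assumes "v \<in> U" "set zs \<subseteq> U" "length zs = higman_length n"
  shows "foldl b v zs \<in> cl {}"
proof (rule solvable_acts_nilpotently[OF _ _ _ assms(1,2)])
  let ?UX = "{u \<in> U. deg u \<in> \<X> \<inter> generate A \<X>}"
  have "dseries (solvable_length n n) ?UX \<subseteq> cl {}"
    by (rule dseries_nil[OF solvable_generate[OF X_fin order_refl] solvable_length_mono[OF X_card]])
  moreover have "U \<subseteq> cl ?UX"
  proof
    fix u assume u: "u \<in> U"
    show "u \<in> cl ?UX"
    proof (cases "deg u \<in> \<X>")
      case True
      thus ?thesis using u by (intro cl_inc) (auto intro: generate.incl)
    next
      case False
      thus ?thesis using cl_mono[OF nil[OF u False]] by blast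
    qed
  qed
  hence "dseries (solvable_length n n) U \<subseteq> cl (dseries (solvable_length n n) ?UX)" by (rule dseries_mono) auto
  ultimately show "dseries (solvable_length n n) U \<subseteq> cl {}" using cl_trans by blast
  show "length zs = (n * n + 1) ^ solvable_length n n" using assms by (simp add: higman_length_def)
qed (auto intro: b_closed cl_inc)

end

section \<open>Additive spans and the lower central series of a Lie ring\<close>

context lie_ring
begin

abbreviation aspan :: "'a set \<Rightarrow> 'a set" where
  "aspan S \<equiv> generate (add_monoid L) S"

lemma aspan_closed: "\<lbrakk>x \<in> aspan S; S \<subseteq> carrier L\<rbrakk> \<Longrightarrow> x \<in> carrier L"
  using add.generate_in_carrier by blast

lemma aspan_subgroup: "S \<subseteq> carrier L \<Longrightarrow> subgroup (aspan S) (add_monoid L)"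
  by (rule add.generate_is_subgroup) simp

lemma aspan_incl: "x \<in> S \<Longrightarrow> x \<in> aspan S"
  by (rule generate.incl)

lemma aspan_empty: "aspan {} = {\<zero>}"
  using add.generate_empty by simp

lemma aspan_induct [consumes 2, case_names incl zero neg add]:
  assumes "x \<in> aspan S" "S \<subseteq> carrier L"
    and "\<And>s. s \<in> S \<Longrightarrow> P s" and "P \<zero>"
    and "\<And>x. \<lbrakk>x \<in> carrier L; P x\<rbrakk> \<Longrightarrow> P (\<ominus> x)"
    and "\<And>x y. \<lbrakk>x \<in> carrier L; y \<in> carrier L; P x; P y\<rbrakk> \<Longrightarrow> P (x \<oplus> y)"
  shows "P x"
proof -
  have "x \<in> carrier L \<and> P x"
    using assms(1)
  proof (induction rule: generate.induct)
    case (inv h)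
    have "inv\<^bsub>add_monoid L\<^esub> h = \<ominus> h" by (simp add: a_inv_def)
    thus ?case using inv assms by (simp add: subset_eq)
  qed (use assms in auto)
  thus ?thesis ..
qed

lemma add_subgroup_zero: "subgroup H (add_monoid L) \<Longrightarrow> \<zero> \<in> H"
  using subgroup.one_closed by fastforce

lemma add_subgroup_add: "\<lbrakk>subgroup H (add_monoid L); x \<in> H; y \<in> H\<rbrakk> \<Longrightarrow> x \<oplus> y \<in> H"
  using subgroup.m_closed by fastforce

lemma add_subgroup_neg: "\<lbrakk>subgroup H (add_monoid L); x \<in> H\<rbrakk> \<Longrightarrow> \<ominus> x \<in> H"
  using subgroup.m_inv_closed[of H "add_monoid L" x] by (simp add: a_inv_def)

lemma add_subgroup_sub: "subgroup H (add_monoid L) \<Longrightarrow> H \<subseteq> carrier L"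
  using subgroup.subset by fastforce

lemma aspan_least:
  assumes "x \<in> aspan S" "subgroup H (add_monoid L)" "S \<subseteq> H"
  shows "x \<in> H"
  using add.generate_subgroup_incl[OF assms(3,2)] assms(1) by blast

lemma bracket_zero_l [simp]: "x \<in> carrier L \<Longrightarrow> \<zero> \<otimes> x = \<zero>"
  using bracket_l_distr[of \<zero> \<zero> x] bracket_closed[of \<zero> x] by simp

lemma bracket_zero_r [simp]: "x \<in> carrier L \<Longrightarrow> x \<otimes> \<zero> = \<zero>"
  using bracket_r_distr[of \<zero> \<zero> x] bracket_closed[of x \<zero>] by simp

lemma bracket_neg_l: "\<lbrakk>x \<in> carrier L; y \<in> carrier L\<rbrakk> \<Longrightarrow> (\<ominus> x) \<otimes> y = \<ominus> (x \<otimes> y)"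
  using bracket_l_distr[of "\<ominus> x" x y] bracket_closed
  by (metis a_inv_closed bracket_zero_l l_neg minus_equality)

lemma bracket_neg_r: "\<lbrakk>x \<in> carrier L; y \<in> carrier L\<rbrakk> \<Longrightarrow> x \<otimes> (\<ominus> y) = \<ominus> (x \<otimes> y)"
  using bracket_r_distr[of "\<ominus> y" y x] bracket_closed
  by (metis a_inv_closed bracket_zero_r l_neg minus_equality)

lemma bracket_anti:
  assumes "x \<in> carrier L" "y \<in> carrier L"
  shows "x \<otimes> y = \<ominus> (y \<otimes> x)"
proof -
  have "\<zero> = (x \<oplus> y) \<otimes> (x \<oplus> y)" using assms by (simp add: bracket_alternating)
  also have "\<dots> = (x \<otimes> (x \<oplus> y)) \<oplus> (y \<otimes> (x \<oplus> y))" using assms by (intro bracket_l_distr) auto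
  also have "\<dots> = (x \<otimes> y) \<oplus> (y \<otimes> x)"
    using assms by (simp add: bracket_r_distr bracket_closed bracket_alternating)
  finally show ?thesis using assms by (metis bracket_closed minus_equality)
qed

lemma bracket_jacobi_l:
  assumes "x \<in> carrier L" "y \<in> carrier L" "z \<in> carrier L"
  shows "(x \<otimes> y) \<otimes> z = ((x \<otimes> z) \<otimes> y) \<oplus> (x \<otimes> (y \<otimes> z))"
proof -
  note c = assms bracket_closed
  have "y \<otimes> (z \<otimes> x) = (x \<otimes> z) \<otimes> y"
    using c bracket_anti[of y "z \<otimes> x"] bracket_anti[of x z] bracket_neg_l[of "z \<otimes> x" y] by simp
  moreover have "z \<otimes> (x \<otimes> y) = \<ominus> ((x \<otimes> y) \<otimes> z)" using c by (intro bracket_anti) auto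
  ultimately have "((x \<otimes> (y \<otimes> z)) \<oplus> ((x \<otimes> z) \<otimes> y)) \<oplus> \<ominus> ((x \<otimes> y) \<otimes> z) = \<zero>"
    using jacobi[OF assms] by simp
  hence "(x \<otimes> (y \<otimes> z)) \<oplus> ((x \<otimes> z) \<otimes> y) = (x \<otimes> y) \<otimes> z"
    using c minus_equality[of "(x \<otimes> (y \<otimes> z)) \<oplus> ((x \<otimes> z) \<otimes> y)" "\<ominus> ((x \<otimes> y) \<otimes> z)"]
    by simp
  thus ?thesis using a_comm[of "x \<otimes> (y \<otimes> z)" "(x \<otimes> z) \<otimes> y"] c by simp
qed

lemma aspan_bracket_l:
  assumes "x \<in> aspan S" "S \<subseteq> carrier L" "y \<in> carrier L" "subgroup H (add_monoid L)"
    and "\<And>s. s \<in> S \<Longrightarrow> s \<otimes> y \<in> H"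
  shows "x \<otimes> y \<in> H"
  using assms(1,2)
  by (induction rule: aspan_induct)
    (use assms in \<open>auto simp: bracket_neg_l bracket_l_distr add_subgroup_zero
       intro: add_subgroup_neg add_subgroup_add\<close>)

lemma aspan_bracket_r:
  assumes "y \<in> aspan S" "S \<subseteq> carrier L" "x \<in> carrier L" "subgroup H (add_monoid L)"
    and "\<And>s. s \<in> S \<Longrightarrow> x \<otimes> s \<in> H"
  shows "x \<otimes> y \<in> H"
  using assms(1,2)
  by (induction rule: aspan_induct)
    (use assms in \<open>auto simp: bracket_neg_r bracket_r_distr add_subgroup_zero
       intro: add_subgroup_neg add_subgroup_add\<close>)

lemma lower_central_sub: "lower_central L i \<subseteq> carrier L"
proof (induction i)
  case (Suc i)
  hence "{x \<otimes> y | x y. x \<in> lower_central L i \<and> y \<in> carrier L} \<subseteq> carrier L"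
    by (auto intro: bracket_closed)
  thus ?case using aspan_closed by auto
qed simp

lemma lower_central_subgroup: "subgroup (lower_central L i) (add_monoid L)"
proof (cases i)
  case 0
  thus ?thesis using add.subgroup_self by simp
next
  case (Suc j)
  have "{x \<otimes> y | x y. x \<in> lower_central L j \<and> y \<in> carrier L} \<subseteq> carrier L"
    using lower_central_sub by (auto intro: bracket_closed)
  thus ?thesis using aspan_subgroup Suc by simp
qed

lemma lower_central_bracket:
  "\<lbrakk>x \<in> lower_central L i; y \<in> carrier L\<rbrakk> \<Longrightarrow> x \<otimes> y \<in> lower_central L (Suc i)"
  by (auto intro: aspan_incl)

lemma lower_central_foldl:
  "\<lbrakk>x \<in> carrier L; set zs \<subseteq> carrier L\<rbrakk> \<Longrightarrow> foldl (\<otimes>) x zs \<in> lower_central L (length zs)"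
  by (induction zs rule: rev_induct) (auto intro: aspan_incl)

text \<open>By biadditivity every letter may be taken from a set of additive generators. For a
  graded ring these are the homogeneous elements, so nilpotency is a statement about homogeneous
  words.\<close>

lemma lower_central_words:
  assumes W: "W \<subseteq> carrier L" "carrier L \<subseteq> aspan W"
  shows "lower_central L i \<subseteq> aspan {foldl (\<otimes>) v zs | v zs. v \<in> W \<and> set zs \<subseteq> W \<and> length zs = i}"
proof (induction i)
  case 0
  have "{foldl (\<otimes>) v zs | v zs. v \<in> W \<and> set zs \<subseteq> W \<and> length zs = 0} = W" by auto
  thus ?case using W by simp
next
  case (Suc i)
  let ?W = "\<lambda>i. {foldl (\<otimes>) v zs | v zs. v \<in> W \<and> set zs \<subseteq> W \<and> length zs = i}"
  have wc: "foldl (\<otimes>) v zs \<in> carrier L" if "v \<in> W" "set zs \<subseteq> W" for v zs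
    using that W by (intro subsetD[OF lower_central_sub lower_central_foldl]) auto
  hence WC: "?W i \<subseteq> carrier L" for i by auto
  note H = aspan_subgroup[OF WC[of "Suc i"]]
  have "x \<otimes> y \<in> aspan (?W (Suc i))" if "x \<in> lower_central L i" "y \<in> carrier L" for x y
  proof (rule aspan_bracket_l[OF _ WC that(2) H])
    show "x \<in> aspan (?W i)" using that Suc by blast
    fix s assume "s \<in> ?W i"
    then obtain v zs where s: "s = foldl (\<otimes>) v zs" "v \<in> W" "set zs \<subseteq> W" "length zs = i" by blast
    show "s \<otimes> y \<in> aspan (?W (Suc i))"
    proof (rule aspan_bracket_r[OF _ W(1) _ H])
      show "y \<in> aspan W" using that W by blast
      show "s \<in> carrier L" using s wc by blast
      fix w assume "w \<in> W"
      hence "s \<otimes> w = foldl (\<otimes>) v (zs @ [w])" "set (zs @ [w]) \<subseteq> W" "length (zs @ [w]) = Suc i"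
        using s by auto
      thus "s \<otimes> w \<in> aspan (?W (Suc i))" using s(2) by (intro aspan_incl) blast
    qed
  qed
  thus ?case unfolding lower_central.simps by (intro subsetI, elim aspan_least[OF _ H]) blast
qed

lemma lower_central_eq_zeroI:
  assumes "W \<subseteq> carrier L" "carrier L \<subseteq> aspan W"
    and "\<And>v zs. \<lbrakk>v \<in> W; set zs \<subseteq> W; length zs = i\<rbrakk> \<Longrightarrow> foldl (\<otimes>) v zs = \<zero>"
  shows "lower_central L i = {\<zero>}"
proof -
  let ?S = "{foldl (\<otimes>) v zs | v zs. v \<in> W \<and> set zs \<subseteq> W \<and> length zs = i}"
  have "?S \<subseteq> {\<zero>}" using assms(3) by auto
  moreover have "subgroup {\<zero>} (add_monoid L)" using aspan_subgroup[of "{}"] by (simp add: aspan_empty)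
  ultimately have "aspan ?S \<subseteq> {\<zero>}" using aspan_least by blast
  hence "lower_central L i \<subseteq> {\<zero>}" using lower_central_words[OF assms(1,2), of i] by blast
  thus ?thesis using add_subgroup_zero[OF lower_central_subgroup] by blast
qed

lemma lower_central_zero_mono:
  assumes "lower_central L c = {\<zero>}" "c \<le> d"
  shows "lower_central L d = {\<zero>}"
  using assms(2)
proof (induction rule: dec_induct)
  case (step m)
  have "{x \<otimes> y | x y. x \<in> lower_central L m \<and> y \<in> carrier L} \<subseteq> {\<zero>}" unfolding step.IH by auto
  moreover have "subgroup {\<zero>} (add_monoid L)" using aspan_subgroup[of "{}"] by (simp add: aspan_empty)
  ultimately have "lower_central L (Suc m) \<subseteq> {\<zero>}"
    unfolding lower_central.simps using aspan_least by blast
  thus ?case using add_subgroup_zero[OF lower_central_subgroup] by blast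
qed (rule assms)

lemma nilpotency_class_le_iff:
  "lie_nilpotent L \<and> nilpotency_class L \<le> c \<longleftrightarrow> lower_central L c = {\<zero>}"
proof
  assume h: "lie_nilpotent L \<and> nilpotency_class L \<le> c"
  hence "\<exists>c. lower_central L c = {\<zero>}" by (simp add: lie_nilpotent_def)
  hence "lower_central L (nilpotency_class L) = {\<zero>}"
    unfolding nilpotency_class_def by (rule LeastI_ex)
  thus "lower_central L c = {\<zero>}" by (rule lower_central_zero_mono) (use h in simp)
next
  assume "lower_central L c = {\<zero>}"
  thus "lie_nilpotent L \<and> nilpotency_class L \<le> c"
    using Least_le[of "\<lambda>c. lower_central L c = {\<zero>}" c]
    by (auto simp: lie_nilpotent_def nilpotency_class_def)
qed

end

section \<open>Homogeneous elements of a graded Lie ring and the existence of a Higman bound\<close>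

locale graded_lie_ring = lie_ring L + A: comm_group A
  for L :: "('l, 'r) ring_scheme" (structure) and A :: "('a, 'm) monoid_scheme" +
  fixes G :: "'a \<Rightarrow> 'l set" and \<X> :: "'a set" and n :: nat
  assumes G_subgroup: "a \<in> carrier A \<Longrightarrow> subgroup (G a) (add_monoid L)"
    and G_bracket: "\<lbrakk>a \<in> carrier A; b \<in> carrier A; x \<in> G a; y \<in> G b\<rbrakk> \<Longrightarrow> x \<otimes> y \<in> G (a \<otimes>\<^bsub>A\<^esub> b)"
    and G_span: "carrier L \<subseteq> aspan (\<Union>a\<in>carrier A. G a)"
    and G_supp: "\<lbrakk>a \<in> carrier A; a \<notin> \<X>\<rbrakk> \<Longrightarrow> G a = {\<zero>}"
    and X_free: "arithmetically_free A \<X>" and X_fin: "finite \<X>" and X_card: "card \<X> \<le> n"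
begin

text \<open>Elements carry their degree as a tag, because 0 lies in every component and would
  otherwise have no degree.\<close>

definition hom_elems :: "('a \<times> 'l) set" where
  "hom_elems = (SIGMA a:carrier A. G a)"

definition hom_cl :: "('a \<times> 'l) set \<Rightarrow> ('a \<times> 'l) set" where
  "hom_cl S = (SIGMA a:carrier A. aspan {x. (a, x) \<in> S \<inter> hom_elems})"

definition hom_br :: "'a \<times> 'l \<Rightarrow> 'a \<times> 'l \<Rightarrow> 'a \<times> 'l" where
  "hom_br u v = (fst u \<otimes>\<^bsub>A\<^esub> fst v, snd u \<otimes> snd v)"

lemma G_sub: "a \<in> carrier A \<Longrightarrow> G a \<subseteq> carrier L"
  using G_subgroup add_subgroup_sub by blast

lemma G_carrier: "\<lbrakk>a \<in> carrier A; x \<in> G a\<rbrakk> \<Longrightarrow> x \<in> carrier L"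
  using G_sub by blast

lemma slice_sub: "a \<in> carrier A \<Longrightarrow> {x. (a, x) \<in> S \<inter> hom_elems} \<subseteq> G a"
  by (auto simp: hom_elems_def)

lemma slice_carrier: "{x. (a, x) \<in> S \<inter> hom_elems} \<subseteq> carrier L"
  by (auto simp: hom_elems_def dest: G_carrier)

lemma hom_br_closed: "\<lbrakk>u \<in> hom_elems; v \<in> hom_elems\<rbrakk> \<Longrightarrow> hom_br u v \<in> hom_elems"
  by (auto simp: hom_elems_def hom_br_def G_bracket)

lemma hom_clI:
  "\<lbrakk>x \<in> aspan {y. (a, y) \<in> S}; S \<subseteq> hom_elems; a \<in> carrier A\<rbrakk> \<Longrightarrow> (a, x) \<in> hom_cl S"
  using Int_absorb2[of S hom_elems] by (simp add: hom_cl_def)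

sublocale H: graded_span A hom_elems hom_cl hom_br fst \<X> n
proof
  fix S
  show "hom_cl S \<subseteq> hom_elems"
    unfolding hom_cl_def hom_elems_def
    using aspan_least[OF _ G_subgroup slice_sub, unfolded hom_elems_def] by blast
next
  fix x S assume "x \<in> S" "x \<in> hom_elems"
  thus "x \<in> hom_cl S" by (cases x) (auto simp: hom_cl_def hom_elems_def intro: aspan_incl)
next
  fix x S T assume x: "x \<in> hom_cl S" and h: "\<And>s. s \<in> S \<Longrightarrow> s \<in> hom_elems \<Longrightarrow> s \<in> hom_cl T"
  obtain a y where xy: "x = (a, y)" "a \<in> carrier A" "y \<in> aspan {x. (a, x) \<in> S \<inter> hom_elems}"
    using x by (auto simp: hom_cl_def)
  have "y \<in> aspan {x. (a, x) \<in> T \<inter> hom_elems}"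
    by (rule aspan_least[OF xy(3) aspan_subgroup[OF slice_carrier]]) (use h in \<open>auto simp: hom_cl_def\<close>)
  thus "x \<in> hom_cl T" using xy by (simp add: hom_cl_def)
next
  fix x y assume "x \<in> hom_elems" "y \<in> hom_elems"
  thus "hom_br x y \<in> hom_elems" by (rule hom_br_closed)
next
  fix x y S T assume x: "x \<in> hom_cl S" and y: "y \<in> hom_elems"
    and h: "\<And>s. s \<in> S \<Longrightarrow> s \<in> hom_elems \<Longrightarrow> hom_br s y \<in> hom_cl T"
  obtain a z where xz: "x = (a, z)" "a \<in> carrier A" "z \<in> aspan {x. (a, x) \<in> S \<inter> hom_elems}"
    using x by (auto simp: hom_cl_def)
  have "z \<otimes> snd y \<in> aspan {w. (a \<otimes>\<^bsub>A\<^esub> fst y, w) \<in> T \<inter> hom_elems}"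
  proof (rule aspan_bracket_l[OF xz(3) slice_carrier _ aspan_subgroup[OF slice_carrier]])
    show "snd y \<in> carrier L" using y G_carrier by (auto simp: hom_elems_def)
    fix s assume "s \<in> {x. (a, x) \<in> S \<inter> hom_elems}"
    hence "hom_br (a, s) y \<in> hom_cl T" by (intro h) auto
    thus "s \<otimes> snd y \<in> aspan {w. (a \<otimes>\<^bsub>A\<^esub> fst y, w) \<in> T \<inter> hom_elems}"
      by (simp add: hom_br_def hom_cl_def)
  qed
  thus "hom_br x y \<in> hom_cl T" using xz y by (auto simp: hom_cl_def hom_br_def hom_elems_def)
next
  fix x y assume xy: "x \<in> hom_elems" "y \<in> hom_elems"
  obtain a s b t where ab: "x = (a, s)" "y = (b, t)" "a \<in> carrier A" "b \<in> carrier A"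
    and st: "s \<in> G a" "t \<in> G b" using xy unfolding hom_elems_def by blast
  note e = ab G_carrier[OF ab(3) st(1)] G_carrier[OF ab(4) st(2)]
  have "s \<otimes> t \<in> aspan {t \<otimes> s}"
    unfolding bracket_anti[OF e(5,6)] using e
    by (intro add_subgroup_neg aspan_subgroup aspan_incl) (auto intro: bracket_closed)
  thus "hom_br x y \<in> hom_cl {hom_br y x}"
    using e xy hom_br_closed[OF xy(2,1)]
    by (auto simp: hom_br_def A.m_comm intro!: hom_clI)
next
  fix x y z assume xyz: "x \<in> hom_elems" "y \<in> hom_elems" "z \<in> hom_elems"
  obtain a s b t c r where e: "x = (a, s)" "y = (b, t)" "z = (c, r)"
    "a \<in> carrier A" "b \<in> carrier A" "c \<in> carrier A"
    and str: "s \<in> G a" "t \<in> G b" "r \<in> G c"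
    using xyz unfolding hom_elems_def by blast
  note cc = G_carrier[OF e(4) str(1)] G_carrier[OF e(5) str(2)] G_carrier[OF e(6) str(3)]
  have "(s \<otimes> t) \<otimes> r \<in> aspan {(s \<otimes> r) \<otimes> t, s \<otimes> (t \<otimes> r)}"
    unfolding bracket_jacobi_l[OF cc] using cc
    by (intro add_subgroup_add aspan_subgroup aspan_incl) (auto intro: bracket_closed)
  moreover have "{(s \<otimes> r) \<otimes> t, s \<otimes> (t \<otimes> r)} =
      {w. (a \<otimes>\<^bsub>A\<^esub> b \<otimes>\<^bsub>A\<^esub> c, w) \<in> {hom_br (hom_br x z) y, hom_br x (hom_br y z)}}"
    using e by (auto simp: hom_br_def A.m_ac)
  ultimately have "(a \<otimes>\<^bsub>A\<^esub> b \<otimes>\<^bsub>A\<^esub> c, (s \<otimes> t) \<otimes> r) \<in> hom_cl {hom_br (hom_br x z) y, hom_br x (hom_br y z)}"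
    using e xyz hom_br_closed by (intro hom_clI) auto
  thus "hom_br (hom_br x y) z \<in> hom_cl {hom_br (hom_br x z) y, hom_br x (hom_br y z)}"
    by (simp add: hom_br_def e)
next
  fix x assume "x \<in> hom_elems" thus "fst x \<in> carrier A" by (auto simp: hom_elems_def)
next
  fix x y show "fst (hom_br x y) = fst x \<otimes>\<^bsub>A\<^esub> fst y" by (simp add: hom_br_def)
next
  fix x S assume "x \<in> hom_cl S"
  thus "x \<in> hom_cl {s \<in> S. fst s = fst x}" by (auto simp: hom_cl_def)
next
  fix x assume "x \<in> hom_elems" "fst x \<notin> \<X>"
  thus "x \<in> hom_cl {}" using G_supp by (auto simp: hom_elems_def hom_cl_def aspan_empty)
qed (rule X_free X_fin X_card)+

lemma foldl_hom_br:
  "snd (foldl hom_br u us) = foldl (\<otimes>) (snd u) (map snd us)"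
  by (induction us arbitrary: u) (auto simp: hom_br_def)

theorem lower_central_vanishes: "lower_central L (higman_length n) = {\<zero>}"
proof (rule lower_central_eq_zeroI)
  let ?W = "\<Union>a\<in>carrier A. G a"
  show "?W \<subseteq> carrier L" "carrier L \<subseteq> aspan ?W" using G_sub G_span by blast+
  fix v zs assume vz: "v \<in> ?W" "set zs \<subseteq> ?W" "length zs = higman_length n"
  obtain a where a: "(a, v) \<in> hom_elems" using vz(1) unfolding hom_elems_def by blast
  have "\<exists>us. set us \<subseteq> hom_elems \<and> map snd us = zs"
    using vz(2)
  proof (induction zs)
    case (Cons z zs)
    then obtain us where "set us \<subseteq> hom_elems" "map snd us = zs" by auto
    moreover obtain b where "(b, z) \<in> hom_elems" using Cons.prems unfolding hom_elems_def by auto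
    ultimately show ?case by (intro exI[of _ "(b, z) # us"]) auto
  qed simp
  then obtain us where us: "set us \<subseteq> hom_elems" "map snd us = zs" by blast
  have "length us = higman_length n" using us(2) vz(3) by auto
  hence "foldl hom_br (a, v) us \<in> hom_cl {}" by (rule H.long_words_nil[OF a us(1)])
  hence "snd (foldl hom_br (a, v) us) = \<zero>" by (auto simp: hom_cl_def aspan_empty)
  thus "foldl (\<otimes>) v zs = \<zero>" by (simp add: foldl_hom_br us)
qed

end

lemma lie_gradingE_span:
  assumes "lie_ring L" "lie_grading A L G"
  shows "carrier L \<subseteq> generate (add_monoid L) (\<Union>a\<in>carrier A. G a)"
proof
  interpret lie_ring L by (rule assms)
  have G: "subgroup (G a) (add_monoid L)" if "a \<in> carrier A" for a
    using assms that by (simp add: lie_grading_def)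
  hence GC: "(\<Union>a\<in>carrier A. G a) \<subseteq> carrier L" using add_subgroup_sub by blast
  fix x assume "x \<in> carrier L"
  then obtain f where f: "f \<in> (\<Pi>\<^sub>E a\<in>carrier A. G a)"
    "x = (\<Oplus>\<^bsub>L\<^esub>a\<in>{a \<in> carrier A. f a \<noteq> \<zero>\<^bsub>L\<^esub>}. f a)"
    using assms(2) unfolding lie_grading_def by metis
  have "(\<Oplus>\<^bsub>L\<^esub>a\<in>S. f a) \<in> aspan (\<Union>a\<in>carrier A. G a)" if "S \<subseteq> carrier A" for S
    using that
  proof (induction S rule: infinite_finite_induct)
    case (infinite S)
    thus ?case using add_subgroup_zero[OF aspan_subgroup[OF GC]] by simp
  next
    case empty
    thus ?case using add_subgroup_zero[OF aspan_subgroup[OF GC]] by simp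
  next
    case (insert a S)
    have fG: "f b \<in> G b" if "b \<in> carrier A" for b using f(1) that by auto
    hence "f b \<in> carrier L" if "b \<in> carrier A" for b using GC that by blast
    hence "(\<Oplus>\<^bsub>L\<^esub>a\<in>insert a S. f a) = f a \<oplus>\<^bsub>L\<^esub> (\<Oplus>\<^bsub>L\<^esub>a\<in>S. f a)"
      using insert by (intro finsum_insert) auto
    moreover have "f a \<in> aspan (\<Union>a\<in>carrier A. G a)" using fG insert by (intro aspan_incl) auto
    ultimately show ?case using insert add_subgroup_add[OF aspan_subgroup[OF GC]] by auto
  qed
  hence "(\<Oplus>\<^bsub>L\<^esub>a\<in>{a \<in> carrier A. f a \<noteq> \<zero>\<^bsub>L\<^esub>}. f a) \<in> aspan (\<Union>a\<in>carrier A. G a)" by simp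
  thus "x \<in> aspan (\<Union>a\<in>carrier A. G a)" by (simp only: f(2))
qed

theorem higman_bound_exists: "higman_bound TYPE('l) TYPE('a) n (higman_length n)"
  unfolding higman_bound_def
proof (intro allI impI)
  fix L :: "'l ring" and A :: "'a monoid" and G \<X>
  assume h: "lie_ring L \<and> comm_group A \<and> lie_grading A L G \<and> arithmetically_free A \<X> \<and>
    finite \<X> \<and> card \<X> \<le> n \<and> grading_support A L G \<subseteq> \<X>"
  then interpret lie_ring L by simp
  interpret A: comm_group A using h by simp
  have G1: "subgroup (G a) (add_monoid L)" if "a \<in> carrier A" for a
    using h that by (simp add: lie_grading_def)
  have G2: "x \<otimes>\<^bsub>L\<^esub> y \<in> G (a \<otimes>\<^bsub>A\<^esub> b)"
    if "a \<in> carrier A" "b \<in> carrier A" "x \<in> G a" "y \<in> G b" for a b x y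
    using h that by (simp add: lie_grading_def)
  have G3: "carrier L \<subseteq> aspan (\<Union>a\<in>carrier A. G a)" using h by (intro lie_gradingE_span) auto
  have G4: "G a = {\<zero>\<^bsub>L\<^esub>}" if "a \<in> carrier A" "a \<notin> \<X>" for a
    using h that unfolding grading_support_def by blast
  have \<X>: "arithmetically_free A \<X>" "finite \<X>" "card \<X> \<le> n" using h by auto
  interpret graded_lie_ring L A G \<X> n
    by (intro graded_lie_ring.intro graded_lie_ring_axioms.intro)
      (use h in simp, use h in simp, fact G1, fact G2, fact G3, fact G4, fact \<X>(1), fact \<X>(2), fact \<X>(3))
  show "lie_nilpotent L \<and> nilpotency_class L \<le> higman_length n"
    using lower_central_vanishes nilpotency_class_le_iff by blast
qed

corollary higman_map_bound: "higman_bound TYPE('l) TYPE('a) n (higman_map TYPE('l) TYPE('a) n)"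
  unfolding higman_map_def by (rule LeastI, rule higman_bound_exists)

subsection \<open>Gradings with projections\<close>

text \<open>The projections express directness of the sum by equations, which pass to subrings and
  to copies in other types more easily than the unique decompositions demanded by
  \<open>lie_grading\<close>.\<close>

locale projected_lie_ring = graded_lie_ring L A G \<X> n
  for L :: "('l, 'r) ring_scheme" (structure) and A :: "('a, 'm) monoid_scheme" and G \<X> n +
  fixes \<pi> :: "'a \<Rightarrow> 'l \<Rightarrow> 'l"
  assumes proj_closed: "\<lbrakk>a \<in> carrier A; x \<in> carrier L\<rbrakk> \<Longrightarrow> \<pi> a x \<in> G a"
    and proj_add: "\<lbrakk>a \<in> carrier A; x \<in> carrier L; y \<in> carrier L\<rbrakk> \<Longrightarrow> \<pi> a (x \<oplus> y) = \<pi> a x \<oplus> \<pi> a y"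
    and proj_same: "\<lbrakk>a \<in> carrier A; x \<in> G a\<rbrakk> \<Longrightarrow> \<pi> a x = x"
    and proj_other: "\<lbrakk>a \<in> carrier A; b \<in> carrier A; a \<noteq> b; x \<in> G b\<rbrakk> \<Longrightarrow> \<pi> a x = \<zero>"
begin

lemma proj_carrier: "\<lbrakk>a \<in> carrier A; x \<in> carrier L\<rbrakk> \<Longrightarrow> \<pi> a x \<in> carrier L"
  using proj_closed G_carrier by blast

lemma G_zero: "a \<in> carrier A \<Longrightarrow> \<zero> \<in> G a"
  using add_subgroup_zero[OF G_subgroup] .

lemma proj_zero: "a \<in> carrier A \<Longrightarrow> \<pi> a \<zero> = \<zero>"
  using proj_same G_zero by blast

lemma sum_of_projections:
  assumes "x \<in> carrier L"
  shows "\<exists>S. finite S \<and> S \<subseteq> carrier A \<and> (\<forall>a\<in>carrier A - S. \<pi> a x = \<zero>) \<and>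
    x = (\<Oplus>a\<in>S. \<pi> a x)"
proof -
  have W: "(\<Union>a\<in>carrier A. G a) \<subseteq> carrier L" using G_sub by blast
  have "x \<in> aspan (\<Union>a\<in>carrier A. G a)" using assms G_span by blast
  thus ?thesis using W
  proof (induction rule: aspan_induct)
    case (incl s)
    then obtain b where b: "b \<in> carrier A" "s \<in> G b" by blast
    have "(\<Oplus>a\<in>{b}. \<pi> a s) = s"
      using b proj_same G_carrier by (simp add: finsum_insert)
    thus ?case using b proj_other by (intro exI[of _ "{b}"]) auto
  next
    case zero
    show ?case by (intro exI[of _ "{}"]) (auto simp: proj_zero)
  next
    case (neg x)
    then obtain S where S: "finite S" "S \<subseteq> carrier A" "\<And>a. a \<in> carrier A - S \<Longrightarrow> \<pi> a x = \<zero>"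
      "x = (\<Oplus>a\<in>S. \<pi> a x)" by blast
    have pn: "\<pi> a x \<oplus> \<pi> a (\<ominus> x) = \<zero>" if "a \<in> carrier A" for a
      using proj_add[OF that neg(1), of "\<ominus> x"] proj_zero[OF that] neg(1) by (simp add: r_neg)
    have cl: "\<pi> a x \<in> carrier L" "\<pi> a (\<ominus> x) \<in> carrier L" if "a \<in> carrier A" for a
      using proj_carrier that neg(1) by auto
    have z: "\<pi> a (\<ominus> x) = \<zero>" if "a \<in> carrier A - S" for a
      using pn[of a] S(3)[OF that] cl[of a] that by simp
    have "(\<Oplus>a\<in>S. \<pi> a x) \<oplus> (\<Oplus>a\<in>S. \<pi> a (\<ominus> x)) = (\<Oplus>a\<in>S. \<pi> a x \<oplus> \<pi> a (\<ominus> x))"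
      by (rule finsum_addf[symmetric]) (use cl S in auto)
    also have "\<dots> = (\<Oplus>a\<in>S. \<zero>)"
      by (rule add.finprod_cong') (use pn S in auto)
    also have "\<dots> = \<zero>" by (rule add.finprod_one)
    finally have "x \<oplus> (\<Oplus>a\<in>S. \<pi> a (\<ominus> x)) = \<zero>" using S(4) by simp
    moreover have "(\<Oplus>a\<in>S. \<pi> a (\<ominus> x)) \<in> carrier L" by (rule finsum_closed) (use cl S in auto)
    ultimately have "\<ominus> x = (\<Oplus>a\<in>S. \<pi> a (\<ominus> x))"
      using neg(1) a_comm minus_equality by metis
    thus ?case using S(1,2) z by blast
  next
    case (add x y)
    then obtain S T where S: "finite S" "S \<subseteq> carrier A" "\<And>a. a \<in> carrier A - S \<Longrightarrow> \<pi> a x = \<zero>"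
      "x = (\<Oplus>a\<in>S. \<pi> a x)"
      and T: "finite T" "T \<subseteq> carrier A" "\<And>a. a \<in> carrier A - T \<Longrightarrow> \<pi> a y = \<zero>"
      "y = (\<Oplus>a\<in>T. \<pi> a y)" by blast
    let ?U = "S \<union> T"
    have cl: "\<pi> a x \<in> carrier L" "\<pi> a y \<in> carrier L" if "a \<in> carrier A" for a
      using proj_carrier that add by auto
    have "(\<Oplus>a\<in>S. \<pi> a x) = (\<Oplus>a\<in>?U. \<pi> a x)"
      by (rule add.finprod_mono_neutral_cong_left) (use S T cl in auto)
    moreover have "(\<Oplus>a\<in>T. \<pi> a y) = (\<Oplus>a\<in>?U. \<pi> a y)"
      by (rule add.finprod_mono_neutral_cong_left) (use S T cl in auto)
    ultimately have "x \<oplus> y = (\<Oplus>a\<in>?U. \<pi> a x) \<oplus> (\<Oplus>a\<in>?U. \<pi> a y)" using S(4) T(4) by simp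
    also have "\<dots> = (\<Oplus>a\<in>?U. \<pi> a x \<oplus> \<pi> a y)"
      by (rule finsum_addf[symmetric]) (use cl S T in auto)
    also have "\<dots> = (\<Oplus>a\<in>?U. \<pi> a (x \<oplus> y))"
      by (rule add.finprod_cong') (use proj_add add S T cl in auto)
    finally have e: "x \<oplus> y = (\<Oplus>a\<in>?U. \<pi> a (x \<oplus> y))" .
    have "\<pi> a (x \<oplus> y) = \<zero>" if "a \<in> carrier A - ?U" for a
      using that proj_add add S(3)[of a] T(3)[of a] by simp
    thus ?case using e S(1,2) T(1,2) by blast
  qed
qed

text \<open>Projecting a finite sum of homogeneous terms reads off its terms; this gives the
  uniqueness of decompositions.\<close>

lemma proj_finsum:
  assumes "finite F" "F \<subseteq> carrier A" "\<And>a. a \<in> F \<Longrightarrow> f a \<in> G a" "b \<in> carrier A"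
  shows "\<pi> b (\<Oplus>a\<in>F. f a) = (if b \<in> F then f b else \<zero>)"
  using assms(1-3)
proof (induction F rule: finite_induct)
  case empty
  thus ?case using proj_zero assms by simp
next
  case (insert c F)
  have fc: "f a \<in> carrier L" if "a \<in> insert c F" for a
    using insert.prems(1,2) that G_carrier[of a "f a"] by auto
  have s: "(\<Oplus>a\<in>F. f a) \<in> carrier L" by (rule finsum_closed) (use fc in auto)
  have "\<pi> b (\<Oplus>a\<in>insert c F. f a) = \<pi> b (f c) \<oplus> \<pi> b (\<Oplus>a\<in>F. f a)"
    using insert fc s assms by (simp add: finsum_insert proj_add)
  also have "\<dots> = \<pi> b (f c) \<oplus> (if b \<in> F then f b else \<zero>)" using insert by simp
  also have "\<dots> = (if b \<in> insert c F then f b else \<zero>)"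
  proof (cases "b = c")
    case True
    thus ?thesis using insert proj_same fc by auto
  next
    case False
    hence "\<pi> b (f c) = \<zero>" using insert.prems assms(4) by (intro proj_other[of b c]) auto
    thus ?thesis using False fc by auto
  qed
  finally show ?case .
qed

theorem lie_grading: "lie_grading A L G"
  unfolding lie_grading_def
proof (intro conjI ballI)
  fix x assume x: "x \<in> carrier L"
  obtain S where S: "finite S" "S \<subseteq> carrier A" "\<And>a. a \<in> carrier A - S \<Longrightarrow> \<pi> a x = \<zero>"
      "x = (\<Oplus>a\<in>S. \<pi> a x)" using sum_of_projections[OF x] by blast
  define f where "f = restrict (\<lambda>a. \<pi> a x) (carrier A)"
  let ?P = "\<lambda>f. f \<in> (\<Pi>\<^sub>E a\<in>carrier A. G a) \<and> finite {a \<in> carrier A. f a \<noteq> \<zero>} \<and>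
       x = (\<Oplus>a\<in>{a \<in> carrier A. f a \<noteq> \<zero>}. f a)"
  show "\<exists>!f. ?P f"
  proof (rule ex1I[of _ f])
    have sub: "{a \<in> carrier A. f a \<noteq> \<zero>} \<subseteq> S" using S(3) by (auto simp: f_def)
    have "(\<Oplus>a\<in>{a \<in> carrier A. f a \<noteq> \<zero>}. f a) = (\<Oplus>a\<in>S. \<pi> a x)"
      by (rule add.finprod_mono_neutral_cong_left)
        (use S(1,2) sub proj_carrier[OF _ x] in \<open>auto simp: f_def\<close>)
    thus "?P f" using S(4) finite_subset[OF sub S(1)] proj_closed[OF _ x] by (simp add: f_def)
  next
    fix g assume g: "?P g"
    let ?F = "{a \<in> carrier A. g a \<noteq> \<zero>}"
    have gG: "g a \<in> G a" if "a \<in> carrier A" for a using g that by auto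
    have px: "\<pi> b x = g b" if "b \<in> carrier A" for b
    proof -
      have "\<pi> b (\<Oplus>a\<in>?F. g a) = (if b \<in> ?F then g b else \<zero>)"
        by (rule proj_finsum) (use g gG that in auto)
      moreover have "(\<Oplus>a\<in>?F. g a) = x" using g by simp
      ultimately show ?thesis using that by (simp split: if_splits)
    qed
    show "g = f"
    proof
      fix b
      show "g b = f b"
      proof (cases "b \<in> carrier A")
        case True
        thus ?thesis using px by (simp add: f_def)
      next
        case False
        thus ?thesis using g by (auto simp: f_def PiE_def extensional_def)
      qed
    qed
  qed
qed (use G_subgroup G_bracket in auto)

end

subsection \<open>Transport of structure\<close>

locale lie_image = lie_ring L for L :: "('l, 'r) ring_scheme" (structure) +
  fixes C :: "'l set" and e :: "'l \<Rightarrow> 'x" and M :: "('x, 's) ring_scheme"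
  assumes C_subgroup: "subgroup C (add_monoid L)"
    and C_bracket: "\<lbrakk>x \<in> C; y \<in> C\<rbrakk> \<Longrightarrow> x \<otimes> y \<in> C"
    and e_inj: "inj_on e C"
    and M_carrier: "carrier M = e ` C"
    and M_mult: "\<lbrakk>x \<in> C; y \<in> C\<rbrakk> \<Longrightarrow> e x \<otimes>\<^bsub>M\<^esub> e y = e (x \<otimes> y)"
    and M_add: "\<lbrakk>x \<in> C; y \<in> C\<rbrakk> \<Longrightarrow> e x \<oplus>\<^bsub>M\<^esub> e y = e (x \<oplus> y)"
    and M_zero: "\<zero>\<^bsub>M\<^esub> = e \<zero>"
begin

lemma C_carrier: "x \<in> C \<Longrightarrow> x \<in> carrier L"
  using C_subgroup add_subgroup_sub by blast

lemmas C_add = add_subgroup_add[OF C_subgroup]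
lemmas C_zero = add_subgroup_zero[OF C_subgroup]
lemmas C_neg = add_subgroup_neg[OF C_subgroup]

lemma M_abelian: "abelian_group M"
proof (rule abelian_groupI)
  fix x assume "x \<in> carrier M"
  then obtain u where "x = e u" "u \<in> C" by (auto simp: M_carrier)
  thus "\<exists>y\<in>carrier M. y \<oplus>\<^bsub>M\<^esub> x = \<zero>\<^bsub>M\<^esub>"
    using C_neg C_carrier by (intro bexI[of _ "e (\<ominus> u)"]) (auto simp: M_carrier M_add M_zero l_neg)
qed (auto simp: M_carrier M_add M_zero C_zero C_add C_carrier a_ac)

lemma M_lie_ring: "lie_ring M"
  by (intro lie_ring.intro lie_ring_axioms.intro M_abelian)
    (auto simp: M_carrier M_mult M_add M_zero C_bracket C_add C_carrier bracket_l_distr bracket_r_distr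
      bracket_alternating jacobi)

sublocale M: lie_ring M by (rule M_lie_ring)

lemma e_neg: "x \<in> C \<Longrightarrow> e (\<ominus> x) = \<ominus>\<^bsub>M\<^esub> e x"
  by (rule M.minus_equality[symmetric]) (auto simp: M_add C_neg l_neg C_carrier M_zero M_carrier)

lemma e_sp:
  assumes "x \<in> aspan S" "S \<subseteq> C"
  shows "e x \<in> M.aspan (e ` S)"
proof -
  have S: "S \<subseteq> carrier L" using assms C_carrier by blast
  have eS: "e ` S \<subseteq> carrier M" using assms M_carrier by auto
  note H = M.aspan_subgroup[OF eS]
  from assms(1) S have "x \<in> C \<and> e x \<in> M.aspan (e ` S)"
  proof (induction rule: aspan_induct)
    case (incl s)
    thus ?case using assms(2) M.aspan_incl[of "e s" "e ` S"] by blast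
  next
    case (neg x)
    thus ?case using M.add_subgroup_neg[OF H] e_neg C_neg by simp
  next
    case (add x y)
    thus ?case using M.add_subgroup_add[OF H] C_add by (simp add: M_add[symmetric])
  qed (use assms C_zero M.add_subgroup_zero[OF H] in \<open>auto simp: M_zero\<close>)
  thus ?thesis ..
qed

lemma e_subgroup:
  assumes H: "subgroup H (add_monoid L)" "H \<subseteq> C"
  shows "subgroup (e ` H) (add_monoid M)"
proof (rule M.add.subgroupI)
  show "e ` H \<subseteq> carrier M" "e ` H \<noteq> {}" using assms M_carrier add_subgroup_zero by auto
  show "\<ominus>\<^bsub>M\<^esub> a \<in> e ` H" if "a \<in> e ` H" for a
    using that H add_subgroup_neg[OF H(1)] by (auto simp: e_neg[symmetric] subset_eq)
  show "a \<oplus>\<^bsub>M\<^esub> b \<in> e ` H" if "a \<in> e ` H" "b \<in> e ` H" for a b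
    using that H add_subgroup_add[OF H(1)] by (auto simp: M_add subset_eq)
qed

lemma e_foldl:
  "\<lbrakk>v \<in> C; set zs \<subseteq> C\<rbrakk> \<Longrightarrow> foldl (\<otimes>\<^bsub>M\<^esub>) (e v) (map e zs) = e (foldl (\<otimes>) v zs) \<and> foldl (\<otimes>) v zs \<in> C"
  by (induction zs arbitrary: v) (auto simp: M_mult C_bracket)

end

lemma comm_group_image:
  assumes "comm_group A" "subgroup B A" and k: "inj_on k B"
    and N: "carrier N = k ` B" "\<And>a b. \<lbrakk>a \<in> B; b \<in> B\<rbrakk> \<Longrightarrow> k a \<otimes>\<^bsub>N\<^esub> k b = k (a \<otimes>\<^bsub>A\<^esub> b)" "\<one>\<^bsub>N\<^esub> = k \<one>\<^bsub>A\<^esub>"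
  shows "comm_group N" and "a \<in> B \<Longrightarrow> k a [^]\<^bsub>N\<^esub> (j::nat) = k (a [^]\<^bsub>A\<^esub> j)"
proof -
  interpret comm_group A by fact
  interpret B: subgroup B A by fact
  show N': "comm_group N"
  proof (rule comm_groupI)
    fix x assume "x \<in> carrier N"
    then obtain u where "x = k u" "u \<in> B" by (auto simp: N)
    thus "\<exists>y\<in>carrier N. y \<otimes>\<^bsub>N\<^esub> x = \<one>\<^bsub>N\<^esub>"
      by (intro bexI[of _ "k (inv\<^bsub>A\<^esub> u)"]) (auto simp: N)
  qed (auto simp: N m_ac)
  show "k a [^]\<^bsub>N\<^esub> j = k (a [^]\<^bsub>A\<^esub> j)" if a: "a \<in> B"
  proof (induction j)
    case (Suc j)
    have "a [^]\<^bsub>A\<^esub> j \<in> B"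
    proof (induction j)
      case (Suc j)
      thus ?case using a by simp
    qed simp
    thus ?case using Suc a by (simp add: N)
  qed (simp add: N)
qed

section \<open>Countable closures and their copies in infinite types\<close>

inductive_set bin_closure :: "('x \<Rightarrow> 'x \<Rightarrow> 'x) \<Rightarrow> 'x set \<Rightarrow> 'x set" for f D where
  base: "x \<in> D \<Longrightarrow> x \<in> bin_closure f D"
| step: "\<lbrakk>x \<in> bin_closure f D; y \<in> bin_closure f D\<rbrakk> \<Longrightarrow> f x y \<in> bin_closure f D"

lemma countable_bin_closure:
  assumes "countable D"
  shows "countable (bin_closure f D)"
proof -
  define E where "E = rec_nat D (\<lambda>_ S. S \<union> (\<lambda>(x, y). f x y) ` (S \<times> S))"
  have E0: "E 0 = D" and ES: "E (Suc i) = E i \<union> (\<lambda>(x, y). f x y) ` (E i \<times> E i)" for i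
    by (simp_all add: E_def)
  have "countable (E i)" for i
  proof (induction i)
    case 0
    show ?case using assms E0 by simp
  next
    case (Suc i)
    thus ?case unfolding ES by (intro countable_Un countable_image countable_SIGMA)
  qed
  moreover have "bin_closure f D \<subseteq> (\<Union>i. E i)"
  proof
    have mono: "E i \<subseteq> E j" if "i \<le> j" for i j
      by (rule lift_Suc_mono_le[OF _ that]) (auto simp: ES)
    fix x assume "x \<in> bin_closure f D"
    thus "x \<in> (\<Union>i. E i)"
    proof (induction rule: bin_closure.induct)
      case (base x)
      thus ?case using E0 by blast
    next
      case (step x y)
      then obtain i j where "x \<in> E i" "y \<in> E j" by blast
      hence "x \<in> E (max i j)" "y \<in> E (max i j)"
        using mono[of i "max i j"] mono[of j "max i j"] by auto
      hence "f x y \<in> E (Suc (max i j))" unfolding ES by force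
      thus ?case by blast
    qed
  qed
  ultimately show ?thesis by (meson countable_UN countable_subset countableI_type)
qed

lemma countable_generate:
  assumes "countable S"
  shows "countable (generate G S)"
proof -
  let ?D = "insert \<one>\<^bsub>G\<^esub> (S \<union> m_inv G ` S)"
  have "generate G S \<subseteq> bin_closure (\<otimes>\<^bsub>G\<^esub>) ?D"
  proof
    fix x assume "x \<in> generate G S"
    thus "x \<in> bin_closure (\<otimes>\<^bsub>G\<^esub>) ?D"
      by (induction rule: generate.induct) (auto intro: bin_closure.intros)
  qed
  thus ?thesis
    using countable_bin_closure[of ?D "(\<otimes>\<^bsub>G\<^esub>)"] assms countable_subset by blast
qed

lemma countable_inj_on:
  assumes "countable S" "infinite (UNIV :: 'x set)"
  shows "\<exists>e :: 's \<Rightarrow> 'x. inj_on e S"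
proof -
  obtain g :: "nat \<Rightarrow> 'x" where g: "inj g"
    using infinite_countable_subset[OF assms(2)] by blast
  have "inj_on (g \<circ> to_nat_on S) S"
    by (rule comp_inj_on[OF inj_on_to_nat_on[OF assms(1)]]) (use g in \<open>auto intro: inj_on_subset\<close>)
  thus ?thesis by blast
qed

subsection \<open>The Higman bound for arbitrary carriers\<close>

context projected_lie_ring
begin

lemma proj_neg:
  assumes "a \<in> carrier A" "x \<in> carrier L"
  shows "\<pi> a (\<ominus> x) = \<ominus> \<pi> a x"
proof -
  have "\<pi> a (\<ominus> x) \<oplus> \<pi> a x = \<zero>"
    using proj_add[OF assms(1), of "\<ominus> x" x] proj_zero[OF assms(1)] assms(2) by (simp add: l_neg)
  thus ?thesis using proj_carrier assms by (intro minus_equality[symmetric]) auto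
qed

text \<open>A word in homogeneous elements lies in a countable graded subring, which can be copied into \<open>'x\<close>,
  with its degrees copied into \<open>'y\<close>.\<close>

theorem higman_transfer:
  assumes infl: "infinite (UNIV :: 'x set)" and infa: "infinite (UNIV :: 'y set)"
    and hb: "higman_bound TYPE('x) TYPE('y) n c"
  shows "lower_central L c = {\<zero>}"
proof (rule lower_central_eq_zeroI)
  let ?W = "\<Union>a\<in>carrier A. G a"
  show "?W \<subseteq> carrier L" "carrier L \<subseteq> aspan ?W" using G_sub G_span by blast+
  fix v zs assume vz: "v \<in> ?W" "set zs \<subseteq> ?W" "length zs = c"
  \<comment> \<open>The letter 0 lies in every component, so a degree has to be chosen for each
    letter.\<close>
  obtain a where a: "\<And>x. x \<in> ?W \<Longrightarrow> a x \<in> carrier A \<and> x \<in> G (a x)" by (metis UN_E)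
  define D where "D = (\<lambda>x. (a x, x)) ` set (v # zs)"
  have "countable D" unfolding D_def by (intro countable_image countable_finite) simp
  moreover have "D \<subseteq> hom_elems" using vz a unfolding D_def hom_elems_def by auto
  moreover have "set (v # zs) \<subseteq> snd ` D" unfolding D_def image_image by simp
  ultimately have D: "D \<subseteq> hom_elems" "countable D" "set (v # zs) \<subseteq> snd ` D" by blast+
  define mon where "mon = bin_closure hom_br D"
  have mon_hom: "u \<in> hom_elems" if "u \<in> mon" for u
    using that unfolding mon_def
    by (induction rule: bin_closure.induct) (use D hom_br_closed in auto)
  have mon_br: "hom_br u w \<in> mon" if "u \<in> mon" "w \<in> mon" for u w
    using that unfolding mon_def by (rule bin_closure.step)
  \<comment> \<open>The span of these monomials will be the component of degree \<open>b\<close> of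
    the subring \<open>C\<close>.\<close>
  define S where "S b = {x. (b, x) \<in> mon}" for b
  define B where "B = generate A (fst ` mon)"
  define C where "C = aspan (snd ` mon)"
  have monA: "fst ` mon \<subseteq> carrier A" and monL: "snd ` mon \<subseteq> carrier L"
    using mon_hom G_carrier by (force simp: hom_elems_def)+
  have B: "subgroup B A" unfolding B_def by (rule A.generate_is_subgroup[OF monA])
  have BA: "B \<subseteq> carrier A" using B by (rule subgroup.subset)
  have C: "subgroup C (add_monoid L)" unfolding C_def by (rule aspan_subgroup[OF monL])
  have SG: "S b \<subseteq> G b" for b using mon_hom by (auto simp: S_def hom_elems_def)
  have SL: "S b \<subseteq> carrier L" for b using monL by (force simp: S_def)
  have spS: "subgroup (aspan (S b)) (add_monoid L)" for b by (rule aspan_subgroup[OF SL])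
  have SC: "S b \<subseteq> C" for b by (force simp: S_def C_def intro: aspan_incl)
  have spSC: "aspan (S b) \<subseteq> C" for b using aspan_least[OF _ C SC] by blast
  have spSG: "aspan (S b) \<subseteq> G b" if "b \<in> B" for b
    using aspan_least[OF _ G_subgroup SG] that BA by blast
  have countable: "countable C" "countable B"
    unfolding C_def B_def mon_def
    using D by (auto intro!: countable_generate countable_image countable_bin_closure)
  obtain e :: "'l \<Rightarrow> 'x" where e: "inj_on e C" using countable_inj_on[OF countable(1) infl] by blast
  obtain k :: "'a \<Rightarrow> 'y" where k: "inj_on k B" using countable_inj_on[OF countable(2) infa] by blast
  define d where "d = inv_into C e"
  define l where "l = inv_into B k"
  have d: "d (e x) = x" if "x \<in> C" for x using that e by (simp add: d_def)
  have l: "l (k x) = x" if "x \<in> B" for x using that k by (simp add: l_def)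
  define M :: "'x ring" where "M = \<lparr>carrier = e ` C, monoid.mult = (\<lambda>x y. e (d x \<otimes> d y)), one = e \<zero>,
    zero = e \<zero>, add = (\<lambda>x y. e (d x \<oplus> d y))\<rparr>"
  define N :: "'y monoid" where "N = \<lparr>carrier = k ` B, monoid.mult = (\<lambda>x y. k (l x \<otimes>\<^bsub>A\<^esub> l y)), one = k \<one>\<^bsub>A\<^esub>\<rparr>"
  have C_br: "x \<otimes> y \<in> C" if "x \<in> C" "y \<in> C" for x y
    using that(1) unfolding C_def
  proof (rule aspan_bracket_l[OF _ monL _ C[unfolded C_def]])
    show yL: "y \<in> carrier L" using that add_subgroup_sub[OF C] by blast
    fix s assume "s \<in> snd ` mon"
    then obtain u where u: "s = snd u" "u \<in> mon" by blast
    show "s \<otimes> y \<in> aspan (snd ` mon)"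
      using that(2) unfolding C_def
    proof (rule aspan_bracket_r[OF _ monL _ C[unfolded C_def]])
      show "s \<in> carrier L" using u monL by blast
      fix t assume "t \<in> snd ` mon"
      then obtain w where "t = snd w" "w \<in> mon" by blast
      thus "s \<otimes> t \<in> aspan (snd ` mon)"
        using mon_br[OF u(2), of w] u by (intro aspan_incl) (force simp: hom_br_def)
    qed
  qed
  have S_br: "x \<otimes> y \<in> aspan (S (b \<otimes>\<^bsub>A\<^esub> b'))" if "x \<in> aspan (S b)" "y \<in> aspan (S b')" for x y b b'
    using that(1)
  proof (rule aspan_bracket_l[OF _ SL _ spS])
    show yL: "y \<in> carrier L" using that aspan_closed SL by blast
    fix s assume s: "s \<in> S b"
    show "s \<otimes> y \<in> aspan (S (b \<otimes>\<^bsub>A\<^esub> b'))"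
      using that(2)
    proof (rule aspan_bracket_r[OF _ SL _ spS])
      show "s \<in> carrier L" using s SL by blast
      fix t assume "t \<in> S b'"
      thus "s \<otimes> t \<in> aspan (S (b \<otimes>\<^bsub>A\<^esub> b'))"
        using mon_br[of "(b, s)" "(b', t)"] s by (intro aspan_incl) (simp add: hom_br_def S_def)
    qed
  qed
  \<comment> \<open>The projections map \<open>C\<close> into the spans of its own monomials, each
    of which is homogeneous. This makes \<open>C\<close> a graded subring.\<close>
  have pS: "\<pi> b x \<in> aspan (S b)" if "b \<in> B" "x \<in> C" for b x
    using that(2) monL unfolding C_def
  proof (induction rule: aspan_induct)
    case (incl s)
    then obtain b' where b': "(b', s) \<in> mon" by force
    hence b'': "b' \<in> carrier A" "s \<in> G b'" using mon_hom by (auto simp: hom_elems_def)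
    show ?case
    proof (cases "b' = b")
      case True
      thus ?thesis using b' b'' proj_same by (auto simp: S_def intro: aspan_incl)
    next
      case False
      hence "\<pi> b s = \<zero>" using b'' BA that by (intro proj_other) auto
      thus ?thesis using add_subgroup_zero[OF spS] by simp
    qed
  next
    case zero
    have "\<pi> b \<zero> = \<zero>" using proj_zero BA that by blast
    thus ?case using add_subgroup_zero[OF spS] by simp
  next
    case (neg x)
    have "\<pi> b (\<ominus> x) = \<ominus> \<pi> b x" using proj_neg BA that neg by blast
    thus ?case using add_subgroup_neg[OF spS] neg by simp
  next
    case (add x y)
    have "\<pi> b (x \<oplus> y) = \<pi> b x \<oplus> \<pi> b y" using proj_add BA that add by blast
    thus ?case using add_subgroup_add[OF spS] add by simp
  qed
  interpret I: lie_image L C e M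
    by (intro lie_image.intro lie_ring_axioms lie_image_axioms.intro)
       (use C C_br e in \<open>auto simp: M_def d\<close>)
  note Ng = comm_group_image[OF A.comm_group_axioms B k, of N]
  have Nc: "carrier N = k ` B" "\<And>a b. \<lbrakk>a \<in> B; b \<in> B\<rbrakk> \<Longrightarrow> k a \<otimes>\<^bsub>N\<^esub> k b = k (a \<otimes>\<^bsub>A\<^esub> b)"
    "\<one>\<^bsub>N\<^esub> = k \<one>\<^bsub>A\<^esub>" by (auto simp: N_def l)
  define GM where "GM b = e ` aspan (S (l b))" for b
  \<comment> \<open>The degrees of \<open>C\<close> lie in \<open>B\<close>. A progression inside
    \<open>XM\<close> would come from one inside \<X>, so freeness is inherited.\<close>
  define XM where "XM = k ` (\<X> \<inter> B)"
  have free: "arithmetically_free N XM"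
    unfolding arithmetically_free_def
  proof (intro conjI notI)
    show "XM \<subseteq> carrier N" by (auto simp: XM_def Nc)
    assume "\<exists>\<alpha>\<in>XM. \<exists>\<beta>\<in>XM. \<forall>j::nat. \<alpha> \<otimes>\<^bsub>N\<^esub> \<beta> [^]\<^bsub>N\<^esub> j \<in> XM"
    then obtain u w where uw: "u \<in> \<X>" "u \<in> B" "w \<in> \<X>" "w \<in> B"
      "\<And>j::nat. k u \<otimes>\<^bsub>N\<^esub> k w [^]\<^bsub>N\<^esub> j \<in> XM" by (auto simp: XM_def)
    have "u \<otimes>\<^bsub>A\<^esub> w [^]\<^bsub>A\<^esub> j \<in> \<X>" for j :: nat
    proof -
      have wB: "w [^]\<^bsub>A\<^esub> j \<in> B" using uw(4)
        by (induction j) (auto intro: subgroup.one_closed[OF B] subgroup.m_closed[OF B])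
      hence "k (u \<otimes>\<^bsub>A\<^esub> w [^]\<^bsub>A\<^esub> j) \<in> XM" using uw(5)[of j] Ng(2)[OF Nc uw(4)] Nc(2) uw(2) by simp
      then obtain x where x: "x \<in> \<X>" "x \<in> B" "k (u \<otimes>\<^bsub>A\<^esub> w [^]\<^bsub>A\<^esub> j) = k x" by (auto simp: XM_def)
      hence "u \<otimes>\<^bsub>A\<^esub> w [^]\<^bsub>A\<^esub> j = x"
        using inj_onD[OF k] subgroup.m_closed[OF B uw(2) wB] by blast
      thus ?thesis using x by simp
    qed
    thus False using X_free uw unfolding arithmetically_free_def by blast
  qed
  have XMc: "finite XM" "card XM \<le> n"
  proof -
    show "finite XM" using X_fin by (simp add: XM_def)
    have "card XM \<le> card (\<X> \<inter> B)" unfolding XM_def using X_fin by (intro card_image_le) simp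
    also have "\<dots> \<le> card \<X>" using X_fin by (intro card_mono) auto
    finally show "card XM \<le> n" using X_card by simp
  qed
  have GM_k: "GM (k b) = e ` aspan (S b)" if "b \<in> B" for b using that by (simp add: GM_def l)
  have GM_span: "carrier M \<subseteq> I.M.aspan (\<Union>b\<in>carrier N. GM b)"
  proof
    have GC: "(\<Union>b\<in>carrier N. GM b) \<subseteq> carrier M"
      using spSC by (auto simp: GM_def I.M_carrier)
    fix y assume "y \<in> carrier M"
    then obtain x where x: "y = e x" "x \<in> aspan (snd ` mon)" by (auto simp: I.M_carrier C_def)
    have "snd ` mon \<subseteq> C" by (auto simp: C_def intro: aspan_incl)
    hence "y \<in> I.M.aspan (e ` (snd ` mon))" unfolding x(1) by (rule I.e_sp[OF x(2)])
    thus "y \<in> I.M.aspan (\<Union>b\<in>carrier N. GM b)"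
    proof (rule I.M.aspan_least[OF _ I.M.aspan_subgroup[OF GC]])
      show "e ` (snd ` mon) \<subseteq> I.M.aspan (\<Union>b\<in>carrier N. GM b)"
      proof
        fix z assume "z \<in> e ` (snd ` mon)"
        then obtain b s where bs: "(b, s) \<in> mon" "z = e s" by force
        hence "b \<in> B" by (force simp: B_def intro: generate.incl)
        moreover have "s \<in> aspan (S b)" using bs by (auto simp: S_def intro: aspan_incl)
        ultimately have "z \<in> GM (k b)" "k b \<in> carrier N" using bs by (auto simp: GM_k Nc)
        thus "z \<in> I.M.aspan (\<Union>b\<in>carrier N. GM b)" by (intro I.M.aspan_incl) blast
      qed
    qed
  qed
  have NcE: "\<exists>a\<in>B. b = k a" if "b \<in> carrier N" for b using that by (auto simp: Nc)
  interpret P: projected_lie_ring M N GM XM n "\<lambda>b x. e (\<pi> (l b) (d x))"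
  proof (intro projected_lie_ring.intro graded_lie_ring.intro graded_lie_ring_axioms.intro
      projected_lie_ring_axioms.intro)
    show "lie_ring M" by (rule I.M_lie_ring)
    show "comm_group N" by (rule Ng(1)[OF Nc])
    show "carrier M \<subseteq> I.M.aspan (\<Union>b\<in>carrier N. GM b)" by (rule GM_span)
    show "arithmetically_free N XM" "finite XM" "card XM \<le> n" by (fact free XMc)+
  next
    fix b assume "b \<in> carrier N"
    thus "subgroup (GM b) (add_monoid M)" unfolding GM_def by (intro I.e_subgroup spS spSC)
  next
    fix b b' x y assume "b \<in> carrier N" "b' \<in> carrier N" and xy: "x \<in> GM b" "y \<in> GM b'"
    then obtain a a' where aa: "a \<in> B" "a' \<in> B" "b = k a" "b' = k a'" using NcE by metis
    then obtain s t where st: "s \<in> aspan (S a)" "t \<in> aspan (S a')" "x = e s" "y = e t"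
      using xy GM_k by auto
    have "x \<otimes>\<^bsub>M\<^esub> y = e (s \<otimes> t)" using st spSC by (auto simp: I.M_mult subset_eq)
    moreover have "b \<otimes>\<^bsub>N\<^esub> b' = k (a \<otimes>\<^bsub>A\<^esub> a')" "a \<otimes>\<^bsub>A\<^esub> a' \<in> B"
      using aa Nc(2) subgroup.m_closed[OF B] by auto
    ultimately show "x \<otimes>\<^bsub>M\<^esub> y \<in> GM (b \<otimes>\<^bsub>N\<^esub> b')" using S_br[OF st(1,2)] GM_k by simp
  next
    fix b assume b: "b \<in> carrier N" "b \<notin> XM"
    then obtain a where a: "a \<in> B" "b = k a" using NcE by blast
    hence "a \<notin> \<X>" using b by (auto simp: XM_def)
    hence "aspan (S a) \<subseteq> {\<zero>}" using spSG[OF a(1)] G_supp a BA by blast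
    hence "aspan (S a) = {\<zero>}" using add_subgroup_zero[OF spS] by blast
    thus "GM b = {\<zero>\<^bsub>M\<^esub>}" using a GM_k I.M_zero by simp
  next
    fix b x assume "b \<in> carrier N" "x \<in> carrier M"
    then obtain a s where "a \<in> B" "b = k a" "s \<in> C" "x = e s" using NcE unfolding I.M_carrier by blast
    thus "e (\<pi> (l b) (d x)) \<in> GM b" using pS by (simp add: l d GM_k)
  next
    fix b x y assume "b \<in> carrier N" "x \<in> carrier M" "y \<in> carrier M"
    then obtain a s t where *: "a \<in> B" "b = k a" "s \<in> C" "x = e s" "t \<in> C" "y = e t"
      using NcE unfolding I.M_carrier by blast
    have "\<pi> a s \<in> C" "\<pi> a t \<in> C" using pS[OF *(1)] * spSC by blast+
    moreover have "\<pi> a (s \<oplus> t) = \<pi> a s \<oplus> \<pi> a t"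
      using * BA I.C_carrier by (intro proj_add) auto
    ultimately show "e (\<pi> (l b) (d (x \<oplus>\<^bsub>M\<^esub> y))) = e (\<pi> (l b) (d x)) \<oplus>\<^bsub>M\<^esub> e (\<pi> (l b) (d y))"
      using * I.C_add by (simp add: l d I.M_add)
  next
    fix b x assume "b \<in> carrier N" and x: "x \<in> GM b"
    then obtain a where a: "a \<in> B" "b = k a" using NcE by blast
    then obtain s where s: "s \<in> aspan (S a)" "x = e s" using x GM_k by auto
    have "\<pi> a s = s" using s spSG[OF a(1)] a BA by (intro proj_same) auto
    moreover have "d x = s" using s spSC d by blast
    ultimately show "e (\<pi> (l b) (d x)) = x" using s a l by simp
  next
    fix b b' x assume "b \<in> carrier N" "b' \<in> carrier N" "b \<noteq> b'" and x: "x \<in> GM b'"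
    then obtain a a' where a: "a \<in> B" "b = k a" "a' \<in> B" "b' = k a'" "a \<noteq> a'" using NcE by blast
    then obtain s where s: "s \<in> aspan (S a')" "x = e s" using x GM_k by auto
    have "\<pi> a s = \<zero>" using s spSG[OF a(3)] a BA by (intro proj_other[of a a']) auto
    moreover have "d x = s" using s spSC d by blast
    ultimately show "e (\<pi> (l b) (d x)) = \<zero>\<^bsub>M\<^esub>" using a l I.M_zero by simp
  qed
  have "grading_support N M GM \<subseteq> XM" using P.G_supp by (auto simp: grading_support_def)
  hence "lie_nilpotent M \<and> nilpotency_class M \<le> c"
    using hb P.lie_grading free XMc I.M_lie_ring Ng(1)[OF Nc] unfolding higman_bound_def by blast
  hence M0: "lower_central M c = {e \<zero>}" using I.M.nilpotency_class_le_iff I.M_zero by simp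
  have "D \<subseteq> mon" by (auto simp: mon_def intro: bin_closure.base)
  hence "set (v # zs) \<subseteq> C" using D(3) by (force simp: C_def intro: aspan_incl)
  hence vC: "v \<in> C" "set zs \<subseteq> C" by auto
  \<comment> \<open>The copied word has \<open>c\<close> letters after its first one, so it lies in
    a term that the assumed bound makes zero; injectivity of \<open>e\<close> carries this
    back.\<close>
  have "foldl (\<otimes>\<^bsub>M\<^esub>) (e v) (map e zs) \<in> lower_central M (length (map e zs))"
    by (rule I.M.lower_central_foldl) (use vC I.M_carrier in auto)
  hence "e (foldl (\<otimes>) v zs) = e \<zero>" using I.e_foldl[OF vC] M0 vz(3) by simp
  thus "foldl (\<otimes>) v zs = \<zero>" using e I.e_foldl[OF vC] I.C_zero by (auto dest: inj_onD)
qed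

end

subsection \<open>Separating functionals\<close>

text \<open>If p kills L and the field has characteristic p, the additive maps are the linear ones
  over the prime field, so the extension of scalars takes place over the prime field. The value 0
  off the carrier makes a functional determined by its restriction to L.\<close>

definition functionals :: "('l, 'r) ring_scheme \<Rightarrow> ('l \<Rightarrow> 'f::field) set" where
  "functionals L = {\<theta>. (\<forall>x\<in>carrier L. \<forall>y\<in>carrier L. \<theta> (x \<oplus>\<^bsub>L\<^esub> y) = \<theta> x + \<theta> y) \<and>
     (\<forall>x. x \<notin> carrier L \<longrightarrow> \<theta> x = 0)}"

lemma (in lie_ring) add_pow_mod:
  assumes p: "[p] \<cdot> x = \<zero>" and x: "x \<in> carrier L"
  shows "[(k mod p)] \<cdot> x = [(k::nat)] \<cdot> x"
proof -
  have "[k] \<cdot> x = [(p * (k div p) + k mod p)] \<cdot> x" by simp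
  also have "\<dots> = [(p * (k div p))] \<cdot> x \<oplus> [(k mod p)] \<cdot> x" using x by (simp only: add.nat_pow_mult)
  also have "[(p * (k div p))] \<cdot> x = \<zero>"
    using add.nat_pow_pow[OF x, of "k div p" p] p by simp
  finally show ?thesis using x by simp
qed

lemma (in lie_ring) exists_maximal_subgroup_avoiding:
  assumes x: "x \<in> carrier L" "x \<noteq> \<zero>"
  shows "\<exists>H. subgroup H (add_monoid L) \<and> x \<notin> H \<and>
    (\<forall>H'. subgroup H' (add_monoid L) \<longrightarrow> H \<subseteq> H' \<longrightarrow> x \<notin> H' \<longrightarrow> H' = H)"
proof -
  let ?\<A> = "{H. subgroup H (add_monoid L) \<and> x \<notin> H}"
  have "\<exists>H\<in>?\<A>. \<forall>H'\<in>?\<A>. H \<subseteq> H' \<longrightarrow> H' = H"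
  proof (rule subset_Zorn_nonempty)
    have "subgroup {\<zero>} (add_monoid L)" using aspan_subgroup[of "{}"] by (simp add: aspan_empty)
    thus "?\<A> \<noteq> {}" using x by blast
  next
    fix \<C> assume ne: "\<C> \<noteq> {}" and ch: "subset.chain ?\<A> \<C>"
    have sub: "subgroup H (add_monoid L)" "x \<notin> H" if "H \<in> \<C>" for H
      using ch that by (auto simp: subset.chain_def)
    have tot: "H \<subseteq> H' \<or> H' \<subseteq> H" if "H \<in> \<C>" "H' \<in> \<C>" for H H'
      using ch that by (auto simp: subset.chain_def)
    have "subgroup (\<Union>\<C>) (add_monoid L)"
    proof (rule add.subgroupI)
      show "\<Union>\<C> \<subseteq> carrier L" using sub(1) add_subgroup_sub by blast
      show "\<Union>\<C> \<noteq> {}" using ne sub(1) add_subgroup_zero by blast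
      show "\<ominus> a \<in> \<Union>\<C>" if "a \<in> \<Union>\<C>" for a using that sub(1) add_subgroup_neg by blast
      fix a b assume "a \<in> \<Union>\<C>" "b \<in> \<Union>\<C>"
      then obtain H H' where H: "H \<in> \<C>" "H' \<in> \<C>" "a \<in> H" "b \<in> H'" by blast
      show "a \<oplus> b \<in> \<Union>\<C>"
      proof (cases "H \<subseteq> H'")
        case True
        hence "a \<oplus> b \<in> H'" using H by (intro add_subgroup_add[OF sub(1)]) auto
        thus ?thesis using H by blast
      next
        case False
        hence "b \<in> H" using tot[OF H(1,2)] H by blast
        hence "a \<oplus> b \<in> H" using H by (intro add_subgroup_add[OF sub(1)]) auto
        thus ?thesis using H by blast
      qed
    qed
    thus "\<Union>\<C> \<in> ?\<A>" using sub(2) by blast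
  qed
  thus ?thesis by blast
qed

text \<open>A subgroup maximal among those missing \<open>x\<close> is a hyperplane: every element
  is a member of it plus a multiple of \<open>x\<close>, with a coefficient unique modulo p. This
  coefficient is the functional, and it is 1 at \<open>x\<close>.\<close>

lemma (in lie_ring) exists_separating_functional:
  assumes x: "x \<in> carrier L" "x \<noteq> \<zero>" and p: "prime p" "\<And>y. y \<in> carrier L \<Longrightarrow> [p] \<cdot> y = \<zero>"
    and char: "CHAR('f::field) = p"
  shows "\<exists>\<theta> \<in> (functionals L :: ('a \<Rightarrow> 'f) set). \<theta> x \<noteq> 0"
proof -
  obtain H where H: "subgroup H (add_monoid L)" "x \<notin> H"
    and max: "\<And>H'. \<lbrakk>subgroup H' (add_monoid L); H \<subseteq> H'; x \<notin> H'\<rbrakk> \<Longrightarrow> H' = H"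
    using exists_maximal_subgroup_avoiding[OF x] by blast
  note HL = add_subgroup_sub[OF H(1)] and H0 = add_subgroup_zero[OF H(1)]
    and Hadd = add_subgroup_add[OF H(1)] and Hneg = add_subgroup_neg[OF H(1)]
  have pow_c: "[(k::nat)] \<cdot> y \<in> carrier L" if "y \<in> carrier L" for k y using that by simp
  have Hpow: "[(k::nat)] \<cdot> h \<in> H" if "h \<in> H" for h k
    using that HL H0 by (induction k) (auto simp: add.nat_pow_Suc intro: Hadd)
  have inv_mod: "\<exists>i. [(i * j)] \<cdot> y = y" if "\<not> p dvd j" "y \<in> carrier L" for j y
  proof -
    have "coprime j p" using p(1) that(1) by (metis coprime_commute prime_imp_coprime)
    then obtain i where "[j * i = 1] (mod p)" using cong_solve_coprime_nat by auto
    hence "(i * j) mod p = 1 mod p" by (simp add: cong_def mult.commute)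
    hence "[(i * j)] \<cdot> y = [(1::nat)] \<cdot> y"
      using add_pow_mod[OF p(2)[OF that(2)] that(2)] by metis
    thus ?thesis using that(2) by auto
  qed
  have multiple: "p dvd j" if "[j] \<cdot> x \<in> H" for j
  proof (rule ccontr)
    assume "\<not> p dvd j"
    then obtain i where "[(i * j)] \<cdot> x = x" using inv_mod x by blast
    moreover have "[(i * j)] \<cdot> x = [i] \<cdot> ([j] \<cdot> x)"
      using add.nat_pow_pow[OF x(1), of i j] by (simp add: mult.commute)
    ultimately show False using Hpow[OF that, of i] H(2) by simp
  qed
  have dec: "\<exists>k::nat. \<exists>h\<in>H. y = h \<oplus> [k] \<cdot> x" if y: "y \<in> carrier L" for y
  proof (cases "y \<in> H")
    case True
    thus ?thesis using y by (intro exI[of _ 0] bexI[of _ y]) auto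
  next
    case False
    \<comment> \<open>The subgroup generated by H and \<open>y\<close> is strictly larger than H, so
      by maximality it contains \<open>x\<close>.\<close>
    define H' where "H' = {h \<oplus> [(j::nat)] \<cdot> y | h j. h \<in> H}"
    have H'L: "H' \<subseteq> carrier L" using HL y by (auto simp: H'_def)
    have "subgroup H' (add_monoid L)"
    proof (rule add.subgroupI)
      show "H' \<subseteq> carrier L" by (rule H'L)
      show "H' \<noteq> {}" using H0 by (auto simp: H'_def)
      fix a assume "a \<in> H'"
      then obtain h j where a: "a = h \<oplus> [(j::nat)] \<cdot> y" "h \<in> H" by (auto simp: H'_def)
      have hc: "h \<in> carrier L" using a HL by blast
      have "[(p * j - j)] \<cdot> y \<oplus> [j] \<cdot> y = [(p * j - j + j)] \<cdot> y"
        using y by (simp add: add.nat_pow_mult)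
      also have "p * j - j + j = p * j" using prime_gt_0_nat[OF p(1)] by simp
      also have "[(p * j)] \<cdot> y = \<zero>" using add.nat_pow_pow[OF y, of j p] p(2)[OF y] by simp
      finally have z: "[(p * j - j)] \<cdot> y \<oplus> [j] \<cdot> y = \<zero>" .
      have "(\<ominus> h \<oplus> [(p * j - j)] \<cdot> y) \<oplus> a = (\<ominus> h \<oplus> h) \<oplus> ([(p * j - j)] \<cdot> y \<oplus> [j] \<cdot> y)"
        unfolding a(1) using hc y pow_c by (simp add: a_ac)
      also have "\<dots> = \<zero>" using z hc by (simp add: l_neg)
      finally have "\<ominus> a = \<ominus> h \<oplus> [(p * j - j)] \<cdot> y"
        using a hc y by (intro minus_equality) auto
      thus "\<ominus> a \<in> H'" using Hneg[OF a(2)] by (auto simp: H'_def)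
    next
      fix a b assume "a \<in> H'" "b \<in> H'"
      then obtain h j h' j' where ab: "a = h \<oplus> [(j::nat)] \<cdot> y" "h \<in> H" "b = h' \<oplus> [(j'::nat)] \<cdot> y" "h' \<in> H"
        by (auto simp: H'_def)
      have c: "h \<in> carrier L" "h' \<in> carrier L" using ab HL by auto
      have "a \<oplus> b = (h \<oplus> h') \<oplus> ([j] \<cdot> y \<oplus> [j'] \<cdot> y)"
        unfolding ab using c y pow_c by (simp add: a_ac)
      also have "[j] \<cdot> y \<oplus> [j'] \<cdot> y = [(j + j')] \<cdot> y" using y by (simp add: add.nat_pow_mult)
      finally show "a \<oplus> b \<in> H'" using Hadd[OF ab(2,4)] by (auto simp: H'_def)
    qed
    moreover have "H \<subseteq> H'"
    proof
      fix h assume h: "h \<in> H"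
      hence "h = h \<oplus> [(0::nat)] \<cdot> y" using HL by auto
      thus "h \<in> H'" using h unfolding H'_def by blast
    qed
    moreover have "y = \<zero> \<oplus> [(1::nat)] \<cdot> y" using y by simp
    hence "y \<in> H'" using H0 unfolding H'_def by blast
    ultimately have "x \<in> H'" using max[of H'] False by blast
    then obtain h j where xh: "x = h \<oplus> [(j::nat)] \<cdot> y" "h \<in> H" by (auto simp: H'_def)
    have hc: "h \<in> carrier L" using xh HL by blast
    \<comment> \<open>Otherwise x = h would lie in H. So \<open>j\<close> is invertible modulo p and
      the relation can be solved for \<open>y\<close>.\<close>
    have "\<not> p dvd j"
    proof
      assume "p dvd j"
      hence "j mod p = 0" by simp
      hence "[j] \<cdot> y = \<zero>" using add_pow_mod[OF p(2)[OF y] y, of j] by simp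
      thus False using xh H(2) hc by simp
    qed
    then obtain i where i: "[(i * j)] \<cdot> y = y" using inv_mod y by blast
    have "[i] \<cdot> x = [i] \<cdot> h \<oplus> [i] \<cdot> ([j] \<cdot> y)"
      unfolding xh(1) using hc y by (simp add: add.nat_pow_distrib)
    also have "[i] \<cdot> ([j] \<cdot> y) = y"
      using add.nat_pow_pow[OF y, of i j] i by (simp add: mult.commute)
    finally have "[i] \<cdot> x = [i] \<cdot> h \<oplus> y" .
    hence "\<ominus> ([i] \<cdot> h) \<oplus> [i] \<cdot> x = (\<ominus> ([i] \<cdot> h) \<oplus> [i] \<cdot> h) \<oplus> y"
      using hc y pow_c by (simp add: a_assoc)
    also have "\<dots> = y" using hc y pow_c by (simp add: l_neg)
    finally have "y = \<ominus> ([i] \<cdot> h) \<oplus> [i] \<cdot> x" by simp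
    thus ?thesis using Hneg[OF Hpow[OF xh(2)]] by blast
  qed
  have uniq_le: "[k = k'] (mod p)"
    if "h \<in> H" "h' \<in> H" "h \<oplus> [k] \<cdot> x = h' \<oplus> [k'] \<cdot> x" "k' \<le> k" for h h' k k'
  proof -
    have c: "h \<in> carrier L" "h' \<in> carrier L" using that HL by auto
    have "[k] \<cdot> x = [(k - k')] \<cdot> x \<oplus> [k'] \<cdot> x" using that(4) x by (simp add: add.nat_pow_mult)
    hence "(h \<oplus> [(k - k')] \<cdot> x) \<oplus> [k'] \<cdot> x = h' \<oplus> [k'] \<cdot> x" using that(3) c x pow_c by (simp add: a_assoc)
    hence "h \<oplus> [(k - k')] \<cdot> x = h'" using c x pow_c by simp
    hence "\<ominus> h \<oplus> h' = (\<ominus> h \<oplus> h) \<oplus> [(k - k')] \<cdot> x" using c x pow_c by (auto simp: a_assoc)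
    hence "[(k - k')] \<cdot> x = \<ominus> h \<oplus> h'" using c x pow_c by (simp add: l_neg)
    hence "[(k - k')] \<cdot> x \<in> H" using that Hadd Hneg by simp
    hence "p dvd k - k'" by (rule multiple)
    thus ?thesis using that(4) by (simp add: cong_altdef_nat)
  qed
  have uniq: "[k = k'] (mod p)"
    if "h \<in> H" "h' \<in> H" "h \<oplus> [k] \<cdot> x = h' \<oplus> [k'] \<cdot> x" for h h' k k'
    using uniq_le[OF that] uniq_le[OF that(2,1) that(3)[symmetric]] cong_sym
    by (cases "k' \<le> k") auto
  \<comment> \<open>Only the class modulo p is determined, which suffices for the image in a field
    of characteristic p.\<close>
  define \<kappa> where "\<kappa> y = (SOME k::nat. \<exists>h\<in>H. y = h \<oplus> [k] \<cdot> x)" for y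
  have \<kappa>: "\<exists>h\<in>H. y = h \<oplus> [(\<kappa> y)] \<cdot> x" if "y \<in> carrier L" for y
    unfolding \<kappa>_def by (rule someI_ex[OF dec[OF that]])
  have \<kappa>_eq: "(of_nat (\<kappa> y) :: 'f) = of_nat k" if "h \<in> H" "y = h \<oplus> [k] \<cdot> x" for y h k
  proof -
    have "y \<in> carrier L" using that HL x by auto
    then obtain h' where "h' \<in> H" "y = h' \<oplus> [(\<kappa> y)] \<cdot> x" using \<kappa> by blast
    hence "[\<kappa> y = k] (mod p)" using uniq[of h' h "\<kappa> y" k] that by simp
    thus ?thesis by (simp add: of_nat_eq_iff_cong_CHAR char)
  qed
  define \<theta> where "\<theta> y = (if y \<in> carrier L then of_nat (\<kappa> y) else 0 :: 'f)" for y
  have "\<theta> (y \<oplus> z) = \<theta> y + \<theta> z" if yz: "y \<in> carrier L" "z \<in> carrier L" for y z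
  proof -
    obtain h h' where h: "h \<in> H" "y = h \<oplus> [(\<kappa> y)] \<cdot> x" and h': "h' \<in> H" "z = h' \<oplus> [(\<kappa> z)] \<cdot> x"
      using \<kappa>[OF yz(1)] \<kappa>[OF yz(2)] by blast
    have c: "h \<in> carrier L" "h' \<in> carrier L" using h h' HL by auto
    have "y \<oplus> z = (h \<oplus> [(\<kappa> y)] \<cdot> x) \<oplus> (h' \<oplus> [(\<kappa> z)] \<cdot> x)" using h(2) h'(2) by simp
    also have "\<dots> = (h \<oplus> h') \<oplus> ([(\<kappa> y)] \<cdot> x \<oplus> [(\<kappa> z)] \<cdot> x)" using c x pow_c by (simp add: a_ac)
    also have "[(\<kappa> y)] \<cdot> x \<oplus> [(\<kappa> z)] \<cdot> x = [(\<kappa> y + \<kappa> z)] \<cdot> x" using x by (simp add: add.nat_pow_mult)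
    finally have "(of_nat (\<kappa> (y \<oplus> z)) :: 'f) = of_nat (\<kappa> y + \<kappa> z)"
      by (intro \<kappa>_eq[OF Hadd[OF h(1) h'(1)]])
    thus ?thesis using yz by (simp add: \<theta>_def)
  qed
  hence "\<theta> \<in> functionals L" by (simp add: functionals_def \<theta>_def)
  moreover have "x = \<zero> \<oplus> [(1::nat)] \<cdot> x" using x by simp
  hence "\<theta> x = of_nat 1" unfolding \<theta>_def using \<kappa>_eq[OF H0, of x 1] x(1) by simp
  hence "\<theta> x \<noteq> 0" by simp
  ultimately show ?thesis by blast
qed

subsection \<open>Extension of scalars\<close>

text \<open>The tensor product of a field with \<open>L\<close> is realised inside the functions on the additive maps
  \<open>\<theta>\<close> from \<open>L\<close> to the field, with \<open>u \<otimes> x\<close> acting as \<open>\<theta> \<mapsto> u * \<theta> x\<close>. The bracket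
  \<open>[\<phi>, \<psi>] \<theta> = \<phi> (x \<mapsto> \<psi> (y \<mapsto> \<theta> [x, y]))\<close> is then well defined without choosing a basis of \<open>L\<close>.\<close>

definition pure_tensor :: "('l, 'r) ring_scheme \<Rightarrow> 'f::field \<Rightarrow> 'l \<Rightarrow> ('l \<Rightarrow> 'f) \<Rightarrow> 'f" where
  "pure_tensor L u x = (\<lambda>\<theta>. if \<theta> \<in> functionals L then u * \<theta> x else 0)"

inductive_set tensors :: "('l, 'r) ring_scheme \<Rightarrow> (('l \<Rightarrow> 'f::field) \<Rightarrow> 'f) set" for L where
  zero: "(\<lambda>_. 0) \<in> tensors L"
| step: "\<lbrakk>\<phi> \<in> tensors L; x \<in> carrier L\<rbrakk> \<Longrightarrow> (\<lambda>\<theta>. pure_tensor L u x \<theta> + \<phi> \<theta>) \<in> tensors L"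

text \<open>The value 0 outside the carrier keeps the form a functional in each argument, whatever
  the other argument is.\<close>

definition bracket_form :: "('l, 'r) ring_scheme \<Rightarrow> ('l \<Rightarrow> 'f::field) \<Rightarrow> 'l \<Rightarrow> 'l \<Rightarrow> 'f" where
  "bracket_form L \<theta> x y = (if x \<in> carrier L \<and> y \<in> carrier L then \<theta> (x \<otimes>\<^bsub>L\<^esub> y) else 0)"

definition tensor_bracket ::
    "('l, 'r) ring_scheme \<Rightarrow> (('l \<Rightarrow> 'f::field) \<Rightarrow> 'f) \<Rightarrow> (('l \<Rightarrow> 'f) \<Rightarrow> 'f) \<Rightarrow> ('l \<Rightarrow> 'f) \<Rightarrow> 'f" where
  "tensor_bracket L \<phi> \<psi> =
    (\<lambda>\<theta>. if \<theta> \<in> functionals L then \<phi> (\<lambda>x. \<psi> (bracket_form L \<theta> x)) else 0)"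

definition tensor_ring :: "('l, 'r) ring_scheme \<Rightarrow> (('l \<Rightarrow> 'f::field) \<Rightarrow> 'f) ring" where
  "tensor_ring L = \<lparr>carrier = tensors L, monoid.mult = tensor_bracket L, one = (\<lambda>_. 0),
     zero = (\<lambda>_. 0), add = (\<lambda>\<phi> \<psi> \<theta>. \<phi> \<theta> + \<psi> \<theta>)\<rparr>"

definition tensor_map :: "('l, 'r) ring_scheme \<Rightarrow> ('l \<Rightarrow> 'l) \<Rightarrow> (('l \<Rightarrow> 'f::field) \<Rightarrow> 'f) \<Rightarrow> ('l \<Rightarrow> 'f) \<Rightarrow> 'f" where
  "tensor_map L D \<phi> =
    (\<lambda>\<theta>. if \<theta> \<in> functionals L then \<phi> (\<lambda>x. if x \<in> carrier L then \<theta> (D x) else 0) else 0)"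

context lie_ring
begin

lemma functionals_add: "\<lbrakk>\<theta> \<in> functionals L; \<theta>' \<in> functionals L\<rbrakk> \<Longrightarrow> (\<lambda>x. \<theta> x + \<theta>' x) \<in> functionals L"
  by (simp add: functionals_def)

lemma functionals_scale: "\<theta> \<in> functionals L \<Longrightarrow> (\<lambda>x. c * \<theta> x) \<in> functionals L"
  by (simp add: functionals_def algebra_simps)

lemma functionals_zero: "(\<lambda>_. 0) \<in> functionals L"
  by (simp add: functionals_def)

lemma functional_add: "\<lbrakk>\<theta> \<in> functionals L; x \<in> carrier L; y \<in> carrier L\<rbrakk> \<Longrightarrow> \<theta> (x \<oplus> y) = \<theta> x + \<theta> y"
  by (simp add: functionals_def)

lemma functional_zero:
  assumes "\<theta> \<in> functionals L"
  shows "\<theta> \<zero> = 0"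
proof -
  have "\<theta> \<zero> + 0 = \<theta> \<zero> + \<theta> \<zero>" using functional_add[OF assms, of \<zero> \<zero>] by simp
  thus ?thesis by (simp only: add_left_cancel)
qed

lemma functional_neg: "\<lbrakk>\<theta> \<in> functionals L; x \<in> carrier L\<rbrakk> \<Longrightarrow> \<theta> (\<ominus> x) = - \<theta> x"
  using functional_add[of \<theta> x "\<ominus> x"] functional_zero[of \<theta>] by (simp add: r_neg add_eq_0_iff)

lemma tensor_linear_add:
  "\<lbrakk>\<phi> \<in> tensors L; \<theta> \<in> functionals L; \<theta>' \<in> functionals L\<rbrakk> \<Longrightarrow> \<phi> (\<lambda>x. \<theta> x + \<theta>' x) = \<phi> \<theta> + \<phi> \<theta>'"
  by (induction rule: tensors.induct) (auto simp: pure_tensor_def functionals_add algebra_simps)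

lemma tensor_linear_scale:
  "\<lbrakk>\<phi> \<in> tensors L; \<theta> \<in> functionals L\<rbrakk> \<Longrightarrow> \<phi> (\<lambda>x. c * \<theta> x) = c * \<phi> \<theta>"
  by (induction rule: tensors.induct) (auto simp: pure_tensor_def functionals_scale algebra_simps)

lemma tensor_linear_zero: "\<phi> \<in> tensors L \<Longrightarrow> \<phi> (\<lambda>_. 0) = 0"
  using tensor_linear_scale[of \<phi> "\<lambda>_. 0" 0] functionals_zero by simp

lemma pure_in_tensors: "x \<in> carrier L \<Longrightarrow> pure_tensor L u x \<in> tensors L"
  using tensors.step[OF tensors.zero, of x L u] by simp

lemma tensors_add: "\<lbrakk>\<phi> \<in> tensors L; \<psi> \<in> tensors L\<rbrakk> \<Longrightarrow> (\<lambda>\<theta>. \<phi> \<theta> + \<psi> \<theta>) \<in> tensors L"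
  by (induction rule: tensors.induct) (auto simp: add.assoc intro: tensors.step)

lemma tensors_scale:
  assumes "\<phi> \<in> tensors L"
  shows "(\<lambda>\<theta>. c * \<phi> \<theta>) \<in> tensors L"
  using assms
proof (induction rule: tensors.induct)
  case (step \<phi> x u)
  have "(\<lambda>\<theta>. c * (pure_tensor L u x \<theta> + \<phi> \<theta>)) = (\<lambda>\<theta>. pure_tensor L (c * u) x \<theta> + c * \<phi> \<theta>)"
    by (auto simp: pure_tensor_def algebra_simps)
  thus ?case using tensors.step[OF step.IH step.hyps(2)] by simp
qed (simp add: tensors.zero)

lemma tensors_sum:
  "(\<And>i. i \<in> I \<Longrightarrow> g i \<in> tensors L) \<Longrightarrow> (\<lambda>\<theta>. \<Sum>i\<in>I. g i \<theta>) \<in> tensors L"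
  by (induction I rule: infinite_finite_induct) (auto intro: tensors.zero tensors_add)

lemma tensors_induct [consumes 1, case_names zero pure add]:
  assumes "\<phi> \<in> tensors L" "P (\<lambda>_. 0)"
    and "\<And>u x. x \<in> carrier L \<Longrightarrow> P (pure_tensor L u x)"
    and "\<And>\<phi> \<psi>. \<lbrakk>\<phi> \<in> tensors L; \<psi> \<in> tensors L; P \<phi>; P \<psi>\<rbrakk> \<Longrightarrow> P (\<lambda>\<theta>. \<phi> \<theta> + \<psi> \<theta>)"
  shows "P \<phi>"
  using assms(1)
proof (induction rule: tensors.induct)
  case (step \<phi> x u)
  show ?case by (rule assms(4)[OF pure_in_tensors]) (use step assms(3) in auto)
qed (rule assms(2))

lemma bracket_form_functional:
  assumes "\<theta> \<in> functionals L"
  shows "bracket_form L \<theta> x \<in> functionals L" "(\<lambda>x. bracket_form L \<theta> x y) \<in> functionals L"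
  using assms by (auto simp: functionals_def bracket_form_def bracket_closed bracket_l_distr bracket_r_distr)

text \<open>The inner evaluation in \<open>tensor_bracket\<close> is again a functional, so
  linearity of the outer tensor applies to it.\<close>

lemma contract_functional:
  assumes \<psi>: "\<psi> \<in> tensors L" and \<theta>: "\<theta> \<in> functionals L"
  shows "(\<lambda>x. \<psi> (bracket_form L \<theta> x)) \<in> functionals L"
  unfolding functionals_def
proof (intro CollectI conjI ballI allI impI)
  fix x y assume xy: "x \<in> carrier L" "y \<in> carrier L"
  have "bracket_form L \<theta> (x \<oplus> y) = (\<lambda>z. bracket_form L \<theta> x z + bracket_form L \<theta> y z)"
    using functional_add[OF bracket_form_functional(2)[OF \<theta>] xy] by auto
  thus "\<psi> (bracket_form L \<theta> (x \<oplus> y)) = \<psi> (bracket_form L \<theta> x) + \<psi> (bracket_form L \<theta> y)"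
    using tensor_linear_add[OF \<psi> bracket_form_functional(1)[OF \<theta>] bracket_form_functional(1)[OF \<theta>]] by simp
next
  fix x assume "x \<notin> carrier L"
  hence "bracket_form L \<theta> x = (\<lambda>_. 0)" by (auto simp: bracket_form_def)
  thus "\<psi> (bracket_form L \<theta> x) = 0" using tensor_linear_zero[OF \<psi>] by simp
qed

lemma tensor_bracket_add_l:
  "tensor_bracket L (\<lambda>\<theta>. \<phi> \<theta> + \<phi>' \<theta>) \<psi> = (\<lambda>\<theta>. tensor_bracket L \<phi> \<psi> \<theta> + tensor_bracket L \<phi>' \<psi> \<theta>)"
  by (auto simp: tensor_bracket_def)

lemma tensor_bracket_scale_l:
  "tensor_bracket L (\<lambda>\<theta>. c * \<phi> \<theta>) \<psi> = (\<lambda>\<theta>. c * tensor_bracket L \<phi> \<psi> \<theta>)"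
  by (auto simp: tensor_bracket_def)

lemma tensor_bracket_add_r:
  assumes "\<phi> \<in> tensors L" "\<psi> \<in> tensors L" "\<psi>' \<in> tensors L"
  shows "tensor_bracket L \<phi> (\<lambda>\<theta>. \<psi> \<theta> + \<psi>' \<theta>) = (\<lambda>\<theta>. tensor_bracket L \<phi> \<psi> \<theta> + tensor_bracket L \<phi> \<psi>' \<theta>)"
proof
  fix \<theta>
  show "tensor_bracket L \<phi> (\<lambda>\<theta>. \<psi> \<theta> + \<psi>' \<theta>) \<theta> = tensor_bracket L \<phi> \<psi> \<theta> + tensor_bracket L \<phi> \<psi>' \<theta>"
    using tensor_linear_add[OF assms(1) contract_functional[OF assms(2)] contract_functional[OF assms(3)]]
    by (simp add: tensor_bracket_def)
qed

lemma tensor_bracket_scale_r: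
  assumes "\<phi> \<in> tensors L" "\<psi> \<in> tensors L"
  shows "tensor_bracket L \<phi> (\<lambda>\<theta>. c * \<psi> \<theta>) = (\<lambda>\<theta>. c * tensor_bracket L \<phi> \<psi> \<theta>)"
proof
  fix \<theta>
  show "tensor_bracket L \<phi> (\<lambda>\<theta>. c * \<psi> \<theta>) \<theta> = c * tensor_bracket L \<phi> \<psi> \<theta>"
    using tensor_linear_scale[OF assms(1) contract_functional[OF assms(2)]]
    by (simp add: tensor_bracket_def)
qed

lemma tensor_bracket_zero_l: "tensor_bracket L (\<lambda>_. 0) \<psi> = (\<lambda>_. 0)"
  by (auto simp: tensor_bracket_def)

lemma tensor_bracket_zero_r: "\<phi> \<in> tensors L \<Longrightarrow> tensor_bracket L \<phi> (\<lambda>_. 0) = (\<lambda>_. 0)"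
  by (auto simp: tensor_bracket_def tensor_linear_zero)

lemma tensor_bracket_pure:
  assumes "x \<in> carrier L" "y \<in> carrier L"
  shows "tensor_bracket L (pure_tensor L u x) (pure_tensor L v y) = pure_tensor L (u * v) (x \<otimes> y)"
proof
  fix \<theta>
  show "tensor_bracket L (pure_tensor L u x) (pure_tensor L v y) \<theta> = pure_tensor L (u * v) (x \<otimes> y) \<theta>"
  proof (cases "\<theta> \<in> functionals L")
    case True
    note f = contract_functional[OF pure_in_tensors[OF assms(2), of v] True] bracket_form_functional[OF True]
    have "tensor_bracket L (pure_tensor L u x) (pure_tensor L v y) \<theta>
        = u * pure_tensor L v y (bracket_form L \<theta> x)"
      using True f(1) unfolding tensor_bracket_def pure_tensor_def[of L u x] by simp
    also have "\<dots> = u * (v * \<theta> (x \<otimes> y))"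
      using f(2) assms by (simp add: pure_tensor_def bracket_form_def)
    finally show ?thesis using True by (simp add: pure_tensor_def)
  qed (simp add: tensor_bracket_def pure_tensor_def)
qed

lemma pure_add: "\<lbrakk>x \<in> carrier L; y \<in> carrier L\<rbrakk> \<Longrightarrow>
    pure_tensor L u (x \<oplus> y) = (\<lambda>\<theta>. pure_tensor L u x \<theta> + pure_tensor L u y \<theta>)"
  by (auto simp: pure_tensor_def functional_add algebra_simps)

lemma pure_zero: "pure_tensor L u \<zero> = (\<lambda>_. 0)"
  by (auto simp: pure_tensor_def functional_zero)

lemma pure_neg: "x \<in> carrier L \<Longrightarrow> pure_tensor L u (\<ominus> x) = (\<lambda>\<theta>. - pure_tensor L u x \<theta>)"
  by (auto simp: pure_tensor_def functional_neg)

lemma tensor_bracket_closed: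
  assumes "\<phi> \<in> tensors L" "\<psi> \<in> tensors L"
  shows "tensor_bracket L \<phi> \<psi> \<in> tensors L"
  using assms(1)
proof (induction rule: tensors_induct)
  case (pure u x)
  from assms(2) show ?case
  proof (induction rule: tensors_induct)
    case (pure v y)
    thus ?case using \<open>x \<in> carrier L\<close> by (simp add: tensor_bracket_pure pure_in_tensors bracket_closed)
  qed (use pure in \<open>auto simp: tensor_bracket_zero_r tensor_bracket_add_r pure_in_tensors intro: tensors.zero tensors_add\<close>)
qed (auto simp: tensor_bracket_zero_l tensor_bracket_add_l intro: tensors.zero tensors_add)

lemma tensor_bracket_anti:
  assumes "\<phi> \<in> tensors L" "\<psi> \<in> tensors L"
  shows "tensor_bracket L \<phi> \<psi> \<theta> + tensor_bracket L \<psi> \<phi> \<theta> = 0"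
  using assms(1)
proof (induction rule: tensors_induct)
  case (pure u x)
  from assms(2) show ?case
  proof (induction rule: tensors_induct)
    case (pure v y)
    have "x \<otimes> y = \<ominus> (y \<otimes> x)" using pure \<open>x \<in> carrier L\<close> by (intro bracket_anti)
    thus ?case using pure \<open>x \<in> carrier L\<close>
      by (simp add: tensor_bracket_pure pure_neg bracket_closed) (simp add: pure_tensor_def)
  qed (use pure in \<open>auto simp: tensor_bracket_zero_r tensor_bracket_zero_l tensor_bracket_add_l
      tensor_bracket_add_r pure_in_tensors algebra_simps add_eq_0_iff\<close>)
qed (use assms in \<open>auto simp: tensor_bracket_zero_r tensor_bracket_zero_l tensor_bracket_add_l
      tensor_bracket_add_r algebra_simps add_eq_0_iff\<close>)

text \<open>In characteristic 2 this does not follow from antisymmetry, hence a separate induction: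
  brackets of a pure tensor with itself vanish because L is alternating, and the mixed terms of a
  sum cancel by \<open>tensor_bracket_anti\<close>.\<close>

lemma tensor_bracket_alternating:
  assumes "\<phi> \<in> tensors L"
  shows "tensor_bracket L \<phi> \<phi> = (\<lambda>_. 0)"
  using assms
proof (induction rule: tensors_induct)
  case (pure u x)
  thus ?case by (simp add: tensor_bracket_pure bracket_alternating pure_zero)
next
  case (add \<phi> \<psi>)
  show ?case
  proof
    fix \<theta>
    have "tensor_bracket L (\<lambda>\<theta>. \<phi> \<theta> + \<psi> \<theta>) (\<lambda>\<theta>. \<phi> \<theta> + \<psi> \<theta>) \<theta> =
       tensor_bracket L \<phi> \<phi> \<theta> + (tensor_bracket L \<phi> \<psi> \<theta> + tensor_bracket L \<psi> \<phi> \<theta>) + tensor_bracket L \<psi> \<psi> \<theta>"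
      using add by (simp add: tensor_bracket_add_l tensor_bracket_add_r tensors_add)
    thus "tensor_bracket L (\<lambda>\<theta>. \<phi> \<theta> + \<psi> \<theta>) (\<lambda>\<theta>. \<phi> \<theta> + \<psi> \<theta>) \<theta> = 0"
      using add by (simp add: tensor_bracket_anti)
  qed
qed (simp add: tensor_bracket_zero_l)

text \<open>Trilinearity reduces the arguments to pure tensors one after another, and there the
  identity is that of L.\<close>

lemma tensor_jacobi:
  assumes "\<phi> \<in> tensors L" "\<psi> \<in> tensors L" "\<chi> \<in> tensors L"
  shows "tensor_bracket L \<phi> (tensor_bracket L \<psi> \<chi>) \<theta> + tensor_bracket L \<psi> (tensor_bracket L \<chi> \<phi>) \<theta>
    + tensor_bracket L \<chi> (tensor_bracket L \<phi> \<psi>) \<theta> = 0" (is "?J \<phi> \<psi> \<chi> = 0")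
proof -
  note s = tensor_bracket_zero_l tensor_bracket_zero_r tensor_bracket_add_l tensor_bracket_add_r
    tensor_bracket_closed pure_in_tensors tensors.zero
  have pure3: "?J (pure_tensor L u x) (pure_tensor L v y) (pure_tensor L w z) = 0"
    if "x \<in> carrier L" "y \<in> carrier L" "z \<in> carrier L" for u v w x y z
  proof -
    have "?J (pure_tensor L u x) (pure_tensor L v y) (pure_tensor L w z) =
      pure_tensor L (u * v * w) ((x \<otimes> (y \<otimes> z)) \<oplus> (y \<otimes> (z \<otimes> x)) \<oplus> (z \<otimes> (x \<otimes> y))) \<theta>"
      using that by (simp add: tensor_bracket_pure bracket_closed pure_add mult_ac)
    also have "\<dots> = 0" using jacobi[OF that] by (simp add: pure_zero)
    finally show ?thesis .
  qed
  have pure2: "?J (pure_tensor L u x) (pure_tensor L v y) \<chi> = 0"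
    if "x \<in> carrier L" "y \<in> carrier L" for u v x y
    using assms(3)
  proof (induction rule: tensors_induct)
    case (add \<chi> \<chi>')
    have "?J (pure_tensor L u x) (pure_tensor L v y) (\<lambda>\<theta>. \<chi> \<theta> + \<chi>' \<theta>) =
       ?J (pure_tensor L u x) (pure_tensor L v y) \<chi> + ?J (pure_tensor L u x) (pure_tensor L v y) \<chi>'"
      using add.hyps that by (simp add: s)
    thus ?case by (simp only: add.IH add_0)
  qed (use that pure3 in \<open>auto simp: s\<close>)
  have pure1: "?J (pure_tensor L u x) \<psi> \<chi> = 0" if "x \<in> carrier L" for u x
    using assms(2)
  proof (induction rule: tensors_induct)
    case (add \<psi> \<psi>')
    have "?J (pure_tensor L u x) (\<lambda>\<theta>. \<psi> \<theta> + \<psi>' \<theta>) \<chi> = ?J (pure_tensor L u x) \<psi> \<chi> + ?J (pure_tensor L u x) \<psi>' \<chi>"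
      using add.hyps that assms by (simp add: s)
    thus ?case by (simp only: add.IH add_0)
  qed (use that pure2 assms in \<open>auto simp: s\<close>)
  from assms(1) show ?thesis
  proof (induction rule: tensors_induct)
    case (add \<phi> \<phi>')
    have "?J (\<lambda>\<theta>. \<phi> \<theta> + \<phi>' \<theta>) \<psi> \<chi> = ?J \<phi> \<psi> \<chi> + ?J \<phi>' \<psi> \<chi>" using add.hyps assms by (simp add: s)
    thus ?case by (simp only: add.IH add_0)
  qed (use pure1 assms in \<open>auto simp: s\<close>)
qed

lemma tensor_lie_ring: "lie_ring (tensor_ring L :: (('a \<Rightarrow> 'f::field) \<Rightarrow> 'f) ring)"
proof (intro lie_ring.intro lie_ring_axioms.intro abelian_groupI)
  fix \<phi> :: "('a \<Rightarrow> 'f) \<Rightarrow> 'f" assume "\<phi> \<in> carrier (tensor_ring L)"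
  thus "\<exists>\<psi>\<in>carrier (tensor_ring L). \<psi> \<oplus>\<^bsub>tensor_ring L\<^esub> \<phi> = \<zero>\<^bsub>tensor_ring L\<^esub>"
    using tensors_scale[of \<phi> "-1"]
    by (intro bexI[of _ "\<lambda>\<theta>. - \<phi> \<theta>"]) (auto simp: tensor_ring_def)
next
  fix \<phi> \<psi> \<chi> :: "('a \<Rightarrow> 'f) \<Rightarrow> 'f"
  assume "\<phi> \<in> carrier (tensor_ring L)" "\<psi> \<in> carrier (tensor_ring L)" "\<chi> \<in> carrier (tensor_ring L)"
  thus "(\<phi> \<otimes>\<^bsub>tensor_ring L\<^esub> (\<psi> \<otimes>\<^bsub>tensor_ring L\<^esub> \<chi>)) \<oplus>\<^bsub>tensor_ring L\<^esub> (\<psi> \<otimes>\<^bsub>tensor_ring L\<^esub> (\<chi> \<otimes>\<^bsub>tensor_ring L\<^esub> \<phi>))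
     \<oplus>\<^bsub>tensor_ring L\<^esub> (\<chi> \<otimes>\<^bsub>tensor_ring L\<^esub> (\<phi> \<otimes>\<^bsub>tensor_ring L\<^esub> \<psi>)) = \<zero>\<^bsub>tensor_ring L\<^esub>"
    by (auto simp: tensor_ring_def intro!: ext tensor_jacobi)
qed (auto simp: tensor_ring_def tensors.zero tensors_add tensor_bracket_closed tensor_bracket_add_l
    tensor_bracket_add_r tensor_bracket_alternating algebra_simps)

lemma tensor_ring_simps:
  "carrier (tensor_ring L) = tensors L" "\<phi> \<otimes>\<^bsub>tensor_ring L\<^esub> \<psi> = tensor_bracket L \<phi> \<psi>"
  "\<phi> \<oplus>\<^bsub>tensor_ring L\<^esub> \<psi> = (\<lambda>\<theta>. \<phi> \<theta> + \<psi> \<theta>)" "\<zero>\<^bsub>tensor_ring L\<^esub> = (\<lambda>_. 0)"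
  by (simp_all add: tensor_ring_def)

lemma tensor_ring_neg:
  fixes \<phi> :: "('a \<Rightarrow> 'f::field) \<Rightarrow> 'f"
  assumes "\<phi> \<in> tensors L"
  shows "\<ominus>\<^bsub>tensor_ring L\<^esub> \<phi> = (\<lambda>\<theta>. - \<phi> \<theta>)"
proof -
  interpret T: lie_ring "tensor_ring L :: (('a \<Rightarrow> 'f) \<Rightarrow> 'f) ring" by (rule tensor_lie_ring)
  show ?thesis
    using tensors_scale[OF assms, of "-1"] assms
    by (intro T.minus_equality) (auto simp: tensor_ring_simps)
qed

text \<open>The map x \<mapsto> 1 \<otimes> x is a homomorphism of Lie rings and so respects the
  lower central series.\<close>

lemma lower_central_tensor:
  "x \<in> lower_central L i \<Longrightarrow> pure_tensor L (1::'f::field) x \<in> lower_central (tensor_ring L) i"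
proof (induction i arbitrary: x)
  case 0
  thus ?case by (simp add: tensor_ring_simps pure_in_tensors)
next
  case (Suc i)
  interpret T: lie_ring "tensor_ring L :: (('a \<Rightarrow> 'f) \<Rightarrow> 'f) ring" by (rule tensor_lie_ring)
  note H = T.lower_central_subgroup[of "Suc i"]
  let ?S = "{x \<otimes> y | x y. x \<in> lower_central L i \<and> y \<in> carrier L}"
  have S: "?S \<subseteq> carrier L" using lower_central_sub by (auto intro: bracket_closed)
  have "x \<in> aspan ?S" using Suc.prems by simp
  thus ?case using S
  proof (induction rule: aspan_induct)
    case (incl s)
    then obtain y z where s: "s = y \<otimes> z" "y \<in> lower_central L i" "z \<in> carrier L" by blast
    have "pure_tensor L (1::'f) y \<otimes>\<^bsub>tensor_ring L\<^esub> pure_tensor L 1 z \<in> lower_central (tensor_ring L) (Suc i)"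
      by (rule T.lower_central_bracket) (use s Suc.IH pure_in_tensors in \<open>auto simp: tensor_ring_simps\<close>)
    moreover have "y \<in> carrier L" using s lower_central_sub by blast
    ultimately show ?case using s by (simp add: tensor_ring_simps tensor_bracket_pure)
  next
    case zero
    show ?case using T.add_subgroup_zero[OF H] by (simp add: pure_zero tensor_ring_simps)
  next
    case (neg x)
    show ?case using T.add_subgroup_neg[OF H neg(2)] neg(1)
      by (simp add: pure_neg tensor_ring_neg pure_in_tensors)
  next
    case (add x y)
    show ?case using T.add_subgroup_add[OF H add(3,4)] add(1,2) by (simp add: pure_add tensor_ring_simps)
  qed
qed

text \<open>The map x \<mapsto> 1 \<otimes> x is injective because functionals separate the elements
  of L, so vanishing descends from the scalar extension.\<close>

lemma lower_central_zero_tensor: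
  assumes "prime p" "\<And>y. y \<in> carrier L \<Longrightarrow> [p] \<cdot> y = \<zero>" "CHAR('f::field) = p"
    and "lower_central (tensor_ring L :: (('a \<Rightarrow> 'f) \<Rightarrow> 'f) ring) c = {\<zero>\<^bsub>tensor_ring L\<^esub>}"
  shows "lower_central L c = {\<zero>}"
proof -
  have "x = \<zero>" if x: "x \<in> lower_central L c" for x
  proof (rule ccontr)
    assume "x \<noteq> \<zero>"
    moreover have "x \<in> carrier L" using x lower_central_sub by blast
    ultimately obtain \<theta> :: "'a \<Rightarrow> 'f" where \<theta>: "\<theta> \<in> functionals L" "\<theta> x \<noteq> 0"
      using exists_separating_functional[OF _ _ assms(1,2,3)] by blast
    have "pure_tensor L (1::'f) x = (\<lambda>_. 0)"
      using lower_central_tensor[OF x] assms(4) by (auto simp: tensor_ring_simps)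
    hence "pure_tensor L 1 x \<theta> = 0" by simp
    thus False using \<theta> by (simp add: pure_tensor_def)
  qed
  thus ?thesis using add_subgroup_zero[OF lower_central_subgroup] by blast
qed

end

subsection \<open>Roots of unity\<close>

lemma finite_roots_of_unity: "m > 0 \<Longrightarrow> finite {x :: 'f::field. x ^ m = 1}"
proof -
  assume m: "m > 0"
  have "monom 1 m - 1 \<noteq> (0 :: 'f poly)"
  proof
    assume "monom 1 m - 1 = (0 :: 'f poly)"
    hence "coeff (monom 1 m - 1 :: 'f poly) m = 0" by simp
    thus False using m by simp
  qed
  hence "finite {x. poly (monom 1 m - 1 :: 'f poly) x = 0}" by (rule poly_roots_finite)
  thus ?thesis by (simp add: poly_monom)
qed

lemma card_roots_of_unity_le:
  assumes "m > 0"
  shows "card {x :: 'f::field. x ^ m = 1} \<le> m"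
proof -
  have nz: "monom 1 m - 1 \<noteq> (0 :: 'f poly)"
  proof
    assume "monom 1 m - 1 = (0 :: 'f poly)"
    hence "coeff (monom 1 m - 1 :: 'f poly) m = 0" by simp
    thus False using assms by simp
  qed
  have "card {x. poly (monom 1 m - 1 :: 'f poly) x = 0} \<le> degree (monom 1 m - 1 :: 'f poly)"
    by (rule card_poly_roots_bound[OF nz])
  also have "\<dots> \<le> m" by (intro degree_diff_le) (simp_all add: degree_monom_le)
  finally show ?thesis by (simp add: poly_monom)
qed

text \<open>A double root of t^m - 1 would be a root of the derivative m t^(m - 1), whose only
  possible root is 0.\<close>

lemma card_roots_of_unity:
  assumes m: "m > 0" and char: "(of_nat m :: 'f::alg_closed_field) \<noteq> 0"
  shows "card {x :: 'f. x ^ m = 1} = m"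
proof -
  define q :: "'f poly" where "q = monom 1 m - 1"
  have cm: "coeff q m = 1" using m by (simp add: q_def)
  hence q0: "q \<noteq> 0" by auto
  have "degree q \<le> m" unfolding q_def by (intro degree_diff_le) (simp_all add: degree_monom_le)
  hence dq: "degree q = m" using cm by (intro antisym le_degree) auto
  obtain A where A: "size A = degree q" "q = smult (lead_coeff q) (\<Prod>x\<in>#A. [:-x, 1:])"
    using alg_closed_imp_factorization[OF q0] by blast
  have "proots q = A"
  proof -
    have "proots q = proots (\<Prod>x\<in>#A. [:-x, 1:])"
      using q0 by (subst A(2)) (simp add: leading_coeff_neq_0)
    also have "\<dots> = A"
    proof (induction A)
      case (add x A)
      have "(\<Prod>x\<in>#A. [:-x, 1:]) \<noteq> (0 :: 'f poly)" by (auto simp: prod_mset_zero_iff)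
      thus ?case using add by (simp add: proots_mult del: mult_pCons_left)
    qed simp
    finally show ?thesis .
  qed
  have ord: "order x q = 1" if "x \<in># A" for x
  proof -
    have x: "poly q x = 0" using that \<open>proots q = A\<close> q0 by (metis set_count_proots mem_Collect_eq)
    hence xm: "x ^ m = 1" by (simp add: q_def poly_monom)
    hence x0: "x \<noteq> 0" using m by (auto simp: power_0_left)
    have "\<not> [:-x, 1:] ^ 2 dvd q"
    proof
      assume "[:-x, 1:] ^ 2 dvd q"
      then obtain r where r: "q = [:-x, 1:] ^ 2 * r" by (elim dvdE)
      have "poly (pderiv q) x = 0"
        unfolding r power2_eq_square by (simp only: pderiv_mult poly_add poly_mult) simp
      moreover have "poly (pderiv q) x = of_nat m * x ^ (m - 1)"
        by (simp add: q_def pderiv_diff pderiv_monom poly_monom pderiv_1)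
      ultimately show False using char x0 by simp
    qed
    hence "order x q < 2" using order_divides[of x 2 q] q0 by auto
    moreover have "order x q \<noteq> 0" using x q0 by (simp add: order_root)
    ultimately show ?thesis by simp
  qed
  have "count A x = 1" if "x \<in># A" for x
    using ord[OF that] \<open>proots q = A\<close> q0 by (metis count_proots)
  hence "size A = card (set_mset A)" by (simp add: size_multiset_overloaded_eq)
  moreover have "set_mset A = {x. x ^ m = 1}"
    using \<open>proots q = A\<close> q0 set_count_proots[of q] by (auto simp: q_def poly_monom)
  ultimately show ?thesis using A(1) dq by simp
qed

lemma sum_powers_root_of_unity:
  fixes z :: "'f::field"
  assumes "z ^ m = 1" "z \<noteq> 1"
  shows "(\<Sum>j<m. z ^ j) = 0"
  using geometric_sum[OF assms(2), of m] assms by simp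

text \<open>Multiplication by a root \<open>w\<close> permutes the roots and scales the sum by
  \<open>inverse w ^ j\<close>. For 0 < j < m some \<open>w\<close> makes this factor different from
  1, since at most \<open>j\<close> elements satisfy x^j = 1.\<close>

lemma sum_roots_of_unity_powers:
  assumes m: "m > 0" and char: "(of_nat m :: 'f::alg_closed_field) \<noteq> 0" and j: "j < m"
  shows "(\<Sum>x | x ^ m = (1::'f). inverse x ^ j) = (if j = 0 then of_nat m else 0)"
proof (cases "j = 0")
  case True
  thus ?thesis using card_roots_of_unity[OF m char] by simp
next
  case False
  let ?\<mu> = "{x :: 'f. x ^ m = 1}"
  have "\<exists>w\<in>?\<mu>. inverse w ^ j \<noteq> 1"
  proof (rule ccontr)
    assume "\<not> ?thesis"
    hence "?\<mu> \<subseteq> {x. x ^ j = 1}" by (auto simp: power_inverse)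
    hence "card ?\<mu> \<le> card {x :: 'f. x ^ j = 1}"
      using finite_roots_of_unity False by (intro card_mono) auto
    also have "\<dots> \<le> j" using False by (intro card_roots_of_unity_le) simp
    finally show False using card_roots_of_unity[OF m char] j by simp
  qed
  then obtain w :: 'f where w: "w ^ m = 1" "inverse w ^ j \<noteq> 1" by blast
  have w0: "w \<noteq> 0" using w(1) m by (auto simp: power_0_left)
  let ?S = "\<Sum>x\<in>?\<mu>. inverse x ^ j"
  have bij: "bij_betw (\<lambda>x. w * x) ?\<mu> ?\<mu>"
    by (rule bij_betw_byWitness[where f' = "\<lambda>x. inverse w * x"])
      (use w w0 in \<open>auto simp: power_mult_distrib power_inverse\<close>)
  have "?S = (\<Sum>x\<in>?\<mu>. inverse (w * x) ^ j)"
    by (rule sum.reindex_bij_betw[OF bij, symmetric])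
  also have "\<dots> = inverse w ^ j * ?S"
    by (simp add: sum_distrib_left power_mult_distrib inverse_mult_distrib)
  finally have "(inverse w ^ j - 1) * ?S = 0" by (simp add: algebra_simps)
  thus ?thesis using w False by simp
qed

subsection \<open>Derivations of the scalar extension\<close>

text \<open>The induction step of the Leibniz formula. The value \<open>a i j\<close> will be the
  bracket of the i-th power of the derivation at the first factor with the j-th power at the
  second.\<close>

lemma pascal_sum:
  fixes a :: "nat \<Rightarrow> nat \<Rightarrow> 'f::comm_ring_1"
  shows "(\<Sum>i\<le>k. of_nat (k choose i) * (a (Suc i) (k - i) + a i (Suc (k - i)))) =
    (\<Sum>i\<le>Suc k. of_nat (Suc k choose i) * a i (Suc k - i))"
proof -
  have 1: "(\<Sum>i\<le>k. of_nat (k choose i) * a i (Suc (k - i))) =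
      a 0 (Suc k) + (\<Sum>i\<le>k. of_nat (k choose Suc i) * a (Suc i) (k - i))"
  proof -
    have "(\<Sum>i\<le>k. of_nat (k choose i) * a i (Suc (k - i))) =
        (\<Sum>i\<le>k. of_nat (k choose i) * a i (Suc k - i))"
      by (rule sum.cong) (auto simp: Suc_diff_le)
    also have "\<dots> = (\<Sum>i\<le>Suc k. of_nat (k choose i) * a i (Suc k - i))" by (simp add: binomial_eq_0)
    also have "\<dots> = a 0 (Suc k) + (\<Sum>i\<le>k. of_nat (k choose Suc i) * a (Suc i) (k - i))"
      by (subst sum.atMost_Suc_shift) (simp add: binomial_eq_0)
    finally show ?thesis .
  qed
  have "(\<Sum>i\<le>Suc k. of_nat (Suc k choose i) * a i (Suc k - i)) =
      a 0 (Suc k) + (\<Sum>i\<le>k. of_nat ((k choose i) + (k choose Suc i)) * a (Suc i) (k - i))"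
    by (subst sum.atMost_Suc_shift) simp
  also have "\<dots> = (\<Sum>i\<le>k. of_nat (k choose i) * a (Suc i) (k - i)) +
      (\<Sum>i\<le>k. of_nat (k choose i) * a i (Suc (k - i)))"
    unfolding 1 by (simp add: sum.distrib distrib_right)
  finally show ?thesis by (simp add: sum.distrib distrib_left)
qed

definition tensor_derivation ::
    "('l, 'r) ring_scheme \<Rightarrow> ((('l \<Rightarrow> 'f::field) \<Rightarrow> 'f) \<Rightarrow> ('l \<Rightarrow> 'f) \<Rightarrow> 'f) \<Rightarrow> bool" where
  "tensor_derivation L \<Delta> \<longleftrightarrow>
    (\<forall>\<phi>\<in>tensors L. \<Delta> \<phi> \<in> tensors L) \<and>
    (\<forall>\<phi>\<in>tensors L. \<forall>\<psi>\<in>tensors L. \<Delta> (\<lambda>\<theta>. \<phi> \<theta> + \<psi> \<theta>) = (\<lambda>\<theta>. \<Delta> \<phi> \<theta> + \<Delta> \<psi> \<theta>)) \<and>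
    (\<forall>\<phi>\<in>tensors L. \<forall>c. \<Delta> (\<lambda>\<theta>. c * \<phi> \<theta>) = (\<lambda>\<theta>. c * \<Delta> \<phi> \<theta>)) \<and>
    (\<forall>\<phi>\<in>tensors L. \<forall>\<psi>\<in>tensors L. \<Delta> (tensor_bracket L \<phi> \<psi>) =
       (\<lambda>\<theta>. tensor_bracket L (\<Delta> \<phi>) \<psi> \<theta> + tensor_bracket L \<phi> (\<Delta> \<psi>) \<theta>))"

context lie_ring
begin

lemma tensor_derivationD:
  assumes "tensor_derivation L \<Delta>"
  shows "\<phi> \<in> tensors L \<Longrightarrow> \<Delta> \<phi> \<in> tensors L"
    and "\<lbrakk>\<phi> \<in> tensors L; \<psi> \<in> tensors L\<rbrakk> \<Longrightarrow> \<Delta> (\<lambda>\<theta>. \<phi> \<theta> + \<psi> \<theta>) = (\<lambda>\<theta>. \<Delta> \<phi> \<theta> + \<Delta> \<psi> \<theta>)"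
    and "\<phi> \<in> tensors L \<Longrightarrow> \<Delta> (\<lambda>\<theta>. c * \<phi> \<theta>) = (\<lambda>\<theta>. c * \<Delta> \<phi> \<theta>)"
    and "\<lbrakk>\<phi> \<in> tensors L; \<psi> \<in> tensors L\<rbrakk> \<Longrightarrow> \<Delta> (tensor_bracket L \<phi> \<psi>) =
       (\<lambda>\<theta>. tensor_bracket L (\<Delta> \<phi>) \<psi> \<theta> + tensor_bracket L \<phi> (\<Delta> \<psi>) \<theta>)"
  using assms unfolding tensor_derivation_def by blast+

lemma tensor_derivation_zero:
  assumes "tensor_derivation L \<Delta>"
  shows "\<Delta> (\<lambda>_. 0) = (\<lambda>_. 0)"
  using tensor_derivationD(3)[OF assms tensors.zero, of 0] by simp

lemma tensor_derivation_sum: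
  assumes \<Delta>: "tensor_derivation L \<Delta>" and "\<And>i. i \<in> I \<Longrightarrow> g i \<in> tensors L"
  shows "\<Delta> (\<lambda>\<theta>. \<Sum>i\<in>I. c i * g i \<theta>) = (\<lambda>\<theta>. \<Sum>i\<in>I. c i * \<Delta> (g i) \<theta>)"
  using assms(2)
proof (induction I rule: infinite_finite_induct)
  case (insert i I)
  have t: "(\<lambda>\<theta>. c i * g i \<theta>) \<in> tensors L" using insert by (intro tensors_scale) auto
  have t': "(\<lambda>\<theta>. \<Sum>i\<in>I. c i * g i \<theta>) \<in> tensors L"
    by (rule tensors_sum) (use insert in \<open>auto intro: tensors_scale\<close>)
  have "\<Delta> (\<lambda>\<theta>. c i * g i \<theta> + (\<Sum>i\<in>I. c i * g i \<theta>)) =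
      (\<lambda>\<theta>. c i * \<Delta> (g i) \<theta> + (\<Sum>i\<in>I. c i * \<Delta> (g i) \<theta>))"
    using tensor_derivationD(2)[OF \<Delta> t t'] tensor_derivationD(3)[OF \<Delta>] insert by simp
  thus ?case using insert by simp
qed (simp_all add: tensor_derivation_zero[OF \<Delta>])

lemma tensor_derivation_funpow:
  assumes "tensor_derivation L \<Delta>"
  shows "\<phi> \<in> tensors L \<Longrightarrow> (\<Delta> ^^ k) \<phi> \<in> tensors L"
    and "\<lbrakk>\<phi> \<in> tensors L; \<psi> \<in> tensors L\<rbrakk> \<Longrightarrow> (\<Delta> ^^ k) (\<lambda>\<theta>. \<phi> \<theta> + \<psi> \<theta>) = (\<lambda>\<theta>. (\<Delta> ^^ k) \<phi> \<theta> + (\<Delta> ^^ k) \<psi> \<theta>)"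
    and "\<phi> \<in> tensors L \<Longrightarrow> (\<Delta> ^^ k) (\<lambda>\<theta>. c * \<phi> \<theta>) = (\<lambda>\<theta>. c * (\<Delta> ^^ k) \<phi> \<theta>)"
proof -
  show c: "\<phi> \<in> tensors L \<Longrightarrow> (\<Delta> ^^ k) \<phi> \<in> tensors L" for \<phi> k
    by (induction k) (auto intro: tensor_derivationD[OF assms])
  show "\<lbrakk>\<phi> \<in> tensors L; \<psi> \<in> tensors L\<rbrakk> \<Longrightarrow> (\<Delta> ^^ k) (\<lambda>\<theta>. \<phi> \<theta> + \<psi> \<theta>) = (\<lambda>\<theta>. (\<Delta> ^^ k) \<phi> \<theta> + (\<Delta> ^^ k) \<psi> \<theta>)"
    by (induction k) (simp_all add: tensor_derivationD(2)[OF assms c c])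
  show "\<phi> \<in> tensors L \<Longrightarrow> (\<Delta> ^^ k) (\<lambda>\<theta>. c * \<phi> \<theta>) = (\<lambda>\<theta>. c * (\<Delta> ^^ k) \<phi> \<theta>)"
    by (induction k) (simp_all add: tensor_derivationD(3)[OF assms] c)
qed

lemma tensor_leibniz:
  assumes \<Delta>: "tensor_derivation L \<Delta>" and "\<phi> \<in> tensors L" "\<psi> \<in> tensors L"
  shows "(\<Delta> ^^ k) (tensor_bracket L \<phi> \<psi>) =
    (\<lambda>\<theta>. \<Sum>i\<le>k. of_nat (k choose i) * tensor_bracket L ((\<Delta> ^^ i) \<phi>) ((\<Delta> ^^ (k - i)) \<psi>) \<theta>)"
proof (induction k)
  case (Suc k)
  have t: "(\<Delta> ^^ i) \<phi> \<in> tensors L" "(\<Delta> ^^ i) \<psi> \<in> tensors L" for i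
    using tensor_derivation_funpow(1)[OF \<Delta>] assms by auto
  have "(\<Delta> ^^ Suc k) (tensor_bracket L \<phi> \<psi>) =
      (\<lambda>\<theta>. \<Sum>i\<le>k. of_nat (k choose i) * \<Delta> (tensor_bracket L ((\<Delta> ^^ i) \<phi>) ((\<Delta> ^^ (k - i)) \<psi>)) \<theta>)"
    by (simp only: funpow.simps o_apply Suc)
      (rule tensor_derivation_sum[OF \<Delta>], use t tensor_bracket_closed in auto)
  also have "\<dots> = (\<lambda>\<theta>. \<Sum>i\<le>k. of_nat (k choose i) *
      (tensor_bracket L ((\<Delta> ^^ Suc i) \<phi>) ((\<Delta> ^^ (k - i)) \<psi>) \<theta> +
       tensor_bracket L ((\<Delta> ^^ i) \<phi>) ((\<Delta> ^^ (Suc (k - i))) \<psi>) \<theta>))"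
    by (simp add: tensor_derivationD(4)[OF \<Delta> t])
  also have "\<dots> = (\<lambda>\<theta>. \<Sum>i\<le>Suc k. of_nat (Suc k choose i) *
      tensor_bracket L ((\<Delta> ^^ i) \<phi>) ((\<Delta> ^^ (Suc k - i)) \<psi>) \<theta>)"
    by (rule ext) (rule pascal_sum[of k "\<lambda>i j. tensor_bracket L ((\<Delta> ^^ i) \<phi>) ((\<Delta> ^^ j) \<psi>) _"])
  finally show ?case .
qed simp

text \<open>In the Leibniz formula for the p-th power all binomial coefficients except the two outer
  ones are divisible by p and vanish in characteristic p.\<close>

lemma tensor_derivation_prime_power:
  fixes \<Delta> :: "(('a \<Rightarrow> 'f::field) \<Rightarrow> 'f) \<Rightarrow> ('a \<Rightarrow> 'f) \<Rightarrow> 'f"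
  assumes \<Delta>: "tensor_derivation L \<Delta>" and p: "prime p" "CHAR('f) = p"
  shows "tensor_derivation L (\<Delta> ^^ p)"
  unfolding tensor_derivation_def
proof (intro conjI ballI allI)
  fix \<phi> \<psi> :: "('a \<Rightarrow> 'f) \<Rightarrow> 'f" assume t: "\<phi> \<in> tensors L" "\<psi> \<in> tensors L"
  have z: "of_nat (p choose i) = (0::'f)" if "0 < i" "i < p" for i
    using dvd_choose_prime[of i p] that p by (simp add: of_nat_eq_0_iff_char_dvd)
  show "(\<Delta> ^^ p) (tensor_bracket L \<phi> \<psi>) =
      (\<lambda>\<theta>. tensor_bracket L ((\<Delta> ^^ p) \<phi>) \<psi> \<theta> + tensor_bracket L \<phi> ((\<Delta> ^^ p) \<psi>) \<theta>)"
  proof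
    fix \<theta>
    let ?f = "\<lambda>i. of_nat (p choose i) * tensor_bracket L ((\<Delta> ^^ i) \<phi>) ((\<Delta> ^^ (p - i)) \<psi>) \<theta>"
    have "(\<Delta> ^^ p) (tensor_bracket L \<phi> \<psi>) \<theta> = (\<Sum>i\<le>p. ?f i)"
      by (simp add: tensor_leibniz[OF \<Delta> t])
    also have "\<dots> = (\<Sum>i\<in>{0, p}. ?f i)"
      by (rule sum.mono_neutral_right) (use z in \<open>auto simp: le_less\<close>)
    also have "\<dots> = tensor_bracket L ((\<Delta> ^^ p) \<phi>) \<psi> \<theta> + tensor_bracket L \<phi> ((\<Delta> ^^ p) \<psi>) \<theta>"
      using prime_gt_0_nat[OF p(1)] by simp
    finally show "(\<Delta> ^^ p) (tensor_bracket L \<phi> \<psi>) \<theta> =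
      tensor_bracket L ((\<Delta> ^^ p) \<phi>) \<psi> \<theta> + tensor_bracket L \<phi> ((\<Delta> ^^ p) \<psi>) \<theta>" .
  qed
qed (use tensor_derivation_funpow[OF \<Delta>] in auto)

lemma tensor_derivation_prime_powers:
  fixes \<Delta> :: "(('a \<Rightarrow> 'f::field) \<Rightarrow> 'f) \<Rightarrow> ('a \<Rightarrow> 'f) \<Rightarrow> 'f"
  assumes "tensor_derivation L \<Delta>" "prime p" "CHAR('f) = p"
  shows "tensor_derivation L (\<Delta> ^^ (p ^ s))"
proof (induction s)
  case 0
  have "\<Delta> ^^ (p ^ 0) = \<Delta>" by (rule ext) simp
  thus ?case using assms by simp
next
  case (Suc s)
  have "\<Delta> ^^ (p ^ Suc s) = (\<Delta> ^^ (p ^ s)) ^^ p" by (simp add: funpow_mult mult.commute)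
  thus ?case using tensor_derivation_prime_power[OF Suc assms(2,3)] by simp
qed

lemma tensor_map_functional:
  assumes "\<theta> \<in> functionals L" and D: "\<And>x. x \<in> carrier L \<Longrightarrow> D x \<in> carrier L"
    and "\<And>x y. \<lbrakk>x \<in> carrier L; y \<in> carrier L\<rbrakk> \<Longrightarrow> D (x \<oplus> y) = D x \<oplus> D y"
  shows "(\<lambda>x. if x \<in> carrier L then \<theta> (D x) else 0) \<in> functionals L"
  using assms by (simp add: functionals_def)

context
  fixes D
  assumes D: "\<And>x. x \<in> carrier L \<Longrightarrow> D x \<in> carrier L"
    and D_add: "\<And>x y. \<lbrakk>x \<in> carrier L; y \<in> carrier L\<rbrakk> \<Longrightarrow> D (x \<oplus> y) = D x \<oplus> D y"
    and D_br: "\<And>x y. \<lbrakk>x \<in> carrier L; y \<in> carrier L\<rbrakk> \<Longrightarrow> D (x \<otimes> y) = (D x \<otimes> y) \<oplus> (x \<otimes> D y)"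
begin

lemma tensor_map_pure: "x \<in> carrier L \<Longrightarrow> tensor_map L D (pure_tensor L u x) = pure_tensor L u (D x)"
  by (rule ext) (simp add: tensor_map_def pure_tensor_def tensor_map_functional[OF _ D D_add])

lemma tensor_map_add: "tensor_map L D (\<lambda>\<theta>. \<phi> \<theta> + \<psi> \<theta>) = (\<lambda>\<theta>. tensor_map L D \<phi> \<theta> + tensor_map L D \<psi> \<theta>)"
  by (rule ext) (simp add: tensor_map_def)

lemma tensor_map_scale: "tensor_map L D (\<lambda>\<theta>. c * \<phi> \<theta>) = (\<lambda>\<theta>. c * tensor_map L D \<phi> \<theta>)"
  by (rule ext) (simp add: tensor_map_def)

lemma tensor_map_zero: "tensor_map L D (\<lambda>_. 0) = (\<lambda>_. 0)"
  by (rule ext) (simp add: tensor_map_def)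

lemma tensor_map_closed: "\<phi> \<in> tensors L \<Longrightarrow> tensor_map L D \<phi> \<in> tensors L"
  by (induction rule: tensors_induct)
    (simp_all add: tensor_map_zero tensors.zero tensor_map_pure pure_in_tensors D tensor_map_add tensors_add)

lemma tensor_map_derivation: "tensor_derivation L (tensor_map L D)"
  unfolding tensor_derivation_def
proof (intro conjI ballI allI)
  fix \<phi> \<psi> :: "('a \<Rightarrow> 'f::field) \<Rightarrow> 'f" assume t: "\<phi> \<in> tensors L" "\<psi> \<in> tensors L"
  note s = tensor_bracket_zero_l tensor_bracket_zero_r tensor_bracket_add_l tensor_bracket_add_r
    tensor_map_closed tensor_map_add tensor_map_zero pure_in_tensors
  let ?D = "tensor_map L D"
  show "?D (tensor_bracket L \<phi> \<psi>) =
      (\<lambda>\<theta>. tensor_bracket L (?D \<phi>) \<psi> \<theta> + tensor_bracket L \<phi> (?D \<psi>) \<theta>)"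
    using t(1)
  proof (induction rule: tensors_induct)
    case (pure u x)
    from t(2) show ?case
    proof (induction rule: tensors_induct)
      case zero
      show ?case by (rule ext) (simp add: s D \<open>x \<in> carrier L\<close>)
    next
      case (pure v y)
      show ?case using pure \<open>x \<in> carrier L\<close>
        by (simp add: tensor_bracket_pure tensor_map_pure bracket_closed D D_br pure_add)
    next
      case (add \<psi> \<psi>')
      show ?case
        using add.hyps \<open>x \<in> carrier L\<close> by (simp add: s add.IH) (simp add: algebra_simps)
    qed
  next
    case zero
    show ?case by (rule ext) (simp add: s)
  next
    case (add \<phi> \<phi>')
    show ?case using add.hyps t by (simp add: s add.IH) (simp add: algebra_simps)
  qed
qed (simp_all add: tensor_map_closed tensor_map_add tensor_map_scale)

lemma funpow_carrier: "x \<in> carrier L \<Longrightarrow> (D ^^ k) x \<in> carrier L"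
  by (induction k) (auto simp: D)

lemma tensor_map_funpow_id:
  assumes "\<And>x. x \<in> carrier L \<Longrightarrow> (D ^^ k) x = x" "\<phi> \<in> tensors L"
  shows "(tensor_map L D ^^ k) \<phi> = \<phi>"
  using assms(2)
proof (induction rule: tensors_induct)
  case zero
  show ?case by (induction k) (simp_all add: tensor_map_zero)
next
  case (pure u x)
  have "(tensor_map L D ^^ j) (pure_tensor L u x) = pure_tensor L u ((D ^^ j) x)" for j
    by (induction j) (simp_all add: tensor_map_pure funpow_carrier pure)
  thus ?case using assms pure by simp
next
  case (add \<phi> \<psi>)
  thus ?case by (simp add: tensor_derivation_funpow(2)[OF tensor_map_derivation])
qed

end

end

subsection \<open>The eigenspace grading\<close>

definition additive_monoid :: "'f::field monoid" where
  "additive_monoid = \<lparr>carrier = UNIV, monoid.mult = (+), one = 0\<rparr>"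

lemma additive_monoid_simps:
  "carrier additive_monoid = UNIV" "x \<otimes>\<^bsub>additive_monoid\<^esub> y = x + y" "\<one>\<^bsub>additive_monoid\<^esub> = 0"
  by (simp_all add: additive_monoid_def)

lemma additive_monoid_comm_group: "comm_group (additive_monoid :: 'f::field monoid)"
proof (rule comm_groupI)
  fix x :: 'f
  show "\<exists>y\<in>carrier additive_monoid. y \<otimes>\<^bsub>additive_monoid\<^esub> x = \<one>\<^bsub>additive_monoid\<^esub>"
    by (intro bexI[of _ "- x"]) (simp_all add: additive_monoid_simps)
qed (simp_all add: additive_monoid_simps algebra_simps)

lemma additive_monoid_pow: "x [^]\<^bsub>additive_monoid\<^esub> (k::nat) = of_nat k * (x :: 'f::field)"
proof -
  interpret comm_group "additive_monoid :: 'f monoid" by (rule additive_monoid_comm_group)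
  show ?thesis by (induction k) (simp_all add: additive_monoid_simps algebra_simps)
qed

context lie_ring
begin

lemma tensor_sum_in_subgroup:
  assumes "finite I" "\<And>i. i \<in> I \<Longrightarrow> g i \<in> H" "subgroup H (add_monoid (tensor_ring L))"
  shows "(\<lambda>\<theta>. \<Sum>i\<in>I. g i \<theta>) \<in> (H :: (('a \<Rightarrow> 'f::field) \<Rightarrow> 'f) set)"
proof -
  interpret T: lie_ring "tensor_ring L :: (('a \<Rightarrow> 'f) \<Rightarrow> 'f) ring" by (rule tensor_lie_ring)
  note H = assms(3)
  show ?thesis using assms(1,2)
  proof (induction I rule: finite_induct)
    case empty
    thus ?case using T.add_subgroup_zero[OF H] by (simp add: tensor_ring_simps)
  next
    case (insert i I)
    thus ?case using T.add_subgroup_add[OF H, of "g i" "\<lambda>\<theta>. \<Sum>i\<in>I. g i \<theta>"]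
      by (simp add: tensor_ring_simps)
  qed
qed

context
  fixes \<Delta> :: "(('a \<Rightarrow> 'f::alg_closed_field) \<Rightarrow> 'f) \<Rightarrow> ('a \<Rightarrow> 'f) \<Rightarrow> 'f" and m n :: nat
  assumes \<Delta>: "tensor_derivation L \<Delta>" and m: "m > 0" "(of_nat m :: 'f) \<noteq> 0"
    and \<Delta>_m: "\<And>\<phi>. \<phi> \<in> tensors L \<Longrightarrow> (\<Delta> ^^ m) \<phi> = \<phi>"
    and free: "\<not> (\<exists>\<alpha> \<beta> :: 'f. \<alpha> ^ m = 1 \<and> \<beta> ^ m = 1 \<and> (\<forall>k. (\<alpha> + of_nat k * \<beta>) ^ m = 1))"
    and mn: "m \<le> n"
begin

definition eigenspace :: "'f \<Rightarrow> (('a \<Rightarrow> 'f) \<Rightarrow> 'f) set" where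
  "eigenspace a = {\<phi> \<in> tensors L. \<Delta> \<phi> = (\<lambda>\<theta>. a * \<phi> \<theta>)}"

text \<open>The projection of discrete Fourier analysis for an operator with \<Delta>^m = id. If
  \<open>a\<close> is not an \<open>m\<close>-th root of unity its eigenspace is zero, which
  explains the default.\<close>

definition eigen_proj :: "'f \<Rightarrow> (('a \<Rightarrow> 'f) \<Rightarrow> 'f) \<Rightarrow> ('a \<Rightarrow> 'f) \<Rightarrow> 'f" where
  "eigen_proj a \<phi> = (if a ^ m = 1 then (\<lambda>\<theta>. inverse (of_nat m) * (\<Sum>j<m. inverse a ^ j * (\<Delta> ^^ j) \<phi> \<theta>))
     else (\<lambda>_. 0))"

lemma eigen_pow: "\<phi> \<in> eigenspace a \<Longrightarrow> (\<Delta> ^^ j) \<phi> = (\<lambda>\<theta>. a ^ j * \<phi> \<theta>)"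
proof (induction j)
  case (Suc j)
  hence t: "\<phi> \<in> tensors L" "\<Delta> \<phi> = (\<lambda>\<theta>. a * \<phi> \<theta>)" by (simp_all add: eigenspace_def)
  have "(\<Delta> ^^ Suc j) \<phi> = \<Delta> (\<lambda>\<theta>. a ^ j * \<phi> \<theta>)" using Suc by simp
  also have "\<dots> = (\<lambda>\<theta>. a ^ j * \<Delta> \<phi> \<theta>)" by (rule tensor_derivationD(3)[OF \<Delta> t(1)])
  also have "\<dots> = (\<lambda>\<theta>. a ^ Suc j * \<phi> \<theta>)" by (simp add: t(2) mult_ac)
  finally show ?case .
qed simp

lemma eigenspace_trivial:
  assumes "a ^ m \<noteq> 1" "\<phi> \<in> eigenspace a"
  shows "\<phi> = (\<lambda>_. 0)"
proof
  fix \<theta>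
  have "\<phi> \<in> tensors L" using assms by (simp add: eigenspace_def)
  hence "\<phi> = (\<lambda>\<theta>. a ^ m * \<phi> \<theta>)" using eigen_pow[OF assms(2), of m] \<Delta>_m by simp
  hence "\<phi> \<theta> = a ^ m * \<phi> \<theta>" by (rule fun_cong)
  hence "(a ^ m - 1) * \<phi> \<theta> = 0" by (simp add: algebra_simps)
  thus "\<phi> \<theta> = 0" using assms(1) by simp
qed

lemma eigenspace_zero: "(\<lambda>_. 0) \<in> eigenspace a"
  by (simp add: eigenspace_def tensors.zero tensor_derivation_zero[OF \<Delta>])

lemma eigenspace_subgroup: "subgroup (eigenspace a) (add_monoid (tensor_ring L))"
proof -
  interpret T: lie_ring "tensor_ring L :: (('a \<Rightarrow> 'f) \<Rightarrow> 'f) ring" by (rule tensor_lie_ring)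
  show ?thesis
  proof (rule T.add.subgroupI)
    show "eigenspace a \<subseteq> carrier (tensor_ring L)" by (auto simp: eigenspace_def tensor_ring_simps)
    show "eigenspace a \<noteq> {}" using eigenspace_zero by auto
  next
    fix \<phi> assume "\<phi> \<in> eigenspace a"
    hence t: "\<phi> \<in> tensors L" "\<Delta> \<phi> = (\<lambda>\<theta>. a * \<phi> \<theta>)" by (simp_all add: eigenspace_def)
    have "(\<lambda>\<theta>. - \<phi> \<theta>) \<in> tensors L" using tensors_scale[OF t(1), of "-1"] by simp
    moreover have "\<Delta> (\<lambda>\<theta>. - \<phi> \<theta>) = (\<lambda>\<theta>. a * - \<phi> \<theta>)"
      using tensor_derivationD(3)[OF \<Delta> t(1), of "-1"] t(2) by simp
    ultimately show "\<ominus>\<^bsub>tensor_ring L\<^esub> \<phi> \<in> eigenspace a"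
      by (simp add: tensor_ring_neg[OF t(1)] eigenspace_def)
  next
    fix \<phi> \<psi> assume "\<phi> \<in> eigenspace a" "\<psi> \<in> eigenspace a"
    thus "\<phi> \<oplus>\<^bsub>tensor_ring L\<^esub> \<psi> \<in> eigenspace a"
      by (simp add: eigenspace_def tensor_ring_simps tensors_add tensor_derivationD(2)[OF \<Delta>] algebra_simps)
  qed
qed

lemma eigenspace_bracket:
  assumes "\<phi> \<in> eigenspace a" "\<psi> \<in> eigenspace c"
  shows "tensor_bracket L \<phi> \<psi> \<in> eigenspace (a + c)"
proof -
  have t: "\<phi> \<in> tensors L" "\<psi> \<in> tensors L" "\<Delta> \<phi> = (\<lambda>\<theta>. a * \<phi> \<theta>)" "\<Delta> \<psi> = (\<lambda>\<theta>. c * \<psi> \<theta>)"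
    using assms by (simp_all add: eigenspace_def)
  have "\<Delta> (tensor_bracket L \<phi> \<psi>) = (\<lambda>\<theta>. (a + c) * tensor_bracket L \<phi> \<psi> \<theta>)"
    using t by (simp add: tensor_derivationD(4)[OF \<Delta> t(1,2)] tensor_bracket_scale_l
        tensor_bracket_scale_r distrib_right)
  thus ?thesis using t by (simp add: eigenspace_def tensor_bracket_closed)
qed

lemma eigen_proj_tensor:
  assumes "\<phi> \<in> tensors L"
  shows "eigen_proj a \<phi> \<in> tensors L"
  using assms tensor_derivation_funpow(1)[OF \<Delta>]
  by (auto simp: eigen_proj_def intro!: tensors_scale tensors_sum tensors.zero)

lemma eigen_proj_closed:
  assumes \<phi>: "\<phi> \<in> tensors L"
  shows "eigen_proj a \<phi> \<in> eigenspace a"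
proof (cases "a ^ m = 1")
  case True
  have a0: "a \<noteq> 0" using True m by (auto simp: power_0_left)
  let ?h = "\<lambda>j \<theta>. inverse a ^ j * (\<Delta> ^^ j) \<phi> \<theta>"
  have t: "(\<Delta> ^^ j) \<phi> \<in> tensors L" for j by (rule tensor_derivation_funpow(1)[OF \<Delta> \<phi>])
  have s: "(\<lambda>\<theta>. \<Sum>j<m. ?h j \<theta>) \<in> tensors L" by (intro tensors_sum tensors_scale t)
  have "\<Delta> (\<lambda>\<theta>. \<Sum>j<m. ?h j \<theta>) = (\<lambda>\<theta>. a * (\<Sum>j<m. ?h j \<theta>))"
  proof
    fix \<theta>
    have "\<Delta> (\<lambda>\<theta>. \<Sum>j<m. ?h j \<theta>) \<theta> = (\<Sum>j<m. inverse a ^ j * (\<Delta> ^^ Suc j) \<phi> \<theta>)"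
      by (simp add: tensor_derivation_sum[OF \<Delta> t])
    also have "\<dots> = (\<Sum>j<m. a * ?h (Suc j) \<theta>)"
      by (rule sum.cong) (use a0 in \<open>simp_all add: field_simps\<close>)
    also have "\<dots> = a * (\<Sum>j<m. ?h (Suc j) \<theta>)" by (rule sum_distrib_left[symmetric])
    \<comment> \<open>The sum is cyclic: the term at \<open>m\<close> equals the one at 0 because
      both a^m and \<Delta>^m are trivial.\<close>
    also have "(\<Sum>j<m. ?h (Suc j) \<theta>) = (\<Sum>j<m. ?h j \<theta>)"
    proof -
      have "?h 0 \<theta> + (\<Sum>j<m. ?h (Suc j) \<theta>) = (\<Sum>j<m. ?h j \<theta>) + ?h m \<theta>"
        using sum.lessThan_Suc_shift[of "\<lambda>j. ?h j \<theta>" m] sum.lessThan_Suc[of "\<lambda>j. ?h j \<theta>" m]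
        by (simp only:)
      moreover have "?h m \<theta> = ?h 0 \<theta>" using True by (simp add: \<Delta>_m[OF \<phi>] power_inverse)
      ultimately show ?thesis by simp
    qed
    finally show "\<Delta> (\<lambda>\<theta>. \<Sum>j<m. ?h j \<theta>) \<theta> = a * (\<Sum>j<m. ?h j \<theta>)" .
  qed
  hence "\<Delta> (eigen_proj a \<phi>) = (\<lambda>\<theta>. a * eigen_proj a \<phi> \<theta>)"
    using True tensor_derivationD(3)[OF \<Delta> s] by (simp add: eigen_proj_def mult_ac)
  thus ?thesis using eigen_proj_tensor[OF \<phi>] by (simp add: eigenspace_def)
next
  case False
  thus ?thesis using eigenspace_zero by (simp add: eigen_proj_def)
qed

lemma eigen_proj_add:
  assumes "\<phi> \<in> tensors L" "\<psi> \<in> tensors L"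
  shows "eigen_proj a (\<lambda>\<theta>. \<phi> \<theta> + \<psi> \<theta>) = (\<lambda>\<theta>. eigen_proj a \<phi> \<theta> + eigen_proj a \<psi> \<theta>)"
  by (simp add: eigen_proj_def tensor_derivation_funpow(2)[OF \<Delta> assms] distrib_left sum.distrib)

lemma eigen_proj_eigen:
  assumes \<phi>: "\<phi> \<in> eigenspace c" and a: "a ^ m = 1"
  shows "eigen_proj a \<phi> = (\<lambda>\<theta>. inverse (of_nat m) * (\<Sum>j<m. (inverse a * c) ^ j) * \<phi> \<theta>)"
  using a by (simp add: eigen_proj_def eigen_pow[OF \<phi>] power_mult_distrib sum_distrib_left
      sum_distrib_right mult_ac)

lemma eigen_proj_same: "\<phi> \<in> eigenspace a \<Longrightarrow> eigen_proj a \<phi> = \<phi>"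
proof (cases "a ^ m = 1")
  case True
  assume "\<phi> \<in> eigenspace a"
  moreover have "a \<noteq> 0" using True m by (auto simp: power_0_left)
  ultimately show ?thesis using m True by (simp add: eigen_proj_eigen)
next
  case False
  assume "\<phi> \<in> eigenspace a"
  thus ?thesis using eigenspace_trivial False by (simp add: eigen_proj_def)
qed

lemma eigen_proj_other:
  assumes \<phi>: "\<phi> \<in> eigenspace c" and "a \<noteq> c"
  shows "eigen_proj a \<phi> = (\<lambda>_. 0)"
proof (cases "a ^ m = 1 \<and> c ^ m = 1")
  case True
  have "a \<noteq> 0" using True m by (auto simp: power_0_left)
  hence "inverse a * c \<noteq> 1" using assms(2) by (auto simp: field_simps)
  moreover have "(inverse a * c) ^ m = 1" using True by (simp add: power_mult_distrib power_inverse)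
  ultimately have "(\<Sum>j<m. (inverse a * c) ^ j) = 0" by (intro sum_powers_root_of_unity)
  thus ?thesis using True by (simp add: eigen_proj_eigen[OF \<phi>])
next
  case False
  show ?thesis
  proof (cases "a ^ m = 1")
    case True
    hence "\<phi> = (\<lambda>_. 0)" using False eigenspace_trivial \<phi> by blast
    thus ?thesis using eigen_proj_eigen[OF \<phi> True] by simp
  qed (simp add: eigen_proj_def)
qed

text \<open>Fourier inversion: after the two sums are exchanged, orthogonality leaves only
  \<open>j = 0\<close>, with a factor \<open>m\<close> that cancels.\<close>

lemma sum_eigen_proj:
  assumes "\<phi> \<in> tensors L"
  shows "\<phi> = (\<lambda>\<theta>. \<Sum>a | a ^ m = 1. eigen_proj a \<phi> \<theta>)"
proof
  fix \<theta>
  have "(\<Sum>a | a ^ m = 1. eigen_proj a \<phi> \<theta>) =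
      (\<Sum>a | a ^ m = 1. inverse (of_nat m) * (\<Sum>j<m. inverse a ^ j * (\<Delta> ^^ j) \<phi> \<theta>))"
    by (rule sum.cong) (simp_all add: eigen_proj_def)
  also have "\<dots> = inverse (of_nat m) * (\<Sum>a | a ^ m = 1. \<Sum>j<m. inverse a ^ j * (\<Delta> ^^ j) \<phi> \<theta>)"
    by (rule sum_distrib_left[symmetric])
  also have "(\<Sum>a | a ^ m = 1. \<Sum>j<m. inverse a ^ j * (\<Delta> ^^ j) \<phi> \<theta>)
      = (\<Sum>j<m. \<Sum>a | a ^ m = 1. inverse a ^ j * (\<Delta> ^^ j) \<phi> \<theta>)" by (rule sum.swap)
  also have "\<dots> = (\<Sum>j<m. (\<Sum>a | a ^ m = 1. inverse a ^ j) * (\<Delta> ^^ j) \<phi> \<theta>)"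
    by (simp add: sum_distrib_right)
  also have "\<dots> = (\<Sum>j<m. if j = 0 then of_nat m * \<phi> \<theta> else 0)"
    by (rule sum.cong) (auto simp: sum_roots_of_unity_powers[OF m])
  also have "\<dots> = of_nat m * \<phi> \<theta>" using m(1) by simp
  finally show "\<phi> \<theta> = (\<Sum>a | a ^ m = 1. eigen_proj a \<phi> \<theta>)" using m(2) by simp
qed

lemma eigen_grading:
  "projected_lie_ring (tensor_ring L) additive_monoid eigenspace {a :: 'f. a ^ m = 1} n eigen_proj"
proof (intro projected_lie_ring.intro graded_lie_ring.intro graded_lie_ring_axioms.intro
      projected_lie_ring_axioms.intro)
  show "lie_ring (tensor_ring L :: (('a \<Rightarrow> 'f) \<Rightarrow> 'f) ring)" by (rule tensor_lie_ring)
  then interpret T: lie_ring "tensor_ring L :: (('a \<Rightarrow> 'f) \<Rightarrow> 'f) ring" .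
  show "comm_group (additive_monoid :: 'f monoid)" by (rule additive_monoid_comm_group)
  show "finite {a :: 'f. a ^ m = 1}" by (rule finite_roots_of_unity[OF m(1)])
  show "card {a :: 'f. a ^ m = 1} \<le> n" using card_roots_of_unity_le[OF m(1), where 'f = 'f] mn by simp
  show "arithmetically_free additive_monoid {a :: 'f. a ^ m = 1}"
    using free unfolding arithmetically_free_def additive_monoid_pow additive_monoid_simps by simp
  show "carrier (tensor_ring L) \<subseteq> T.aspan (\<Union>a\<in>carrier additive_monoid. eigenspace a)"
  proof
    fix \<phi> :: "('a \<Rightarrow> 'f) \<Rightarrow> 'f" assume "\<phi> \<in> carrier (tensor_ring L)"
    hence \<phi>: "\<phi> \<in> tensors L" by (simp add: tensor_ring_simps)
    have sub: "(\<Union>a\<in>carrier additive_monoid. eigenspace a) \<subseteq> carrier (tensor_ring L)"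
      by (auto simp: eigenspace_def tensor_ring_simps)
    have "(\<lambda>\<theta>. \<Sum>a | a ^ m = 1. eigen_proj a \<phi> \<theta>) \<in> T.aspan (\<Union>a\<in>carrier additive_monoid. eigenspace a)"
    proof (rule tensor_sum_in_subgroup[OF finite_roots_of_unity[OF m(1)] _ T.aspan_subgroup[OF sub]])
      fix a :: 'f
      show "eigen_proj a \<phi> \<in> T.aspan (\<Union>a\<in>carrier additive_monoid. eigenspace a)"
        by (rule T.aspan_incl, rule UN_I[of a], simp add: additive_monoid_simps)
           (rule eigen_proj_closed[OF \<phi>])
    qed
    thus "\<phi> \<in> T.aspan (\<Union>a\<in>carrier additive_monoid. eigenspace a)"
      using sum_eigen_proj[OF \<phi>] by simp
  qed
next
  fix a :: 'f show "subgroup (eigenspace a) (add_monoid (tensor_ring L))" by (rule eigenspace_subgroup)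
next
  fix a :: 'f assume "a \<notin> {a. a ^ m = 1}"
  thus "eigenspace a = {\<zero>\<^bsub>tensor_ring L\<^esub>}"
    using eigenspace_trivial eigenspace_zero by (auto simp: tensor_ring_simps)
qed (simp_all add: eigenspace_bracket eigen_proj_closed eigen_proj_add
    eigen_proj_same eigen_proj_other tensor_ring_simps additive_monoid_simps)

end

theorem lower_central_periodic_derivation:
  fixes D :: "'a \<Rightarrow> 'a"
  assumes p: "prime p" "\<And>y. y \<in> carrier L \<Longrightarrow> [p] \<cdot> y = \<zero>" "CHAR('f::alg_closed_field) = p"
    and D: "\<And>x. x \<in> carrier L \<Longrightarrow> D x \<in> carrier L"
      "\<And>x y. \<lbrakk>x \<in> carrier L; y \<in> carrier L\<rbrakk> \<Longrightarrow> D (x \<oplus> y) = D x \<oplus> D y"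
      "\<And>x y. \<lbrakk>x \<in> carrier L; y \<in> carrier L\<rbrakk> \<Longrightarrow> D (x \<otimes> y) = (D x \<otimes> y) \<oplus> (x \<otimes> D y)"
      "\<And>x. x \<in> carrier L \<Longrightarrow> (D ^^ n) x = x"
    and n: "n = p ^ s * m" "m > 0" "\<not> p dvd m"
    and free: "\<not> (\<exists>\<alpha> \<beta> :: 'f. \<alpha> ^ m = 1 \<and> \<beta> ^ m = 1 \<and> (\<forall>k. (\<alpha> + of_nat k * \<beta>) ^ m = 1))"
    and inf: "infinite (UNIV :: 'x set)" "infinite (UNIV :: 'y set)"
  shows "lower_central L (higman_map TYPE('x) TYPE('y) n) = {\<zero>}"
proof -
  \<comment> \<open>With this power D^n = id becomes \<Delta>^m = id, where \<open>m\<close> is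
    invertible in the field, as the eigenprojections require.\<close>
  define \<Delta> :: "(('a \<Rightarrow> 'f) \<Rightarrow> 'f) \<Rightarrow> ('a \<Rightarrow> 'f) \<Rightarrow> 'f" where "\<Delta> = tensor_map L D ^^ (p ^ s)"
  have 1: "tensor_derivation L \<Delta>"
    unfolding \<Delta>_def by (rule tensor_derivation_prime_powers[OF tensor_map_derivation[OF D(1-3)] p(1,3)])
  have 2: "(of_nat m :: 'f) \<noteq> 0" using n(3) p(3) by (simp add: of_nat_eq_0_iff_char_dvd)
  have 3: "(\<Delta> ^^ m) \<phi> = \<phi>" if "\<phi> \<in> tensors L" for \<phi>
    using tensor_map_funpow_id[OF D(1-4) that] by (simp add: \<Delta>_def funpow_mult n(1) mult.commute)
  \<comment> \<open>The support has at most \<open>m\<close> elements, and m \<le> n brings it under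
    the bound for \<open>n\<close>.\<close>
  have "1 \<le> p ^ s" using prime_gt_0_nat[OF p(1)] by simp
  hence 4: "m \<le> n" using mult_le_mono1[of 1 "p ^ s" m] n(1) by simp
  interpret T: projected_lie_ring "tensor_ring L" additive_monoid "eigenspace \<Delta>" "{a :: 'f. a ^ m = 1}" n "eigen_proj \<Delta> m"
    by (rule eigen_grading[OF 1 n(2) 2 3 free 4])
  have "lower_central (tensor_ring L :: (('a \<Rightarrow> 'f) \<Rightarrow> 'f) ring) (higman_map TYPE('x) TYPE('y) n) = {\<zero>\<^bsub>tensor_ring L\<^esub>}"
    by (rule T.higman_transfer[OF inf higman_map_bound])
  from lower_central_zero_tensor[OF p(1) _ p(3) this] p(2) show ?thesis by blast
qed

end

subsection \<open>Periods of polynomials\<close>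

lemma power_minus_one_dvd:
  fixes x :: "'r::comm_ring_1"
  shows "x ^ d - 1 dvd x ^ (d * j) - 1"
  by (metis dvd_triv_left power_diff_1_eq power_mult)

lemma monom_1_eq_power: "monom (1::'r::comm_semiring_1) n = [:0, 1:] ^ n"
  by (simp add: monom_altdef)

lemma dvd_pCons_0_cancel:
  fixes r :: "'k::field poly"
  assumes "poly r 0 \<noteq> 0" "r dvd pCons 0 y"
  shows "r dvd y"
proof -
  obtain s where s: "pCons 0 y = r * s" using assms(2) by (elim dvdE)
  have "poly (pCons 0 y) 0 = poly r 0 * poly s 0" by (simp only: s poly_mult)
  hence "poly s 0 = 0" using assms(1) by simp
  then obtain s' where "s = pCons 0 s'" by (cases s) auto
  hence "pCons 0 y = pCons 0 (r * s')" using s by simp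
  thus ?thesis by simp
qed

lemma dvd_power_X_cancel:
  fixes r :: "'k::field poly"
  assumes "poly r 0 \<noteq> 0" "r dvd [:0, 1:] ^ i * y"
  shows "r dvd y"
  using assms(2)
proof (induction i)
  case (Suc i)
  have "[:0, 1:] ^ Suc i * y = pCons 0 ([:0, 1:] ^ i * y)" by (simp add: mult.assoc)
  thus ?case using Suc dvd_pCons_0_cancel[OF assms(1)] by metis
qed simp

lemma finite_bounded_degree_polys: "finite {q :: 'k::{finite,zero} poly. \<forall>i\<ge>d. coeff q i = 0}"
proof (rule finite_imageD)
  let ?Q = "{q :: 'k poly. \<forall>i\<ge>d. coeff q i = 0}" and ?f = "\<lambda>q :: 'k poly. map (coeff q) [0..<d]"
  have "?f ` ?Q \<subseteq> {xs. set xs \<subseteq> UNIV \<and> length xs = d}" by auto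
  thus "finite (?f ` ?Q)" by (rule finite_subset) (rule finite_lists_length_eq, simp)
  show "inj_on ?f ?Q"
  proof (rule inj_onI)
    fix q q' :: "'k poly" assume q: "q \<in> ?Q" "q' \<in> ?Q" "?f q = ?f q'"
    have "coeff q i = coeff q' i" for i
    proof (cases "i < d")
      case True
      thus ?thesis using q(3) by simp
    qed (use q in simp)
    thus "q = q'" by (simp add: poly_eq_iff)
  qed
qed

text \<open>There are finitely many residues modulo \<open>r\<close>, so two powers of t agree, and
  the smaller power cancels because r(0) \<noteq> 0.\<close>

lemma exists_period:
  fixes r :: "'k::{finite,field} poly"
  assumes r0: "poly r 0 \<noteq> 0"
  shows "\<exists>N>0. r dvd monom 1 N - 1"
proof -
  have rn: "r \<noteq> 0" using r0 by auto
  let ?Q = "{q :: 'k poly. \<forall>i\<ge>degree r. coeff q i = 0}"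
  have "[:0, 1:] ^ i mod r \<in> ?Q" for i :: nat
  proof (cases "[:0, 1:] ^ i mod r = 0")
    case False
    hence "degree ([:0, 1:] ^ i mod r) < degree r" using degree_mod_less[OF rn] by blast
    thus ?thesis by (simp add: coeff_eq_0)
  qed simp
  hence "range (\<lambda>i::nat. [:0, 1:] ^ i mod r) \<subseteq> ?Q" by blast
  hence "finite (range (\<lambda>i::nat. [:0, 1:] ^ i mod r))"
    using finite_bounded_degree_polys by (rule finite_subset)
  hence "\<not> inj (\<lambda>i::nat. [:0, 1:] ^ i mod r)" using finite_imageD[of _ UNIV] by blast
  then obtain i j where ij: "i < j" "[:0, 1:] ^ i mod r = [:0, 1:] ^ j mod r"
    unfolding inj_def by (metis linorder_neqE_nat)
  have "r dvd [:0, 1:] ^ j - [:0, 1:] ^ i" using ij(2)[symmetric] by (simp add: mod_eq_dvd_iff)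
  also have "[:0, 1:] ^ j - [:0, 1:] ^ i = [:0, 1:] ^ i * ([:0, 1:] ^ (j - i) - 1 :: 'k poly)"
    using ij(1) by (simp add: right_diff_distrib power_add[symmetric])
  finally have "r dvd [:0, 1:] ^ (j - i) - 1" by (rule dvd_power_X_cancel[OF r0])
  thus ?thesis using ij(1) by (intro exI[of _ "j - i"]) (simp add: monom_1_eq_power)
qed

text \<open>Division with remainder: a nonzero remainder of \<open>N\<close> modulo the least
  exponent would be a smaller exponent.\<close>

lemma per_properties:
  fixes r :: "'p::prime_card mod_ring poly"
  assumes "N > 0" "r dvd monom 1 N - 1"
  shows "per r > 0" "r dvd monom 1 (per r) - 1" "per r dvd N"
proof -
  have *: "per r > 0 \<and> r dvd monom 1 (per r) - 1"
    unfolding per_def by (rule LeastI[of "\<lambda>m. m > 0 \<and> r dvd monom 1 m - 1" N]) (use assms in simp)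
  thus d: "per r > 0" "r dvd monom 1 (per r) - 1" by auto
  let ?x = "[:0, 1:] :: 'p mod_ring poly" and ?d = "per r" and ?e = "N mod per r"
  have "r dvd ?x ^ ?d - 1" using d by (simp add: monom_1_eq_power)
  hence 1: "r dvd ?x ^ ?e * (?x ^ (?d * (N div ?d)) - 1)"
    using power_minus_one_dvd dvd_trans dvd_mult by blast
  have "?x ^ N = ?x ^ ?e * ?x ^ (?d * (N div ?d))" by (simp add: power_add[symmetric])
  hence "?x ^ ?e - 1 = (?x ^ N - 1) - ?x ^ ?e * (?x ^ (?d * (N div ?d)) - 1)"
    by (simp add: right_diff_distrib)
  moreover have "r dvd ?x ^ N - 1" using assms by (simp add: monom_1_eq_power)
  ultimately have r: "r dvd ?x ^ ?e - 1" using 1 by (metis dvd_diff)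
  have "?e = 0"
  proof (rule ccontr)
    assume "?e \<noteq> 0"
    hence "per r \<le> ?e" using r unfolding per_def[of r]
      by (intro Least_le) (simp add: monom_1_eq_power per_def)
    moreover have "?e < per r" using d by simp
    ultimately show False by simp
  qed
  thus "per r dvd N" by auto
qed

subsection \<open>Shift-invariant polynomials\<close>

lemma degree_artin_schreier:
  "degree (monom 1 CARD('p) - monom 1 1 :: 'p::prime_card mod_ring poly) = CARD('p)"
proof -
  have "CARD('p) > 1" using prime_card[where 'a = 'p] prime_gt_1_nat by blast
  hence "degree (monom 1 1 :: 'p mod_ring poly) < degree (monom 1 CARD('p) :: 'p mod_ring poly)"
    by (simp add: degree_monom_eq)
  hence "degree (- monom 1 1 + monom 1 CARD('p) :: 'p mod_ring poly) = CARD('p)"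
    by (subst degree_add_eq_right) (simp_all add: degree_monom_eq)
  thus ?thesis by simp
qed

text \<open>In characteristic p, (t + 1)^p = t^p + 1, so the shift raises t^p and t by the same
  constant.\<close>

lemma artin_schreier_shift:
  "pcompose (monom 1 CARD('p) - monom 1 1) [:1, 1:] = (monom 1 CARD('p) - monom 1 1 :: 'p::prime_card mod_ring poly)"
proof -
  let ?x = "[:0, 1:] :: 'p mod_ring poly" and ?p = "CARD('p)"
  have C: "CHAR('p mod_ring poly) = ?p" by simp
  have pr: "prime CHAR('p mod_ring poly)" using prime_card[where 'a = 'p] by (simp only: C)
  have "[:1, 1:] = ?x + 1" by (simp add: one_pCons)
  hence "[:1, 1:] ^ ?p = ?x ^ ?p + (1 :: 'p mod_ring poly)"
    using freshmans_dream[OF pr C[symmetric], of ?x 1] by (simp only: power_one)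
  moreover have "pcompose (?x ^ k) [:1, 1:] = [:1, 1:] ^ k" for k
    by (simp add: pcompose_hom.hom_power pcompose_pCons)
  ultimately show ?thesis
    by (simp add: monom_1_eq_power pcompose_diff one_pCons)
qed

text \<open>Invariance gives \<open>c\<close> the same value at all p elements of the prime field,
  which are too many roots for a nonzero c - c(0) of degree below p.\<close>

lemma shift_invariant_const:
  fixes c :: "'p::prime_card mod_ring poly"
  assumes inv: "pcompose c [:1, 1:] = c" and deg: "degree c < CARD('p)"
  shows "c = [:poly c 0:]"
proof -
  have step: "poly c (x + 1) = poly c x" for x
    using arg_cong[OF inv, of "\<lambda>q. poly q x"] by (simp add: poly_pcompose add.commute)
  have val: "poly c (of_nat k) = poly c 0" for k
    by (induction k) (simp_all add: step[of "of_nat _", simplified add.commute] add.commute)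
  define q where "q = c - [:poly c 0:]"
  have "poly q x = 0" for x
  proof -
    have "\<exists>k. x = of_nat k"
    proof -
      have "inj_on (of_nat :: nat \<Rightarrow> 'p mod_ring) {..<CARD('p)}"
        by (rule inj_onI) (simp add: of_nat_eq_iff_cong_CHAR cong_def)
      hence "card ((of_nat :: nat \<Rightarrow> 'p mod_ring) ` {..<CARD('p)}) = CARD('p)"
        by (simp add: card_image)
      moreover have "CARD('p mod_ring) = CARD('p)" by simp
      ultimately have "(of_nat :: nat \<Rightarrow> 'p mod_ring) ` {..<CARD('p)} = UNIV"
        by (intro card_subset_eq) simp_all
      thus ?thesis by (metis UNIV_I imageE)
    qed
    thus ?thesis using val by (auto simp: q_def)
  qed
  hence roots: "{x. poly q x = 0} = UNIV" by auto
  have "q = 0"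
  proof (rule ccontr)
    assume "q \<noteq> 0"
    hence "card {x. poly q x = 0} \<le> degree q" by (rule card_poly_roots_bound)
    moreover have "degree q < CARD('p)"
      using deg degree_diff_le_max[of c "[:poly c 0:]"] by (simp add: q_def)
    ultimately show False by (simp add: roots)
  qed
  thus ?thesis by (simp add: q_def)
qed

text \<open>Expansion in base t^p - t. The base is invariant, so by uniqueness of division the
  quotient and the remainder are invariant too; the remainder is a constant digit and the quotient
  has smaller degree.\<close>

lemma shift_invariant_decomp:
  fixes c :: "'p::prime_card mod_ring poly"
  assumes "pcompose c [:1, 1:] = c"
  shows "\<exists>h. c = pcompose h (monom 1 CARD('p) - monom 1 1)"
  using assms
proof (induction "degree c" arbitrary: c rule: less_induct)
  case less
  let ?w = "monom 1 CARD('p) - monom 1 1 :: 'p mod_ring poly" and ?s = "[:1, 1:] :: 'p mod_ring poly"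
  have pos: "CARD('p) > 0" by simp
  have w: "degree ?w = CARD('p)" "?w \<noteq> 0" using degree_artin_schreier[where 'p = 'p] pos by auto
  show ?case
  proof (cases "degree c < CARD('p)")
    case True
    have "pcompose [:poly c 0:] ?w = [:poly c 0:]" by simp
    also have "\<dots> = c" by (rule shift_invariant_const[OF less.prems True, symmetric])
    finally have "pcompose [:poly c 0:] ?w = c" .
    thus ?thesis by (intro exI[of _ "[:poly c 0:]"]) (rule sym)
  next
    case False
    define q where "q = c div ?w"
    define r where "r = c mod ?w"
    have c: "c = ?w * q + r" by (simp add: q_def r_def)
    have dr: "degree r < CARD('p)"
      using degree_mod_less[OF w(2), of c] w(1) pos by (auto simp: r_def)
    have "?w * pcompose q ?s + pcompose r ?s = ?w * q + r"
      using less.prems unfolding c by (simp only: pcompose_add pcompose_mult artin_schreier_shift)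
    hence eq: "?w * (pcompose q ?s - q) = r - pcompose r ?s" by (simp add: algebra_simps)
    have "degree (r - pcompose r ?s) < CARD('p)"
      using degree_diff_le_max[of r "pcompose r ?s"] dr by (simp add: degree_pcompose)
    have q: "pcompose q ?s = q"
    proof (rule ccontr)
      assume "pcompose q ?s \<noteq> q"
      hence "degree (?w * (pcompose q ?s - q)) = CARD('p) + degree (pcompose q ?s - q)"
        using w by (subst degree_mult_eq) auto
      thus False using eq \<open>degree (r - pcompose r ?s) < CARD('p)\<close> by simp
    qed
    hence r: "pcompose r ?s = r" using eq by simp
    have c0: "c \<noteq> 0" using False pos by auto
    have "degree q < degree c"
    proof (cases "q = 0")
      case True
      hence "degree q = 0" by simp
      thus ?thesis using False pos by linarith
    next
      case q0: False
      hence "degree (?w * q) = CARD('p) + degree q" using w by (subst degree_mult_eq) auto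
      hence "degree c = CARD('p) + degree q" unfolding c using dr by (subst degree_add_eq_left) auto
      thus ?thesis using pos by simp
    qed
    then obtain h where h: "q = pcompose h ?w" using less.hyps q by blast
    have "c = pcompose (pCons (poly r 0) h) ?w"
      using c shift_invariant_const[OF r dr] h by (simp add: pcompose_pCons)
    thus ?thesis by blast
  qed
qed

subsection \<open>Bad orders and roots of unity\<close>

interpretation to_ac_hom: inj_idom_hom "to_ac :: 'k::field \<Rightarrow> 'k alg_closure"
  by unfold_locales auto

interpretation to_ac_poly: map_poly_inj_idom_hom "to_ac :: 'k::field \<Rightarrow> 'k alg_closure" ..

definition eval_ac :: "'k::field poly \<Rightarrow> 'k alg_closure \<Rightarrow> 'k alg_closure" where
  "eval_ac a x = poly (map_poly to_ac a) x"

lemma eval_ac_simps: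
  "eval_ac (a + b) x = eval_ac a x + eval_ac b x" "eval_ac (a - b) x = eval_ac a x - eval_ac b x"
  "eval_ac (a * b) x = eval_ac a x * eval_ac b x" "eval_ac 1 x = 1" "eval_ac 0 x = 0"
  "eval_ac (monom 1 k) x = x ^ k" "eval_ac (smult c a) x = to_ac c * eval_ac a x"
  "eval_ac (pcompose a b) x = eval_ac a (eval_ac b x)"
  "eval_ac [:1, 1:] x = x + 1"
  by (simp_all add: eval_ac_def to_ac_poly.hom_add to_ac_poly.hom_minus to_ac_poly.hom_mult
      map_poly_monom poly_monom to_ac_hom.map_poly_hom_smult to_ac_hom.map_poly_pcompose poly_pcompose
      map_poly_pCons)

lemma eval_ac_const: "eval_ac [:c:] x = to_ac c"
  by (cases "c = 0") (simp_all add: eval_ac_def map_poly_pCons)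

lemma bad_orderI:
  fixes \<alpha> \<beta> :: "'p::prime_card mod_ring alg_closure"
  assumes m: "m > 0" and \<alpha>: "\<alpha> ^ m = 1" and \<beta>: "\<beta> ^ m = 1"
    and all: "\<And>k. (\<alpha> + of_nat k * \<beta>) ^ m = 1"
  shows "m \<in> bad_orders TYPE('p)"
proof -
  have \<beta>0: "\<beta> \<noteq> 0" using \<beta> m by (auto simp: power_0_left)
  define \<gamma> where "\<gamma> = \<alpha> / \<beta>"
  have \<gamma>: "(\<gamma> + of_nat k) ^ m = 1" for k
  proof -
    have "\<gamma> + of_nat k = (\<alpha> + of_nat k * \<beta>) / \<beta>" using \<beta>0 by (simp add: \<gamma>_def add_divide_distrib)
    thus ?thesis using all[of k] \<beta> by (simp add: power_divide)
  qed
  \<comment> \<open>The vanishing ideal of the coset over the prime field; \<open>c\<close> will be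
    its monic generator.\<close>
  define Z where "Z = {a :: 'p mod_ring poly. \<forall>k. eval_ac a (\<gamma> + of_nat k) = 0}"
  define q where "q = (monom 1 m - 1 :: 'p mod_ring poly)"
  have qZ: "q \<in> Z" using \<gamma> by (simp add: Z_def q_def eval_ac_simps)
  have "coeff q m = 1" using m by (simp add: q_def)
  hence q0: "q \<noteq> 0" by auto
  obtain c0 where c0: "c0 \<in> Z \<and> c0 \<noteq> 0" and min0: "\<And>a. a \<in> Z \<and> a \<noteq> 0 \<Longrightarrow> degree c0 \<le> degree a"
    using ex_has_least_nat[of "\<lambda>a. a \<in> Z \<and> a \<noteq> 0" q degree] qZ q0 by blast
  define c where "c = smult (inverse (lead_coeff c0)) c0"
  have lc: "lead_coeff c = 1" and dc: "degree c = degree c0" and c0': "c \<noteq> 0"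
    using c0 by (auto simp: c_def)
  have cZ: "c \<in> Z" using c0 by (simp add: Z_def c_def eval_ac_simps)
  have min: "degree c \<le> degree a" if "a \<in> Z" "a \<noteq> 0" for a using min0 that dc by simp
  have dvd: "c dvd a" if "a \<in> Z" for a
  proof -
    have "a mod c = a - c * (a div c)" by (simp add: minus_mult_div_eq_mod)
    hence "a mod c \<in> Z" using that cZ by (simp add: Z_def eval_ac_simps)
    hence "a mod c = 0" using min[of "a mod c"] degree_mod_less[OF c0', of a] by linarith
    thus ?thesis by auto
  qed
  have inv: "pcompose c [:1, 1:] = c"
  proof (rule ccontr)
    let ?c' = "pcompose c [:1, 1:]"
    assume "?c' \<noteq> c"
    have "?c' \<in> Z"
      unfolding Z_def
    proof (intro CollectI allI)
      fix k
      have "\<gamma> + of_nat k + 1 = \<gamma> + of_nat (Suc k)" by simp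
      thus "eval_ac ?c' (\<gamma> + of_nat k) = 0"
        using cZ by (simp only: eval_ac_simps Z_def mem_Collect_eq)
    qed
    hence "?c' - c \<in> Z" using cZ by (simp add: Z_def eval_ac_simps)
    hence le: "degree c \<le> degree (?c' - c)" using min \<open>?c' \<noteq> c\<close> by simp
    have d': "degree ?c' = degree c" by (simp add: degree_pcompose)
    \<comment> \<open>Two monic polynomials of equal degree: their difference would be a nonzero
      element of \<open>Z\<close> of degree below the minimum.\<close>
    have "lead_coeff ?c' = 1" using lc by (subst lead_coeff_comp) simp_all
    hence "coeff (?c' - c) (degree c) = 0" using lc d' by simp
    moreover have "degree (?c' - c) = degree c"
      using le degree_diff_le_max[of ?c' c] d' by simp
    ultimately show False using \<open>?c' \<noteq> c\<close> by (metis eq_iff_diff_eq_0 leading_coeff_0_iff)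
  qed
  then obtain h where h: "c = pcompose h (monom 1 CARD('p) - monom 1 1)"
    using shift_invariant_decomp by blast
  have cq: "c dvd monom 1 m - 1" using dvd[OF qZ] by (simp add: q_def)
  \<comment> \<open>The value of t^m - 1 at 0 is -1, so its divisor \<open>c\<close> does not vanish
    at 0, and c(0) = h(0).\<close>
  have "poly (monom 1 m - 1 :: 'p mod_ring poly) 0 \<noteq> 0" using m by (simp add: poly_monom power_0_left)
  moreover obtain d where d: "monom 1 m - 1 = c * d" using cq by (elim dvdE)
  have "poly (monom 1 m - 1) 0 = poly c 0 * poly d 0" by (simp only: d poly_mult)
  ultimately have "poly c 0 \<noteq> 0" by auto
  hence h0: "poly h 0 \<noteq> 0" by (simp add: h poly_pcompose poly_monom power_0_left)
  have "degree h \<ge> 1"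
  proof (rule ccontr)
    assume "\<not> ?thesis"
    hence "degree h = 0" by simp
    then obtain e where e: "h = [:e:]" using degree_eq_zeroE by blast
    have "eval_ac c (\<gamma> + of_nat 0) = 0" using cZ unfolding Z_def by blast
    hence "e = 0" by (simp add: h e eval_ac_simps eval_ac_const)
    thus False using h0 e by simp
  qed
  hence "per c \<in> period_set TYPE('p)" using h h0 unfolding period_set_def by blast
  moreover obtain k where k: "m = per c * k" using per_properties(3)[OF m cq] by (elim dvdE)
  moreover have "k > 0" using k m by (cases k) auto
  ultimately show ?thesis unfolding bad_orders_def
    by (intro CollectI exI[of _ k] exI[of _ "per c"]) (simp add: mult.commute)
qed

lemma bad_orders_multiple: "\<lbrakk>m \<in> bad_orders P; j > 0\<rbrakk> \<Longrightarrow> j * m \<in> bad_orders P"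
  unfolding bad_orders_def
proof (elim CollectE exE conjE)
  fix k l assume "m = k * l" "0 < k" "l \<in> period_set P" "0 < j"
  thus "j * m \<in> {k * m | k m. 0 < k \<and> m \<in> period_set P}"
    by (intro CollectI exI[of _ "j * k"] exI[of _ l]) simp
qed

text \<open>In the algebraic closure h has a root \<delta>, and t^p - t = \<delta> has a solution
  \<gamma>. The left side is unchanged when 1 is added to t, so c = h(t^p - t) vanishes on the whole
  coset, and with it t^k - 1 for k = \<open>per c\<close>.\<close>

lemma bad_orderE:
  assumes "n \<in> bad_orders TYPE('p::prime_card)"
  shows "\<exists>\<gamma> :: 'p mod_ring alg_closure. \<forall>k. (\<gamma> + of_nat k) ^ n = 1"
proof -
  obtain j h where jh: "n = j * per (pcompose h (monom 1 CARD('p) - monom 1 1 :: 'p mod_ring poly))"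
    "poly h 0 \<noteq> 0" "degree h \<ge> 1"
    using assms by (auto simp: bad_orders_def period_set_def)
  define c where "c = pcompose h (monom 1 CARD('p) - monom 1 1 :: 'p mod_ring poly)"
  have pos: "CARD('p) > 1" using prime_card[where 'a = 'p] prime_gt_1_nat by blast
  have "poly c 0 \<noteq> 0" using jh pos by (simp add: c_def poly_pcompose poly_monom power_0_left)
  then obtain N where N: "N > 0" "c dvd monom 1 N - 1" using exists_period by blast
  have cd: "c dvd monom 1 (per c) - 1" using per_properties(2)[OF N] .
  have "degree (map_poly to_ac h) > 0" using jh(3) by (simp add: degree_map_poly)
  then obtain \<delta> where \<delta>: "eval_ac h \<delta> = 0"
    unfolding eval_ac_def using alg_closed_imp_poly_has_root by blast
  have "degree (monom 1 CARD('p) - monom 1 1 - [:\<delta>:]) > 0"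
  proof -
    have "coeff [:\<delta>:] CARD('p) = 0" by (rule coeff_eq_0) simp
    moreover have "coeff (monom 1 1) CARD('p) = (0 :: 'p mod_ring alg_closure)" using pos by simp
    ultimately have e: "coeff (monom 1 CARD('p) - monom 1 1 - [:\<delta>:]) CARD('p) = 1"
      unfolding coeff_diff by (simp only: coeff_monom) simp
    have "CARD('p) \<le> degree (monom 1 CARD('p) - monom 1 1 - [:\<delta>:])"
      by (rule le_degree, subst e) simp
    thus ?thesis using pos by simp
  qed
  then obtain \<gamma> where "poly (monom 1 CARD('p) - monom 1 1 - [:\<delta>:]) \<gamma> = 0"
    using alg_closed_imp_poly_has_root by blast
  hence \<gamma>: "\<gamma> ^ CARD('p) - \<gamma> = \<delta>" by (simp add: poly_monom)
  have fr: "(\<gamma> + of_nat k) ^ CARD('p) - (\<gamma> + of_nat k) = \<delta>" for k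
  proof -
    have C: "CHAR('p mod_ring alg_closure) = CARD('p)" by simp
    have pr: "prime CHAR('p mod_ring alg_closure)" using prime_card[where 'a = 'p] by (simp only: C)
    have a: "(x + 1) ^ CARD('p) = x ^ CARD('p) + 1" for x :: "'p mod_ring alg_closure"
      using freshmans_dream[OF pr C[symmetric], of x 1] by (simp only: power_one)
    show ?thesis
    proof (induction k)
      case (Suc k)
      have "\<gamma> + of_nat (Suc k) = (\<gamma> + of_nat k) + 1" by simp
      hence "(\<gamma> + of_nat (Suc k)) ^ CARD('p) - (\<gamma> + of_nat (Suc k)) =
          ((\<gamma> + of_nat k) ^ CARD('p) + 1) - ((\<gamma> + of_nat k) + 1)" by (simp only: a)
      thus ?case using Suc by simp
    qed (simp add: \<gamma>)
  qed
  have "(\<gamma> + of_nat k) ^ n = 1" for k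
  proof -
    have "eval_ac c (\<gamma> + of_nat k) = 0" using fr[of k] \<delta> by (simp add: c_def eval_ac_simps)
    moreover obtain d where "monom 1 (per c) - 1 = c * d" using cd by (elim dvdE)
    ultimately have "eval_ac (monom 1 (per c) - 1) (\<gamma> + of_nat k) = 0" by (simp only: eval_ac_simps mult_zero_left)
    hence "(\<gamma> + of_nat k) ^ per c = 1" by (simp add: eval_ac_simps)
    moreover have "n = per c * j" using jh(1) by (simp only: c_def mult.commute)
    ultimately show ?thesis by (simp only: power_mult power_one)
  qed
  thus ?thesis by blast
qed

subsection \<open>A non-nilpotent Lie algebra with a periodic derivation\<close>

text \<open>A triple \<open>(f, s, w)\<close> stands for \<open>\<Sum> f \<lambda> e\<^sub>\<lambda> + s x + w\<close>, where \<open>[e\<^sub>\<lambda>, x] = e\<^sub>\<lambda>\<^sub>+\<^sub>1\<close>, the derivation acts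
  by \<open>e\<^sub>\<lambda> \<mapsto> \<lambda> e\<^sub>\<lambda>\<close> and \<open>x \<mapsto> x\<close>, and \<open>w\<close> lies in a central summand whose \<open>n\<close> coordinates it permutes
  cyclically. The central summand is there only to make the order of the derivation exactly \<open>n\<close>.\<close>

type_synonym 'f cyc = "('f \<Rightarrow> 'f) \<times> 'f \<times> (nat \<Rightarrow> 'f)"

definition cyc_carrier :: "'f::field set \<Rightarrow> 'f set \<Rightarrow> nat \<Rightarrow> 'f cyc set" where
  "cyc_carrier U \<Lambda> n = {(f, s, w). (\<forall>x. f x \<in> U) \<and> (\<forall>x. x \<notin> \<Lambda> \<longrightarrow> f x = 0) \<and> s \<in> U \<and>
     (\<forall>i. w i \<in> U) \<and> (\<forall>i\<ge>n. w i = 0)}"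

fun cyc_add :: "'f::field cyc \<Rightarrow> 'f cyc \<Rightarrow> 'f cyc" where
  "cyc_add (f, s, w) (f', s', w') = ((\<lambda>x. f x + f' x), s + s', (\<lambda>i. w i + w' i))"

fun cyc_smult :: "'f::field \<Rightarrow> 'f cyc \<Rightarrow> 'f cyc" where
  "cyc_smult c (f, s, w) = ((\<lambda>x. c * f x), c * s, (\<lambda>i. c * w i))"

definition cyc_zero :: "'f::field cyc" where
  "cyc_zero = ((\<lambda>_. 0), 0, (\<lambda>_. 0))"

text \<open>The bracket raises weights by 1, so the coefficient at a weight comes from its
  predecessor.\<close>

fun cyc_bracket :: "'f::field cyc \<Rightarrow> 'f cyc \<Rightarrow> 'f cyc" where
  "cyc_bracket (f, s, w) (f', s', w') = ((\<lambda>x. s' * f (x - 1) - s * f' (x - 1)), 0, (\<lambda>_. 0))"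

fun cyc_deriv :: "nat \<Rightarrow> 'f::field cyc \<Rightarrow> 'f cyc" where
  "cyc_deriv n (f, s, w) = ((\<lambda>x. x * f x), s, (\<lambda>i. if i < n then w (Suc i mod n) else 0))"

lemma finite_cyc_carrier:
  assumes U_fin: "finite U" and \<Lambda>_sub: "\<Lambda> \<subseteq> U"
  shows "finite (cyc_carrier U \<Lambda> n :: 'f::field cyc set)"
proof -
  let ?A = "{f :: 'f \<Rightarrow> 'f. \<forall>x. (x \<in> \<Lambda> \<longrightarrow> f x \<in> U) \<and> (x \<notin> \<Lambda> \<longrightarrow> f x = 0)}"
  let ?B = "{w :: nat \<Rightarrow> 'f. \<forall>i. (i \<in> {..<n} \<longrightarrow> w i \<in> U) \<and> (i \<notin> {..<n} \<longrightarrow> w i = 0)}"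
  have "finite ?A" by (rule finite_set_of_finite_funs[OF finite_subset[OF \<Lambda>_sub U_fin] U_fin])
  moreover have "finite ?B" by (rule finite_set_of_finite_funs[OF _ U_fin]) simp
  ultimately have "finite (?A \<times> U \<times> ?B)" using U_fin by simp
  moreover have "cyc_carrier U \<Lambda> n \<subseteq> ?A \<times> U \<times> ?B" by (auto simp: cyc_carrier_def)
  ultimately show ?thesis by (rule rev_finite_subset)
qed

text \<open>The weights lie in a finite subfield \<open>U\<close>, so that the field and the algebra are finite and can be
  encoded in \<open>nat\<close> by \<open>k\<close> and \<open>l\<close>.\<close>

locale cyclic_lie_algebra =
  fixes U \<Lambda> :: "'f::field set" and n :: nat and k :: "'f \<Rightarrow> nat" and l :: "'f cyc \<Rightarrow> nat"
  assumes U_zero: "0 \<in> U" and U_one: "1 \<in> U" and U_add: "\<lbrakk>x \<in> U; y \<in> U\<rbrakk> \<Longrightarrow> x + y \<in> U"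
    and U_mult: "\<lbrakk>x \<in> U; y \<in> U\<rbrakk> \<Longrightarrow> x * y \<in> U" and U_minus: "x \<in> U \<Longrightarrow> - x \<in> U"
    and U_inverse: "x \<in> U \<Longrightarrow> inverse x \<in> U" and U_fin: "finite U"
    and \<Lambda>_sub: "\<Lambda> \<subseteq> U" and \<Lambda>_ne: "\<Lambda> \<noteq> {}" and \<Lambda>_succ: "x \<in> \<Lambda> \<Longrightarrow> x + 1 \<in> \<Lambda>"
    and \<Lambda>_pred: "x \<in> \<Lambda> \<Longrightarrow> x - 1 \<in> \<Lambda>" and \<Lambda>_pow: "x \<in> \<Lambda> \<Longrightarrow> x ^ n = 1" and n_pos: "n > 0"
    and k_inj: "inj_on k U" and l_inj: "inj_on l (cyc_carrier U \<Lambda> n)"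
begin

abbreviation "V \<equiv> cyc_carrier U \<Lambda> n"

definition "k' = inv_into U k"
definition "l' = inv_into V l"

lemma k' [simp]: "x \<in> U \<Longrightarrow> k' (k x) = x"
  using k_inj by (simp add: k'_def)

lemma l' [simp]: "v \<in> V \<Longrightarrow> l' (l v) = v"
  using l_inj by (simp add: l'_def)

lemma U_diff: "\<lbrakk>x \<in> U; y \<in> U\<rbrakk> \<Longrightarrow> x - y \<in> U"
  using U_add[OF _ U_minus, of x y] by simp

lemmas U_closed [simp] = U_zero U_one U_add U_mult U_minus U_inverse U_diff

definition K :: "nat ring" where
  "K = \<lparr>carrier = k ` U, monoid.mult = (\<lambda>x y. k (k' x * k' y)), one = k 1, zero = k 0,
     add = (\<lambda>x y. k (k' x + k' y))\<rparr>"

lemma K_simps: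
  "carrier K = k ` U" "\<one>\<^bsub>K\<^esub> = k 1" "\<zero>\<^bsub>K\<^esub> = k 0"
  "\<lbrakk>x \<in> U; y \<in> U\<rbrakk> \<Longrightarrow> k x \<otimes>\<^bsub>K\<^esub> k y = k (x * y)" "\<lbrakk>x \<in> U; y \<in> U\<rbrakk> \<Longrightarrow> k x \<oplus>\<^bsub>K\<^esub> k y = k (x + y)"
  by (simp_all add: K_def)

lemma K_field: "field K"
proof -
  have "abelian_group K"
  proof (rule abelian_groupI)
    fix x assume "x \<in> carrier K"
    then obtain u where "x = k u" "u \<in> U" by (auto simp: K_simps)
    thus "\<exists>y\<in>carrier K. y \<oplus>\<^bsub>K\<^esub> x = \<zero>\<^bsub>K\<^esub>" by (intro bexI[of _ "k (- u)"]) (auto simp: K_simps)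
  qed (auto simp: K_simps algebra_simps)
  moreover have "comm_monoid K"
    by (rule comm_monoidI) (auto simp: K_simps algebra_simps)
  ultimately interpret cring K
    by (rule cringI) (auto simp: K_simps algebra_simps)
  show ?thesis
  proof (rule cring_fieldI2)
    show "\<zero>\<^bsub>K\<^esub> \<noteq> \<one>\<^bsub>K\<^esub>" using k_inj by (auto simp: K_simps dest: inj_onD)
    fix a assume a: "a \<in> carrier K" "a \<noteq> \<zero>\<^bsub>K\<^esub>"
    then obtain u where "a = k u" "u \<in> U" "u \<noteq> 0" by (auto simp: K_simps)
    thus "\<exists>b\<in>carrier K. a \<otimes>\<^bsub>K\<^esub> b = \<one>\<^bsub>K\<^esub>"
      by (intro bexI[of _ "k (inverse u)"]) (auto simp: K_simps)
  qed
qed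

lemma K_multiple: "[(j::nat)] \<cdot>\<^bsub>K\<^esub> \<one>\<^bsub>K\<^esub> = k (of_nat j) \<and> (of_nat j :: 'f) \<in> U"
proof -
  interpret field K by (rule K_field)
  show ?thesis
  proof (induction j)
    case (Suc j)
    have "[(Suc j)] \<cdot>\<^bsub>K\<^esub> \<one>\<^bsub>K\<^esub> = [j] \<cdot>\<^bsub>K\<^esub> \<one>\<^bsub>K\<^esub> \<oplus>\<^bsub>K\<^esub> \<one>\<^bsub>K\<^esub>" by (rule add.nat_pow_Suc)
    thus ?case using Suc by (simp add: K_simps add.commute)
  qed (simp add: K_simps)
qed

lemma K_characteristic:
  assumes "CHAR('f) > 0"
  shows "characteristic K = CHAR('f)"
proof -
  have eq: "[(j::nat)] \<cdot>\<^bsub>K\<^esub> \<one>\<^bsub>K\<^esub> = \<zero>\<^bsub>K\<^esub> \<longleftrightarrow> CHAR('f) dvd j" for j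
    using K_multiple[of j] k_inj by (auto simp: K_simps of_nat_eq_0_iff_char_dvd[symmetric] dest: inj_onD)
  have ex: "\<exists>m::nat. m > 0 \<and> CHAR('f) dvd m" using assms by auto
  have "(LEAST m::nat. m > 0 \<and> CHAR('f) dvd m) = CHAR('f)"
    by (rule Least_equality) (use assms dvd_imp_le in auto)
  thus ?thesis using ex by (simp add: characteristic_def eq)
qed

definition L :: "(nat, nat) module" where
  "L = \<lparr>carrier = l ` V, monoid.mult = (\<lambda>x y. l (cyc_bracket (l' x) (l' y))), one = l cyc_zero,
     zero = l cyc_zero, add = (\<lambda>x y. l (cyc_add (l' x) (l' y))),
     module.smult = (\<lambda>c x. l (cyc_smult (k' c) (l' x)))\<rparr>"

lemma V_closed [simp]:
  "cyc_zero \<in> V" "\<lbrakk>u \<in> V; v \<in> V\<rbrakk> \<Longrightarrow> cyc_add u v \<in> V" "\<lbrakk>c \<in> U; v \<in> V\<rbrakk> \<Longrightarrow> cyc_smult c v \<in> V"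
  "\<lbrakk>u \<in> V; v \<in> V\<rbrakk> \<Longrightarrow> cyc_bracket u v \<in> V" "v \<in> V \<Longrightarrow> cyc_deriv n v \<in> V"
proof -
  show "cyc_zero \<in> V" by (simp add: cyc_zero_def cyc_carrier_def)
  show "\<lbrakk>u \<in> V; v \<in> V\<rbrakk> \<Longrightarrow> cyc_add u v \<in> V" by (cases u; cases v) (simp add: cyc_carrier_def)
  show "\<lbrakk>c \<in> U; v \<in> V\<rbrakk> \<Longrightarrow> cyc_smult c v \<in> V" by (cases v) (simp add: cyc_carrier_def)
  show "cyc_deriv n v \<in> V" if v: "v \<in> V"
  proof -
    obtain f s w where e: "v = (f, s, w)" by (cases v)
    have "x * f x \<in> U" for x using v \<Lambda>_sub by (cases "x \<in> \<Lambda>") (auto simp: e cyc_carrier_def)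
    thus ?thesis using v by (simp add: e cyc_carrier_def)
  qed
  assume uv: "u \<in> V" "v \<in> V"
  have "x - 1 \<notin> \<Lambda>" if "x \<notin> \<Lambda>" for x using \<Lambda>_succ[of "x - 1"] that by auto
  thus "cyc_bracket u v \<in> V" using uv by (cases u; cases v) (simp add: cyc_carrier_def)
qed

lemma L_simps:
  "carrier L = l ` V" "\<zero>\<^bsub>L\<^esub> = l cyc_zero"
  "\<lbrakk>u \<in> V; v \<in> V\<rbrakk> \<Longrightarrow> l u \<otimes>\<^bsub>L\<^esub> l v = l (cyc_bracket u v)"
  "\<lbrakk>u \<in> V; v \<in> V\<rbrakk> \<Longrightarrow> l u \<oplus>\<^bsub>L\<^esub> l v = l (cyc_add u v)"
  "\<lbrakk>c \<in> U; v \<in> V\<rbrakk> \<Longrightarrow> k c \<odot>\<^bsub>L\<^esub> l v = l (cyc_smult c v)"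
  by (simp_all add: L_def)

lemma cyc_identities:
  "cyc_add (cyc_add u v) w = cyc_add u (cyc_add v w)" "cyc_add u v = cyc_add v u"
  "cyc_add cyc_zero u = u" "cyc_add (cyc_smult (-1) u) u = cyc_zero"
  "cyc_bracket (cyc_add u v) w = cyc_add (cyc_bracket u w) (cyc_bracket v w)"
  "cyc_bracket w (cyc_add u v) = cyc_add (cyc_bracket w u) (cyc_bracket w v)"
  "cyc_bracket u u = cyc_zero"
  "cyc_add (cyc_bracket u (cyc_bracket v w)) (cyc_add (cyc_bracket v (cyc_bracket w u))
     (cyc_bracket w (cyc_bracket u v))) = cyc_zero"
  "cyc_smult (a + c) u = cyc_add (cyc_smult a u) (cyc_smult c u)"
  "cyc_smult a (cyc_add u v) = cyc_add (cyc_smult a u) (cyc_smult a v)"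
  "cyc_smult (a * c) u = cyc_smult a (cyc_smult c u)" "cyc_smult 1 u = u"
  "cyc_bracket (cyc_smult a u) v = cyc_smult a (cyc_bracket u v)"
  "cyc_bracket u (cyc_smult a v) = cyc_smult a (cyc_bracket u v)"
  "cyc_deriv n (cyc_add u v) = cyc_add (cyc_deriv n u) (cyc_deriv n v)"
  "cyc_deriv n (cyc_smult a u) = cyc_smult a (cyc_deriv n u)"
  "cyc_deriv n (cyc_bracket u v) = cyc_add (cyc_bracket (cyc_deriv n u) v) (cyc_bracket u (cyc_deriv n v))"
  by (cases u; cases v; cases w; simp add: cyc_zero_def fun_eq_iff algebra_simps)+

declare cyc_add.simps [simp del] cyc_smult.simps [simp del] cyc_bracket.simps [simp del]
  cyc_deriv.simps [simp del]

lemma L_lie_ring: "lie_ring L"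
proof (intro lie_ring.intro lie_ring_axioms.intro abelian_groupI)
  fix x assume "x \<in> carrier L"
  then obtain u where "x = l u" "u \<in> V" by (auto simp: L_simps)
  thus "\<exists>y\<in>carrier L. y \<oplus>\<^bsub>L\<^esub> x = \<zero>\<^bsub>L\<^esub>"
    by (intro bexI[of _ "l (cyc_smult (-1) u)"]) (auto simp: L_simps cyc_identities(4))
next
  fix x y assume "x \<in> carrier L" "y \<in> carrier L"
  then obtain u v where "x = l u" "u \<in> V" "y = l v" "v \<in> V" by (auto simp: L_simps)
  thus "x \<oplus>\<^bsub>L\<^esub> y = y \<oplus>\<^bsub>L\<^esub> x" by (simp add: L_simps cyc_identities(2)[of u v])
qed (auto simp: L_simps cyc_identities(1,3,5-8))

lemma L_lie_algebra: "lie_algebra K L"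
proof -
  interpret L: lie_ring L by (rule L_lie_ring)
  interpret K: field K by (rule K_field)
  have "module K L"
    by (rule moduleI)
      (auto simp: L_simps K_simps cyc_identities(9-12) intro: K.is_cring L.abelian_group_axioms)
  hence "vectorspace K L" by (intro vectorspace.intro K_field)
  thus ?thesis
    by (intro lie_algebra.intro L_lie_ring lie_algebra_axioms.intro)
      (auto simp: L_simps K_simps cyc_identities(13,14))
qed

text \<open>The carrier is finite, so it is itself a finite spanning set.\<close>

lemma L_fin_dim: "vectorspace.fin_dim K L"
proof -
  interpret lie_algebra K L by (rule L_lie_algebra)
  have "span (carrier L) = carrier L"
    using span_is_subset2[of "carrier L"] in_own_span[of "carrier L"] by blast
  moreover have "finite (carrier L)" using finite_cyc_carrier[OF U_fin \<Lambda>_sub] by (simp add: L_simps)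
  ultimately show ?thesis unfolding fin_dim_def by blast
qed

definition D :: "nat \<Rightarrow> nat" where
  "D x = l (cyc_deriv n (l' x))"

lemma D_l: "v \<in> V \<Longrightarrow> D (l v) = l (cyc_deriv n v)"
  by (simp add: D_def)

lemma D_derivation: "lie_derivation K L D"
  unfolding lie_derivation_def LinearCombinations.module_hom_def
  by (auto simp: L_simps K_simps D_l cyc_identities(15-17))

lemma cyc_deriv_funpow:
  assumes "(f, s, w) \<in> V"
  shows "(cyc_deriv n ^^ j) (f, s, w) = ((\<lambda>x. x ^ j * f x), s, (\<lambda>i. if i < n then w ((i + j) mod n) else 0))"
proof (induction j)
  case 0
  show ?case using assms by (auto simp: cyc_carrier_def fun_eq_iff)
next
  case (Suc j)
  have "(Suc i mod n + j) mod n = (i + Suc j) mod n" for i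
    by (simp add: mod_add_left_eq)
  moreover have "Suc i mod n < n" for i using n_pos by simp
  ultimately show ?case using Suc by (simp add: cyc_deriv.simps fun_eq_iff mult.assoc)
qed

lemma D_funpow: "v \<in> V \<Longrightarrow> (D ^^ j) (l v) = l ((cyc_deriv n ^^ j) v) \<and> (cyc_deriv n ^^ j) v \<in> V"
  by (induction j) (auto simp: D_l)

lemma D_periodic: "periodic_of_order L D n"
  unfolding periodic_of_order_def
proof (intro conjI ballI allI impI notI)
  fix x assume "x \<in> carrier L"
  then obtain v where v: "x = l v" "v \<in> V" by (auto simp: L_simps)
  obtain f s w where e: "v = (f, s, w)" by (cases v)
  have "(\<lambda>x. x ^ n * f x) = f"
  proof
    fix x show "x ^ n * f x = f x"
      using v(2) \<Lambda>_pow[of x] by (cases "x \<in> \<Lambda>") (auto simp: e cyc_carrier_def)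
  qed
  moreover have "(\<lambda>i. if i < n then w ((i + n) mod n) else 0) = w"
    using v(2) by (auto simp: e cyc_carrier_def)
  ultimately have "(cyc_deriv n ^^ n) v = v" using cyc_deriv_funpow v(2) by (simp add: e)
  thus "(D ^^ n) x = x" using D_funpow[OF v(2)] v(1) by simp
next
  fix j assume j: "0 < j \<and> j < n" and id: "\<forall>x\<in>carrier L. (D ^^ j) x = x"
  \<comment> \<open>The first unit vector of the central summand; after \<open>j\<close> shifts its
    entry 1 stands at position \<open>n - j\<close>.\<close>
  define v :: "'f cyc" where "v = ((\<lambda>_. 0), 0, (\<lambda>i. if i = 0 then 1 else 0))"
  have v: "v \<in> V" using n_pos by (simp add: v_def cyc_carrier_def)
  hence "l ((cyc_deriv n ^^ j) v) = l v" using id D_funpow[OF v, of j] by (simp add: L_simps)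
  hence "(cyc_deriv n ^^ j) v = v" using l_inj D_funpow[OF v, of j] v by (auto dest: inj_onD)
  hence "(\<lambda>i. if i < n then (if (i + j) mod n = 0 then 1 else 0) else 0) = (\<lambda>i. if i = (0::nat) then (1::'f) else 0)"
    using cyc_deriv_funpow[of _ _ _ j] v unfolding v_def by simp
  from fun_cong[OF this, of "n - j"] show False using j by simp
qed

text \<open>The weights are closed under predecessors, so every weight vector is the bracket of
  another one with \<open>t\<close> and hence lies in all terms of the lower central series.\<close>

lemma not_nilpotent: "\<not> lie_nilpotent L"
proof
  assume "lie_nilpotent L"
  then obtain c where c: "lower_central L c = {\<zero>\<^bsub>L\<^esub>}" by (auto simp: lie_nilpotent_def)
  define e :: "'f \<Rightarrow> 'f cyc" where "e x = ((\<lambda>z. if z = x then 1 else 0), 0, (\<lambda>_. 0))" for x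
  define t :: "'f cyc" where "t = ((\<lambda>_. 0), 1, (\<lambda>_. 0))"
  have eV: "e x \<in> V" if "x \<in> \<Lambda>" for x using that by (auto simp: e_def cyc_carrier_def)
  have tV: "t \<in> V" by (simp add: t_def cyc_carrier_def)
  have step: "cyc_bracket (e (x - 1)) t = e x" for x by (auto simp: e_def t_def fun_eq_iff cyc_bracket.simps)
  have "l (e x) \<in> lower_central L i" if "x \<in> \<Lambda>" for x i
    using that
  proof (induction i arbitrary: x)
    case 0
    thus ?case using eV by (simp add: L_simps)
  next
    case (Suc i)
    have "l (e (x - 1)) \<in> lower_central L i" using Suc \<Lambda>_pred by blast
    moreover have "l t \<in> carrier L" using tV by (simp add: L_simps)
    moreover have "l (e x) = l (e (x - 1)) \<otimes>\<^bsub>L\<^esub> l t"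
      using eV[OF \<Lambda>_pred[OF Suc.prems]] tV by (simp add: L_simps step)
    ultimately show ?case by (auto intro: generate.incl)
  qed
  moreover obtain x where x: "x \<in> \<Lambda>" using \<Lambda>_ne by blast
  ultimately have "l (e x) = l cyc_zero" using c by (force simp: L_simps)
  hence "e x = cyc_zero" using l_inj eV[OF x] by (auto dest: inj_onD)
  hence "(\<lambda>z. if z = x then 1 else 0) = (\<lambda>_. 0 :: 'f)" by (simp add: e_def cyc_zero_def)
  from fun_cong[OF this, of x] show False by simp
qed

end

text \<open>The powers \<gamma>^(p^i) are \<open>n\<close>-th roots of unity, so two of them
  coincide. Injectivity of the Frobenius map gives \<gamma>^q = \<gamma> for a power q > 1 of p, and
  the fixed points of x \<mapsto> x^q form a finite field containing the coset.\<close>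

lemma exists_periodic_counterexample:
  fixes \<gamma> :: "'f::field"
  assumes p: "prime p" "CHAR('f) = p" and n: "n > 0" and \<gamma>: "\<And>k. (\<gamma> + of_nat k) ^ n = 1"
  shows "\<exists>(K :: nat ring) (L :: (nat, nat) module) D.
        lie_algebra K L \<and> characteristic K = p \<and> vectorspace.fin_dim K L \<and>
        lie_derivation K L D \<and> periodic_of_order L D n \<and> \<not> lie_nilpotent L"
proof -
  have C: "prime CHAR('f)" using p by simp
  have fd: "(x + y) ^ (p ^ e) = x ^ (p ^ e) + y ^ (p ^ e)" for x y :: 'f and e
    by (rule freshmans_dream'[OF C]) (simp add: p)
  have p0: "p > 1" using p prime_gt_1_nat by blast
  have "range (\<lambda>i::nat. \<gamma> ^ (p ^ i)) \<subseteq> {x. x ^ n = 1}"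
  proof
    fix x assume "x \<in> range (\<lambda>i::nat. \<gamma> ^ (p ^ i))"
    then obtain i where "x = \<gamma> ^ (p ^ i)" by blast
    hence "x ^ n = (\<gamma> ^ n) ^ (p ^ i)" by (simp add: power_mult[symmetric] mult.commute)
    thus "x \<in> {x. x ^ n = 1}" using \<gamma>[of 0] by simp
  qed
  hence "finite (range (\<lambda>i::nat. \<gamma> ^ (p ^ i)))" using finite_roots_of_unity[OF n] finite_subset by blast
  hence "\<not> inj (\<lambda>i::nat. \<gamma> ^ (p ^ i))" using finite_imageD[of _ UNIV] by blast
  then obtain i j where ij: "i < j" "\<gamma> ^ (p ^ i) = \<gamma> ^ (p ^ j)"
    unfolding inj_def by (metis linorder_neqE_nat)
  define q where "q = p ^ (j - i)"
  have q1: "q > 1" unfolding q_def using p0 ij(1) by (intro one_less_power) auto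
  have fq: "(x + y) ^ q = x ^ q + y ^ q" for x y :: 'f unfolding q_def by (rule fd)
  have "\<gamma> ^ q = \<gamma>"
  proof -
    have "(\<gamma> ^ q - \<gamma>) ^ (p ^ i) + \<gamma> ^ (p ^ i) = (\<gamma> ^ q) ^ (p ^ i)"
      using fd[of "\<gamma> ^ q - \<gamma>" \<gamma> i] by simp
    also have "\<dots> = \<gamma> ^ (p ^ j)" using ij(1) by (simp add: q_def power_mult[symmetric] power_add[symmetric])
    finally have "(\<gamma> ^ q - \<gamma>) ^ (p ^ i) = 0" using ij(2) by simp
    thus ?thesis by simp
  qed
  define U where "U = {x :: 'f. x ^ q = x}"
  define \<Lambda> where "\<Lambda> = range (\<lambda>k. \<gamma> + of_nat k)"
  have U_fin: "finite U"
  proof -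
    have "coeff (monom 1 q - monom 1 1 :: 'f poly) q = 1" using q1 by simp
    hence "monom 1 q - monom 1 1 \<noteq> (0 :: 'f poly)" by (metis coeff_0 zero_neq_one)
    hence "finite {x. poly (monom 1 q - monom 1 1 :: 'f poly) x = 0}" by (rule poly_roots_finite)
    thus ?thesis by (simp add: U_def poly_monom)
  qed
  \<comment> \<open>Read off from 1 + (-1) = 0 by additivity of the q-th power, which includes p =
    2.\<close>
  have minus1: "(-1 :: 'f) ^ q = -1"
    using fq[of 1 "-1"] q1 by (simp add: power_0_left eq_neg_iff_add_eq_0 add.commute)
  have U1: "0 \<in> U" "1 \<in> U" "\<And>x y. \<lbrakk>x \<in> U; y \<in> U\<rbrakk> \<Longrightarrow> x + y \<in> U" "\<And>x y. \<lbrakk>x \<in> U; y \<in> U\<rbrakk> \<Longrightarrow> x * y \<in> U"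
    "\<And>x. x \<in> U \<Longrightarrow> inverse x \<in> U"
    using q1 by (auto simp: U_def fq power_mult_distrib power_inverse power_0_left)
  have U_minus: "- x \<in> U" if "x \<in> U" for x
    using U1(4)[of "-1" x] minus1 that by (simp add: U_def)
  have "of_nat m \<in> U" for m by (induction m) (auto intro: U1)
  hence \<Lambda>U: "\<Lambda> \<subseteq> U" using \<open>\<gamma> ^ q = \<gamma>\<close> by (auto simp: \<Lambda>_def U_def fq)
  have succ: "x + 1 \<in> \<Lambda>" if "x \<in> \<Lambda>" for x
  proof -
    from that obtain m where "x = \<gamma> + of_nat m" by (auto simp: \<Lambda>_def)
    hence "x + 1 = \<gamma> + of_nat (Suc m)" by (simp add: add_ac)
    thus ?thesis unfolding \<Lambda>_def by blast
  qed
  have pred: "x - 1 \<in> \<Lambda>" if "x \<in> \<Lambda>" for x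
  proof -
    from that obtain m where m: "x = \<gamma> + of_nat m" by (auto simp: \<Lambda>_def)
    \<comment> \<open>The coset is indexed by natural numbers, so subtracting 1 is done by adding p
      - 1.\<close>
    have "of_nat p = (0 :: 'f)" using p(2) of_nat_CHAR[where 'a = 'f] by simp
    hence "\<gamma> + of_nat (m + (p - 1)) = x - 1" using p0 m by (simp add: of_nat_diff)
    thus ?thesis unfolding \<Lambda>_def by (metis rangeI)
  qed
  obtain k :: "'f \<Rightarrow> nat" where k: "inj_on k U" using finite_imp_inj_to_nat_seg[OF U_fin] by blast
  obtain l :: "'f cyc \<Rightarrow> nat" where l: "inj_on l (cyc_carrier U \<Lambda> n)"
    using finite_imp_inj_to_nat_seg[OF finite_cyc_carrier[OF U_fin \<Lambda>U]] by blast
  interpret C: cyclic_lie_algebra U \<Lambda> n k l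
  proof
    show "\<Lambda> \<noteq> {}" by (simp add: \<Lambda>_def)
    show "x ^ n = 1" if "x \<in> \<Lambda>" for x using that \<gamma> by (auto simp: \<Lambda>_def)
  qed (fact U1 U_minus U_fin \<Lambda>U succ pred n k l)+
  have "characteristic C.K = p" using C.K_characteristic p0 p by simp
  thus ?thesis
    using C.L_lie_algebra C.L_fin_dim C.D_derivation C.D_periodic C.not_nilpotent by blast
qed

section \<open>Assembly over an arbitrary ground field of characteristic p\<close>

lemma (in lie_algebra) characteristic_multiple_zero:
  assumes "characteristic K = p" "p > 0" "y \<in> carrier L"
  shows "[p] \<cdot>\<^bsub>L\<^esub> y = \<zero>\<^bsub>L\<^esub>"
proof -
  have "[(j::nat)] \<cdot>\<^bsub>L\<^esub> y = ([j] \<cdot> \<one>) \<odot>\<^bsub>L\<^esub> y" for j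
  proof (induction j)
    case (Suc j)
    have "[(Suc j)] \<cdot>\<^bsub>L\<^esub> y = [j] \<cdot>\<^bsub>L\<^esub> y \<oplus>\<^bsub>L\<^esub> y" using assms(3) by simp
    also have "\<dots> = ([j] \<cdot> \<one> \<oplus> \<one>) \<odot>\<^bsub>L\<^esub> y" using Suc assms(3) by (simp add: smult_l_distr)
    finally show ?case by simp
  qed (use assms(3) in \<open>simp add: smult_l_null\<close>)
  moreover have ex: "\<exists>m::nat. m > 0 \<and> [m] \<cdot> \<one> = \<zero>"
    using assms(1,2) by (auto simp: characteristic_def split: if_splits)
  hence "[p] \<cdot> \<one> = \<zero>"
    using LeastI_ex[OF ex] assms(1) by (simp add: characteristic_def)
  ultimately show ?thesis using assms(3) by (simp add: smult_l_null)
qed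

theorem proposition3p18:
  fixes p n :: nat
  assumes "p = CARD('p::prime_card)" and "n > 0"
    and "infinite (UNIV :: 'l set)" and "infinite (UNIV :: 'a set)"
  shows "(n \<notin> bad_orders TYPE('p) \<longrightarrow>
      (\<forall>(K :: 'k ring) (L :: ('k, 'g) module) D.
        lie_algebra K L \<and> characteristic K = p \<and> vectorspace.fin_dim K L \<and>
        lie_derivation K L D \<and> periodic_of_order L D n \<longrightarrow>
        lie_nilpotent L \<and> nilpotency_class L \<le> higman_map TYPE('l) TYPE('a) n)) \<and>
    (n \<in> bad_orders TYPE('p) \<longrightarrow>
      (\<exists>(K :: nat ring) (L :: (nat, nat) module) D.
        lie_algebra K L \<and> characteristic K = p \<and> vectorspace.fin_dim K L \<and>
        lie_derivation K L D \<and> periodic_of_order L D n \<and> \<not> lie_nilpotent L))"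
proof -
  have p: "prime p" using prime_card[where 'a = 'p] assms(1) by simp
  have C: "CHAR('p mod_ring alg_closure) = p" using assms(1) by simp
  have "lie_nilpotent L \<and> nilpotency_class L \<le> higman_map TYPE('l) TYPE('a) n"
    if n: "n \<notin> bad_orders TYPE('p)"
      and h: "lie_algebra K L" "characteristic K = p" "lie_derivation K L D" "periodic_of_order L D n"
    for K :: "'k ring" and L :: "('k, 'g) module" and D
  proof -
    interpret lie_algebra K L by fact
    have D: "D x \<in> carrier L" "(D ^^ n) x = x" if "x \<in> carrier L" for x
      using h(3,4) that by (auto simp: lie_derivation_def LinearCombinations.module_hom_def periodic_of_order_def)
    have D2: "D (x \<oplus>\<^bsub>L\<^esub> y) = D x \<oplus>\<^bsub>L\<^esub> D y" "D (x \<otimes>\<^bsub>L\<^esub> y) = (D x \<otimes>\<^bsub>L\<^esub> y) \<oplus>\<^bsub>L\<^esub> (x \<otimes>\<^bsub>L\<^esub> D y)"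
      if "x \<in> carrier L" "y \<in> carrier L" for x y
      using h(3) that by (auto simp: lie_derivation_def LinearCombinations.module_hom_def)
    have pz: "[p] \<cdot>\<^bsub>L\<^esub> y = \<zero>\<^bsub>L\<^esub>" if "y \<in> carrier L" for y
      using characteristic_multiple_zero[OF h(2) prime_gt_0_nat[OF p] that] .
    obtain m where m: "n = p ^ multiplicity p n * m" "\<not> p dvd m"
      using multiplicity_decompose'[of n p] assms(2) p by (metis not_prime_unit not_gr0)
    have m0: "m > 0" using m assms(2) by (cases m) auto
    \<comment> \<open>Multiples of bad orders are bad, so removing the p-part of a good order leaves
      a good one.\<close>
    have "m \<notin> bad_orders TYPE('p)"
      using bad_orders_multiple[of m "TYPE('p)" "p ^ multiplicity p n"] n m(1) prime_gt_0_nat[OF p] by auto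
    hence free: "\<not> (\<exists>\<alpha> \<beta> :: 'p mod_ring alg_closure. \<alpha> ^ m = 1 \<and> \<beta> ^ m = 1 \<and>
        (\<forall>k. (\<alpha> + of_nat k * \<beta>) ^ m = 1))"
      using bad_orderI[OF m0] by blast
    have "lower_central L (higman_map TYPE('l) TYPE('a) n) = {\<zero>\<^bsub>L\<^esub>}"
      by (rule lower_central_periodic_derivation[OF p pz C D(1) D2 D(2) m(1) m0 m(2) free assms(3,4)])
    thus ?thesis using nilpotency_class_le_iff by blast
  qed
  moreover have "\<exists>(K :: nat ring) (L :: (nat, nat) module) D.
        lie_algebra K L \<and> characteristic K = p \<and> vectorspace.fin_dim K L \<and>
        lie_derivation K L D \<and> periodic_of_order L D n \<and> \<not> lie_nilpotent L"
    if bad: "n \<in> bad_orders TYPE('p)"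
  proof -
    obtain \<gamma> :: "'p mod_ring alg_closure" where "\<And>k. (\<gamma> + of_nat k) ^ n = 1"
      using bad_orderE[OF bad] by blast
    thus ?thesis by (rule exists_periodic_counterexample[OF p C assms(2)])
  qed
  ultimately show ?thesis by blast
qed

end
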